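(* There exists an algorithm that: (i) accepts as input a real quadratic field $F$; if $F$ is $2$-stage euclidean, the algorithm terminates and it proves that $F$ is $2$-stage euclidean; (ii) if $F$ is $2$-stage euclidean, after finishing step (i) it accepts as input any $x\in F$ and it computes a continued fraction with coefficients in $\mathcal{O}_F$ for $x$, i.e. it computes a finite list $q_1,\dots,q_n\in\mathcal{O}_F$ with $x=[q_1,\dots,q_n]$.
   Context: $\mathcal{O}_F$ denotes the ring of integers (maximal order) of the number field $F$, and $\operatorname{Nm}$ the norm of $F/\mathbb{Q}$. Continued fractions: given $q_1,\dots,q_n\in\mathcal{O}_F$, the finite continued fraction $[q_1,\dots,q_n]\in F$ is defined inductively by $[q_1]=q_1$, $[q_1,q_2]=q_1+\frac{1}{q_2}$, and $[q_1,q_2,\dots,q_n]=[q_1,[q_2,\dots,q_n]]$ (whenever the divisions make sense). Division chains: a $1$-stage division chain for $\alpha,\beta\in\mathcal{O}_F$ is a pair $(q_1,r_1)$ of elements of $\mathcal{O}_F$ with $\alpha=q_1\beta+r_1$. A $2$-stage division chain for $\alpha,\beta$ is a quadruple $(q_1,q_2,r_1,r_2)$ of elements of $\mathcal{O}_F$ with $\alpha=q_1\beta+r_1$ and $\beta=q_2r_1+r_2$. A $k$-stage division chain ($k\in\{1,2\}$) is decreasing if $|\operatorname{Nm}(r_k)|<|\operatorname{Nm}(\beta)|$. The field $F$ is $2$-stage euclidean if every pair $\alpha,\beta\in\mathcal{O}_F$ with $\beta\neq 0$ has a $k$-stage decreasing chain for some $k\le 2$. That the algorithm "proves" that $F$ is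 $2$-stage euclidean means that its termination on input $F$ establishes that $F$ is $2$-stage euclidean (in particular, it does not terminate on a real quadratic field that is not $2$-stage euclidean). *)

theory Defs
  imports
    Complex_Main
    "HOL-Library.FuncSet"
    "HOL-Library.Nat_Bijection"
    "HOL-Computational_Algebra.Polynomial"
    "HOL-Computational_Algebra.Squarefree"
begin

section \<open>Real quadratic fields, norm, integers\<close>

definition real_subfield :: "real set \<Rightarrow> bool" where
  "real_subfield F \<longleftrightarrow> 1 \<in> F \<and>
     (\<forall>x\<in>F. \<forall>y\<in>F. x - y \<in> F \<and> x * y \<in> F) \<and> (\<forall>x\<in>F. inverse x \<in> F)"

text \<open>Up to isomorphism every real quadratic field is a subfield of the real numbers.\<close>

definition real_quadratic_field :: "real set \<Rightarrow> bool" where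
  "real_quadratic_field F \<longleftrightarrow>
     real_subfield F \<and> vector_space.dim (\<lambda>(q::rat) (x::real). of_rat q * x) F = 2"

definition ring_of_integers :: "real set \<Rightarrow> real set" where
  "ring_of_integers F = {x \<in> F. algebraic_int x}"

definition complex_embeddings :: "real set \<Rightarrow> (real \<Rightarrow> complex) set" where
  "complex_embeddings F = {\<sigma> \<in> extensional F. \<sigma> 1 = 1 \<and>
     (\<forall>x\<in>F. \<forall>y\<in>F. \<sigma> (x + y) = \<sigma> x + \<sigma> y \<and> \<sigma> (x * y) = \<sigma> x * \<sigma> y)}"

definition field_norm :: "real set \<Rightarrow> real \<Rightarrow> complex" where
  "field_norm F x = (\<Prod>\<sigma>\<in>complex_embeddings F. \<sigma> x)"


section \<open>Division chains\<close>

definition division_chain1 :: "real set \<Rightarrow> real \<Rightarrow> real \<Rightarrow> real \<Rightarrow> real \<Rightarrow> bool" where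
  "division_chain1 F \<alpha> \<beta> q1 r1 \<longleftrightarrow>
     {q1, r1} \<subseteq> ring_of_integers F \<and> \<alpha> = q1 * \<beta> + r1"

definition division_chain2 ::
  "real set \<Rightarrow> real \<Rightarrow> real \<Rightarrow> real \<Rightarrow> real \<Rightarrow> real \<Rightarrow> real \<Rightarrow> bool" where
  "division_chain2 F \<alpha> \<beta> q1 q2 r1 r2 \<longleftrightarrow>
     {q1, q2, r1, r2} \<subseteq> ring_of_integers F \<and> \<alpha> = q1 * \<beta> + r1 \<and> \<beta> = q2 * r1 + r2"

definition decreasing :: "real set \<Rightarrow> real \<Rightarrow> real \<Rightarrow> bool" where
  "decreasing F \<beta> r \<longleftrightarrow> norm (field_norm F r) < norm (field_norm F \<beta>)"

definition two_stage_euclidean :: "real set \<Rightarrow> bool" where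
  "two_stage_euclidean F \<longleftrightarrow>
     (\<forall>\<alpha>\<in>ring_of_integers F. \<forall>\<beta>\<in>ring_of_integers F. \<beta> \<noteq> 0 \<longrightarrow>
        (\<exists>q1 r1. division_chain1 F \<alpha> \<beta> q1 r1 \<and> decreasing F \<beta> r1) \<or>
        (\<exists>q1 q2 r1 r2. division_chain2 F \<alpha> \<beta> q1 q2 r1 r2 \<and> decreasing F \<beta> r2))"


section \<open>Continued fractions\<close>

text \<open>The value is \<open>None\<close> for the empty list and when a division by zero occurs.\<close>

fun continued_fraction :: "real list \<Rightarrow> real option" where
  "continued_fraction [] = None"
| "continued_fraction [q] = Some q"
| "continued_fraction (q # q' # qs) =
     (case continued_fraction (q' # qs) of
        None \<Rightarrow> None
      | Some y \<Rightarrow> if y = 0 then None else Some (q + 1 / y))"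


section \<open>Algorithms\<close>

text \<open>
  Algorithms are Kleene's \<open>\<mu>\<close>-recursive functions on natural numbers, and \<open>None\<close> means
  that the computation does not terminate. Programs carry no arity: arguments beyond those a
  program inspects are ignored, and a program that lacks an argument yields \<open>None\<close>.
\<close>

datatype recf =
    Zero
  | Succ
  | Proj nat
  | Comp recf "recf list"
  | PrimRec recf recf
  | Mu recf

primrec eval_recf :: "recf \<Rightarrow> nat list \<Rightarrow> nat option" where
  "eval_recf Zero xs = Some 0"
| "eval_recf Succ xs = (case xs of [] \<Rightarrow> None | x # _ \<Rightarrow> Some (Suc x))"
| "eval_recf (Proj i) xs = (if i < length xs then Some (xs ! i) else None)"
| "eval_recf (Comp f gs) xs =
     Option.bind (those (map (\<lambda>h. h xs) (map eval_recf gs))) (eval_recf f)"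
| "eval_recf (PrimRec f g) xs =
     (case xs of
        [] \<Rightarrow> None
      | n # ys \<Rightarrow> rec_nat (eval_recf f ys)
                   (\<lambda>k r. Option.bind r (\<lambda>v. eval_recf g (k # v # ys))) n)"
| "eval_recf (Mu f) xs =
     (if \<exists>n. eval_recf f (n # xs) = Some 0 \<and> (\<forall>i<n. \<exists>v. eval_recf f (i # xs) = Some (Suc v))
      then Some (LEAST n. eval_recf f (n # xs) = Some 0)
      else None)"

definition halts :: "recf \<Rightarrow> nat list \<Rightarrow> bool" where
  "halts P xs \<longleftrightarrow> eval_recf P xs \<noteq> None"


section \<open>Encoding of inputs and outputs\<close>

definition field_code :: "real set \<Rightarrow> nat \<Rightarrow> bool" where
  "field_code F d \<longleftrightarrow> 1 < d \<and> squarefree d \<and> sqrt (real d) \<in> F"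

text \<open>
  A code consists of \<open>a, b, c\<close> and stands for \<open>(a + b \<surd>d) / (c + 1)\<close>. It need not be in
  lowest terms, so every element has many codes.
\<close>

definition element_of_code :: "nat \<Rightarrow> nat \<Rightarrow> real" where
  "element_of_code d n =
     (let (a, m) = prod_decode n; (b, c) = prod_decode m
      in (of_int (int_decode a) + of_int (int_decode b) * sqrt (real d)) / real (Suc c))"


section \<open>Adequacy of the definitions\<close>

definition rat_sqrt :: "nat \<Rightarrow> real set" where
  "rat_sqrt d = {of_rat a + of_rat b * sqrt (real d) | a b. True}"

lemma vector_space_rat_real: "vector_space (\<lambda>(q::rat) (x::real). of_rat q * x)"
  by unfold_locales (auto simp: algebra_simps of_rat_add of_rat_mult)

lemma real_subfield_closed:
  assumes "real_subfield F"
  shows "0 \<in> F" "1 \<in> F" "\<And>x y. x \<in> F \<Longrightarrow> y \<in> F \<Longrightarrow> x - y \<in> F"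
    "\<And>x y. x \<in> F \<Longrightarrow> y \<in> F \<Longrightarrow> x + y \<in> F" "\<And>x y. x \<in> F \<Longrightarrow> y \<in> F \<Longrightarrow> x * y \<in> F"
    "\<And>x y. x \<in> F \<Longrightarrow> y \<in> F \<Longrightarrow> x / y \<in> F" "\<And>x. x \<in> F \<Longrightarrow> - x \<in> F"
    "\<And>n. real n \<in> F" "\<And>k. real_of_int k \<in> F" "\<And>q. real_of_rat q \<in> F"
proof -
  show 1: "1 \<in> F" and minus: "\<And>x y. x \<in> F \<Longrightarrow> y \<in> F \<Longrightarrow> x - y \<in> F"
    and times: "\<And>x y. x \<in> F \<Longrightarrow> y \<in> F \<Longrightarrow> x * y \<in> F"
    using assms by (auto simp: real_subfield_def)
  show 0: "0 \<in> F" using minus[OF 1 1] by simp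
  show uminus: "- x \<in> F" if "x \<in> F" for x using minus[OF 0 that] by simp
  show plus: "x + y \<in> F" if "x \<in> F" "y \<in> F" for x y
    using minus[OF that(1) uminus[OF that(2)]] by simp
  show div: "x / y \<in> F" if "x \<in> F" "y \<in> F" for x y
    using assms that times[of x "inverse y"] by (auto simp: real_subfield_def divide_inverse)
  show nat: "real n \<in> F" for n
    by (induction n) (auto intro: 0 1 plus)
  show int: "real_of_int k \<in> F" for k
    by (cases k) (use nat uminus in \<open>auto simp del: of_nat_Suc\<close>)
  show "real_of_rat q \<in> F" for q
    by (cases q) (auto simp: of_rat_rat intro: div int)
qed

lemma sqrt_squarefree_irrational:
  assumes "1 < d" "squarefree d"
  shows "sqrt (real d) \<notin> \<rat>"
proof
  assume rat: "sqrt (real d) \<in> \<rat>"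
  have "algebraic_int (sqrt (real d))"
    by (rule algebraic_int.intros[of "[:- real d, 0, 1:]"])
       (auto simp: coeff_pCons power2_eq_square split: nat.splits)
  with rat have "sqrt (real d) \<in> \<int>" by (rule rational_algebraic_int_is_int[rotated])
  then obtain k where k: "sqrt (real d) = real_of_int k" by (elim Ints_cases)
  have "real d = (sqrt (real d))\<^sup>2" by simp
  also have "\<dots> = real_of_int (k\<^sup>2)" by (simp add: k)
  also have "\<dots> = real ((nat \<bar>k\<bar>)\<^sup>2)" by simp
  finally have d: "d = (nat \<bar>k\<bar>)\<^sup>2" by (simp only: of_nat_eq_iff)
  then have "(nat \<bar>k\<bar>)\<^sup>2 dvd d" by simp
  then have "nat \<bar>k\<bar> dvd 1" using assms(2) by (auto simp: squarefree_def)
  with d assms(1) show False by simp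
qed

lemma of_real_of_rat: "complex_of_real (of_rat q) = of_rat q"
  by (cases q) (simp add: of_rat_rat)

lemma independent_one_sqrt:
  fixes r :: real
  assumes "r \<notin> \<rat>"
  shows "\<not> module.dependent (\<lambda>(q::rat) (x::real). of_rat q * x) {1, r}"
    and "x \<in> module.span (\<lambda>(q::rat) (x::real). of_rat q * x) {1, r} \<longleftrightarrow>
           (\<exists>a b. x = of_rat a + of_rat b * r)"
    and "1 \<noteq> r"
proof -
  interpret V: vector_space "\<lambda>(q::rat) (x::real). of_rat q * x" by (rule vector_space_rat_real)
  show "1 \<noteq> r" using assms by auto
  have "r \<notin> V.span {1}" using assms by (auto simp: V.span_singleton)
  then have "V.independent (insert r {1})"
    by (rule V.independent_insertI) (simp add: V.dependent_single)
  then show "V.independent {1, r}" by (simp add: insert_commute)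
  show "x \<in> V.span {1, r} \<longleftrightarrow> (\<exists>a b. x = of_rat a + of_rat b * r)"
    unfolding V.span_insert[of 1 "{r}"] V.span_singleton
    by (simp add: image_iff diff_eq_eq add.commute)
qed

theorem real_quadratic_field_rat_sqrt:
  assumes "1 < d" "squarefree d"
  shows "real_quadratic_field (rat_sqrt d)" "field_code (rat_sqrt d) d"
proof -
  define r where "r = sqrt (real d)"
  have r2: "r * r = of_rat (of_nat d)" by (simp add: r_def)
  have irr: "r \<notin> \<rat>" using sqrt_squarefree_irrational[OF assms] by (simp add: r_def)
  interpret V: vector_space "\<lambda>(q::rat) (x::real). of_rat q * x" by (rule vector_space_rat_real)
  have memI: "of_rat a + of_rat b * r \<in> rat_sqrt d" for a b by (auto simp: rat_sqrt_def r_def)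
  have one: "1 \<in> rat_sqrt d" using memI[of 1 0] by simp
  have sqrt: "r \<in> rat_sqrt d" using memI[of 0 1] by simp
  show "field_code (rat_sqrt d) d" using assms sqrt by (simp add: field_code_def r_def)
  have sub: "x - y \<in> rat_sqrt d" if "x \<in> rat_sqrt d" "y \<in> rat_sqrt d" for x y
  proof -
    obtain a b a' b' where "x = of_rat a + of_rat b * r" "y = of_rat a' + of_rat b' * r"
      using \<open>x \<in> _\<close> \<open>y \<in> _\<close> by (auto simp: rat_sqrt_def r_def)
    then have "x - y = of_rat (a - a') + of_rat (b - b') * r"
      by (simp add: of_rat_diff algebra_simps)
    then show ?thesis using memI by simp
  qed
  have mult: "x * y \<in> rat_sqrt d" if "x \<in> rat_sqrt d" "y \<in> rat_sqrt d" for x y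
  proof -
    obtain a b a' b' where "x = of_rat a + of_rat b * r" "y = of_rat a' + of_rat b' * r"
      using \<open>x \<in> _\<close> \<open>y \<in> _\<close> by (auto simp: rat_sqrt_def r_def)
    then have "x * y = of_rat a * of_rat a' + of_rat b * of_rat b' * (r * r)
                 + (of_rat a * of_rat b' + of_rat b * of_rat a') * r"
      by (simp add: algebra_simps)
    also have "\<dots> = of_rat (a * a' + b * b' * of_nat d) + of_rat (a * b' + b * a') * r"
      unfolding r2 by (simp add: of_rat_add of_rat_mult)
    finally show ?thesis using memI by simp
  qed
  have inv: "inverse x \<in> rat_sqrt d" if x: "x \<in> rat_sqrt d" for x
  proof (cases "x = 0")
    case False
    obtain a b where ab: "x = of_rat a + of_rat b * r"
      using x by (auto simp: rat_sqrt_def r_def)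
    let ?N = "a * a - b * b * of_nat d"
    let ?y = "of_rat a - of_rat b * r"
    have y: "?y \<noteq> 0"
    proof
      assume y0: "?y = 0"
      show False
      proof (cases "b = 0")
        case True with y0 ab False show False by simp
      next
        case False
        then have "r = of_rat (a / b)" using y0 by (simp add: of_rat_divide field_simps)
        with irr show False by simp
      qed
    qed
    have "x * ?y = of_rat a * of_rat a - of_rat b * of_rat b * (r * r)"
      unfolding ab by (simp add: algebra_simps)
    then have xy: "x * ?y = of_rat ?N"
      unfolding r2 by (simp add: of_rat_diff of_rat_mult)
    have "of_rat ?N \<noteq> (0::real)" using False y xy by (metis mult_eq_0_iff)
    with xy False have "inverse x = ?y / of_rat ?N" by (simp add: field_simps)
    also have "\<dots> = of_rat (a / ?N) + of_rat (- b / ?N) * r"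
      by (simp add: of_rat_divide of_rat_minus diff_divide_distrib)
    finally show ?thesis using memI by (simp only:)
  qed (use sub[OF one one] in simp)
  have "V.dim (rat_sqrt d) = 2"
  proof (rule V.dim_unique)
    show "{1, r} \<subseteq> rat_sqrt d" using one sqrt by simp
    show "rat_sqrt d \<subseteq> V.span {1, r}"
      using independent_one_sqrt(2)[OF irr] by (auto simp: rat_sqrt_def r_def)
    show "V.independent {1, r}" by (rule independent_one_sqrt(1)[OF irr])
    show "card {1, r} = 2" using independent_one_sqrt(3)[OF irr] by simp
  qed
  then show "real_quadratic_field (rat_sqrt d)"
    using one sub mult inv by (auto simp: real_quadratic_field_def real_subfield_def)
qed

theorem real_quadratic_field_eq_rat_sqrt:
  assumes F: "real_quadratic_field F" and d: "field_code F d"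
  shows "F = rat_sqrt d"
proof
  interpret V: vector_space "\<lambda>(q::rat) (x::real). of_rat q * x" by (rule vector_space_rat_real)
  define r where "r = sqrt (real d)"
  have sf: "real_subfield F" and dim: "V.dim F = 2" using F by (auto simp: real_quadratic_field_def)
  note cl = real_subfield_closed[OF sf]
  have rF: "r \<in> F" using d by (simp add: field_code_def r_def)
  then show "rat_sqrt d \<subseteq> F" using cl by (auto simp: rat_sqrt_def r_def)
  have irr: "r \<notin> \<rat>"
    using d sqrt_squarefree_irrational by (simp add: field_code_def r_def)
  note ind = independent_one_sqrt[OF irr]
  obtain B where B: "B \<subseteq> F" "V.independent B" "F \<subseteq> V.span B" "card B = 2"
    using V.basis_exists[of F] dim by metis
  then have fB: "finite B" by (intro card_ge_0_finite) simp
  show "F \<subseteq> rat_sqrt d"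
  proof
    fix x assume x: "x \<in> F"
    have "x \<in> V.span {1, r}"
    proof (rule ccontr)
      assume nx: "x \<notin> V.span {1, r}"
      then have "V.independent {x, 1, r}" using ind(1) by (rule V.independent_insertI)
      moreover have "{x, 1, r} \<subseteq> V.span B" using B x rF cl(2) by auto
      ultimately have "card {x, 1, r} \<le> card B"
        using V.independent_span_bound[OF fB] by blast
      moreover have "x \<notin> {1, r}" using nx V.span_base by blast
      ultimately show False using ind(3) B(4) by simp
    qed
    then show "x \<in> rat_sqrt d" using ind(2) by (auto simp: rat_sqrt_def r_def)
  qed
qed

theorem real_quadratic_field_has_code:
  assumes F: "real_quadratic_field F"
  shows "\<exists>d. field_code F d"
proof -
  interpret V: vector_space "\<lambda>(q::rat) (x::real). of_rat q * x" by (rule vector_space_rat_real)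
  have sf: "real_subfield F" and dim: "V.dim F = 2" using F by (auto simp: real_quadratic_field_def)
  note cl = real_subfield_closed[OF sf]
  have "\<exists>\<theta>\<in>F. \<theta> \<notin> \<rat>"
  proof (rule ccontr)
    assume "\<not> ?thesis"
    then have "F \<subseteq> V.span {1}" by (auto simp: V.span_singleton Rats_def)
    then have "V.dim F \<le> card {1::real}" by (intro V.dim_le_card) auto
    with dim show False by simp
  qed
  then obtain \<theta> where \<theta>: "\<theta> \<in> F" "\<theta> \<notin> \<rat>" by blast
  note ind = independent_one_sqrt[OF \<theta>(2)]
  obtain B where B: "{1, \<theta>} \<subseteq> B" "B \<subseteq> F" "V.independent B" "F \<subseteq> V.span B"
    using V.maximal_independent_subset_extend[of "{1, \<theta>}" F] \<theta> cl(2) ind(1) by blast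
  have "card B = 2" using V.basis_card_eq_dim[OF B(2) B(4) B(3)] dim by simp
  moreover have "finite B" using \<open>card B = 2\<close> by (intro card_ge_0_finite) simp
  ultimately have "B = {1, \<theta>}" using card_seteq[of B "{1, \<theta>}"] B(1) ind(3) by simp
  moreover have "\<theta> * \<theta> \<in> F" using \<theta> cl(5) by blast
  ultimately have "\<theta> * \<theta> \<in> V.span {1, \<theta>}" using B(4) by blast
  then obtain p q where pq: "\<theta> * \<theta> = of_rat p + of_rat q * \<theta>" using ind(2) by blast
  define \<eta> where "\<eta> = 2 * \<theta> - of_rat q"
  have \<eta>F: "\<eta> \<in> F" unfolding \<eta>_def using cl(3) cl(5) cl(8)[of 2] cl(10) \<theta>(1) by simp
  have \<eta>irr: "\<eta> \<notin> \<rat>"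
  proof
    assume "\<eta> \<in> \<rat>"
    then have "(\<eta> + of_rat q) / 2 \<in> \<rat>" by auto
    then show False using \<theta>(2) by (simp add: \<eta>_def)
  qed
  have "\<eta> * \<eta> = 4 * (\<theta> * \<theta>) - 4 * of_rat q * \<theta> + of_rat q * of_rat q"
    by (simp add: \<eta>_def algebra_simps)
  also have "\<dots> = of_rat (4 * p + q * q)"
    unfolding pq by (simp add: of_rat_add of_rat_mult algebra_simps)
  finally have \<eta>2: "\<eta> * \<eta> = of_rat (4 * p + q * q)" .
  obtain m n where mn: "4 * p + q * q = Fract m n" "n > 0" by (cases "4 * p + q * q") auto
  have \<eta>3: "\<eta> * \<eta> = real_of_int m / real_of_int n" using \<eta>2 mn by (simp add: of_rat_rat)
  define N where "N = nat (m * n)"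
  have "real_of_int (m * n) = (\<eta> * real_of_int n)\<^sup>2"
    using \<eta>3 mn(2) by (simp add: power2_eq_square field_simps)
  moreover from this have "0 \<le> m * n" by (metis of_int_0_le_iff zero_le_power2)
  ultimately have N: "real N = (\<eta> * real_of_int n)\<^sup>2" by (simp add: N_def)
  then have sN: "sqrt (real N) = \<bar>\<eta> * real_of_int n\<bar>" by simp
  have sNF: "sqrt (real N) \<in> F" unfolding sN abs_if using cl(5,7,9) \<eta>F by auto
  have sNirr: "sqrt (real N) \<notin> \<rat>"
  proof
    assume "sqrt (real N) \<in> \<rat>"
    then have "\<eta> * real_of_int n \<in> \<rat>" unfolding sN abs_if using Rats_minus_iff by (auto split: if_splits)
    then have "\<eta> * real_of_int n / real_of_int n \<in> \<rat>" by (intro Rats_divide) auto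
    with \<eta>irr mn(2) show False by simp
  qed
  define d where "d = squarefree_part N"
  define s where "s = square_part N"
  have Nds: "N = d * s\<^sup>2" unfolding d_def s_def by (rule squarefree_decompose)
  then have s1: "sqrt (real N) = sqrt (real d) * real s" by (simp add: real_sqrt_mult)
  have s0: "s \<noteq> 0"
  proof
    assume "s = 0"
    then show False using sNirr s1 by simp
  qed
  have "sqrt (real d) = sqrt (real N) / real s" using s1 s0 by simp
  then have "sqrt (real d) \<in> F" using cl(6)[OF sNF cl(8)] by simp
  moreover have "squarefree d" by (simp add: d_def)
  moreover have "d \<noteq> 0"
  proof
    assume "d = 0"
    then show False using sNirr s1 by simp
  qed
  moreover have "d \<noteq> 1" using sNirr s1 by auto
  ultimately show ?thesis unfolding field_code_def by (intro exI[of _ d]) auto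
qed

theorem range_element_of_code: "range (element_of_code d) = rat_sqrt d"
proof
  show "range (element_of_code d) \<subseteq> rat_sqrt d"
  proof
    fix x assume "x \<in> range (element_of_code d)"
    then obtain a b :: int and c :: nat where
      "x = (of_int a + of_int b * sqrt (real d)) / real (Suc c)"
      by (auto simp: element_of_code_def split: prod.splits)
    then have "x = of_rat (of_int a / of_nat (Suc c)) + of_rat (of_int b / of_nat (Suc c)) * sqrt (real d)"
      by (simp add: of_rat_divide add_divide_distrib del: of_nat_Suc)
    then show "x \<in> rat_sqrt d" unfolding rat_sqrt_def by blast
  qed
  show "rat_sqrt d \<subseteq> range (element_of_code d)"
  proof
    fix x assume "x \<in> rat_sqrt d"
    then obtain u v where x: "x = of_rat u + of_rat v * sqrt (real d)" by (auto simp: rat_sqrt_def)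
    obtain a k where u: "u = Fract a k" "k > 0" by (cases u) auto
    obtain b l where v: "v = Fract b l" "l > 0" by (cases v) auto
    define c where "c = nat (k * l) - 1"
    have kl: "0 < k * l" using u v by simp
    then have c: "real (Suc c) = real_of_int k * real_of_int l"
      by (simp add: c_def of_nat_diff flip: of_int_mult)
    have "x = (of_int (a * l) + of_int (b * k) * sqrt (real d)) / real (Suc c)"
      unfolding c x u v using u v by (simp add: of_rat_rat field_simps)
    then have "x = element_of_code d (prod_encode (int_encode (a * l), prod_encode (int_encode (b * k), c)))"
      by (simp add: element_of_code_def)
    then show "x \<in> range (element_of_code d)" by blast
  qed
qed

theorem field_norm_rat_sqrt:
  assumes "1 < d" "squarefree d"
  shows "field_norm (rat_sqrt d) (of_rat a + of_rat b * sqrt (real d)) =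
           of_rat (a * a - of_nat d * (b * b))"
proof -
  define r where "r = sqrt (real d)"
  define F where "F = rat_sqrt d"
  have r2: "r * r = real d" by (simp add: r_def)
  have r0: "r \<noteq> 0" using assms by (simp add: r_def)
  have irr: "r \<notin> \<rat>" using sqrt_squarefree_irrational[OF assms] by (simp add: r_def)
  have "real_quadratic_field F" unfolding F_def by (rule real_quadratic_field_rat_sqrt[OF assms])
  then have sf: "real_subfield F" by (simp add: real_quadratic_field_def)
  note cl = real_subfield_closed[OF sf]
  have memI: "of_rat a + of_rat b * r \<in> F" for a b by (auto simp: F_def rat_sqrt_def r_def)
  have memE: "\<exists>a b. x = of_rat a + of_rat b * r" if "x \<in> F" for x
    using that by (auto simp: F_def rat_sqrt_def r_def)
  have rF: "r \<in> F" using memI[of 0 1] by simp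
  have uniq: "a = a' \<and> b = b'"
    if eq: "of_rat a + of_rat b * r = of_rat a' + of_rat b' * r" for a b a' b'
  proof -
    have "b = b'"
    proof (rule ccontr)
      assume "b \<noteq> b'"
      then have "r = of_rat ((a' - a) / (b - b'))"
        using eq by (simp add: of_rat_divide of_rat_diff field_simps)
      with irr show False by simp
    qed
    with eq show ?thesis by simp
  qed
  define conj where "conj x = (THE y. \<exists>a b. x = of_rat a + of_rat b * r \<and> y = of_rat a - of_rat b * r)"
    for x :: real
  have conj: "conj (of_rat a + of_rat b * r) = of_rat a - of_rat b * r" for a b
    unfolding conj_def by (rule the_equality) (use uniq in blast)+
  define \<sigma>1 where "\<sigma>1 = restrict complex_of_real F"
  define \<sigma>2 where "\<sigma>2 = restrict (\<lambda>x. complex_of_real (conj x)) F"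
  have val1: "\<sigma>1 (of_rat a + of_rat b * r) = of_rat a + of_rat b * of_real r" for a b
    unfolding \<sigma>1_def using memI[of a b] by (simp add: of_real_of_rat)
  have val2: "\<sigma>2 (of_rat a + of_rat b * r) = of_rat a - of_rat b * of_real r" for a b
    unfolding \<sigma>2_def using memI[of a b] conj[of a b] by (simp add: of_real_of_rat)
  have "complex_embeddings F = {\<sigma>1, \<sigma>2}"
  proof (intro equalityI subsetI)
    fix \<sigma> assume "\<sigma> \<in> complex_embeddings F"
    then have ext: "\<sigma> \<in> extensional F" and one: "\<sigma> 1 = 1"
      and add: "\<And>x y. x \<in> F \<Longrightarrow> y \<in> F \<Longrightarrow> \<sigma> (x + y) = \<sigma> x + \<sigma> y"
      and mult: "\<And>x y. x \<in> F \<Longrightarrow> y \<in> F \<Longrightarrow> \<sigma> (x * y) = \<sigma> x * \<sigma> y"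
      by (auto simp: complex_embeddings_def)
    have zero: "\<sigma> 0 = 0" using add[OF cl(1) cl(1)] by simp
    have nat: "\<sigma> (real n) = of_nat n" for n
      by (induction n) (use zero one add cl(2) cl(8) in auto)
    have neg: "\<sigma> (- x) = - \<sigma> x" if "x \<in> F" for x
      using add[OF that cl(7)[OF that]] zero by (simp add: add_eq_0_iff)
    have int: "\<sigma> (real_of_int k) = of_int k" for k
      by (cases k) (use nat neg[OF cl(8)] in \<open>auto simp del: of_nat_Suc\<close>)
    have rat: "\<sigma> (of_rat q) = of_rat q" for q
    proof (cases q)
      case (Fract a b)
      have "\<sigma> (of_rat q) * \<sigma> (real_of_int b) = \<sigma> (real_of_int a)"
        unfolding mult[OF cl(10) cl(9), symmetric] using Fract by (simp add: of_rat_rat)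
      then show ?thesis unfolding int using Fract by (simp add: of_rat_rat field_simps)
    qed
    have "\<sigma> r * \<sigma> r = of_nat d" using mult[OF rF rF] nat r2 by simp
    also have "\<dots> = complex_of_real r * complex_of_real r"
      using r2 by (metis of_real_mult of_real_of_nat_eq)
    finally have cases: "\<sigma> r = of_real r \<or> \<sigma> r = - of_real r" by (simp add: square_eq_iff)
    have val: "\<sigma> (of_rat a + of_rat b * r) = of_rat a + of_rat b * \<sigma> r" for a b
      using add[OF cl(10) cl(5)[OF cl(10) rF]] mult[OF cl(10) rF] rat by simp
    have "\<sigma> = \<sigma>1" if "\<sigma> r = of_real r"
    proof (rule extensionalityI[OF ext])
      show "\<sigma>1 \<in> extensional F" by (simp add: \<sigma>1_def)
      show "\<sigma> x = \<sigma>1 x" if "x \<in> F" for x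
        using memE[OF that] val val1 \<open>\<sigma> r = of_real r\<close> by auto
    qed
    moreover have "\<sigma> = \<sigma>2" if "\<sigma> r = - of_real r"
    proof (rule extensionalityI[OF ext])
      show "\<sigma>2 \<in> extensional F" by (simp add: \<sigma>2_def)
      show "\<sigma> x = \<sigma>2 x" if "x \<in> F" for x
        using memE[OF that] val val2 \<open>\<sigma> r = - of_real r\<close> by auto
    qed
    ultimately show "\<sigma> \<in> {\<sigma>1, \<sigma>2}" using cases by blast
  next
    fix \<sigma> assume \<sigma>: "\<sigma> \<in> {\<sigma>1, \<sigma>2}"
    then obtain s :: real where s: "s * s = real d" and ext: "\<sigma> \<in> extensional F"
      and val: "\<And>a b. \<sigma> (of_rat a + of_rat b * r) = of_rat a + of_rat b * of_real s"
    proof (elim insertE emptyE)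
      assume "\<sigma> = \<sigma>1"
      then show ?thesis using that[of r] val1 r2 by (simp add: \<sigma>1_def)
    next
      assume "\<sigma> = \<sigma>2"
      then show ?thesis using that[of "-r"] val2 r2 by (simp add: \<sigma>2_def)
    qed
    have s': "complex_of_real s * complex_of_real s = of_nat d"
      using s by (metis of_real_mult of_real_of_nat_eq)
    have "\<sigma> 1 = 1" using val[of 1 0] by simp
    moreover have "\<sigma> (x + y) = \<sigma> x + \<sigma> y \<and> \<sigma> (x * y) = \<sigma> x * \<sigma> y"
      if xF: "x \<in> F" and yF: "y \<in> F" for x y
    proof -
      obtain a b a' b' where x: "x = of_rat a + of_rat b * r" and y: "y = of_rat a' + of_rat b' * r"
        using memE[OF xF] memE[OF yF] by blast
      have p: "x + y = of_rat (a + a') + of_rat (b + b') * r"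
        by (simp add: x y of_rat_add algebra_simps)
      have "x * y = of_rat a * of_rat a' + of_rat b * of_rat b' * (r * r)
                 + (of_rat a * of_rat b' + of_rat b * of_rat a') * r"
        by (simp add: x y algebra_simps)
      then have m: "x * y = of_rat (a * a' + b * b' * of_nat d) + of_rat (a * b' + b * a') * r"
        unfolding r2 by (simp add: of_rat_add of_rat_mult)
      have "\<sigma> x * \<sigma> y = of_rat a * of_rat a' + of_rat b * of_rat b' * (of_real s * of_real s)
                 + (of_rat a * of_rat b' + of_rat b * of_rat a') * of_real s"
        unfolding x y val by (simp add: algebra_simps)
      also have "\<dots> = \<sigma> (x * y)"
        unfolding s' m val by (simp add: of_rat_add of_rat_mult)
      finally have "\<sigma> (x * y) = \<sigma> x * \<sigma> y" by simp
      moreover have "\<sigma> (x + y) = \<sigma> x + \<sigma> y"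
        unfolding p val unfolding x y val by (simp add: of_rat_add algebra_simps)
      ultimately show ?thesis by blast
    qed
    ultimately show "\<sigma> \<in> complex_embeddings F" using ext by (simp add: complex_embeddings_def)
  qed
  moreover have "\<sigma>1 \<noteq> \<sigma>2"
  proof
    assume "\<sigma>1 = \<sigma>2"
    then have "complex_of_real r = - complex_of_real r" using val1[of 0 1] val2[of 0 1] by simp
    then show False using r0 by simp
  qed
  ultimately have "field_norm F (of_rat a + of_rat b * r) =
      (of_rat a + of_rat b * of_real r) * (of_rat a - of_rat b * of_real r)"
    unfolding field_norm_def using val1 val2 by simp
  also have "\<dots> = of_rat a * of_rat a - of_rat b * of_rat b * (complex_of_real r * complex_of_real r)"
    by (simp add: algebra_simps)
  also have "complex_of_real r * complex_of_real r = of_nat d"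
    using r2 by (metis of_real_mult of_real_of_nat_eq)
  finally show ?thesis
    unfolding F_def r_def by (simp add: of_rat_diff of_rat_mult)
qed

end

theory Submission
  imports Defs "HOL-Analysis.Kronecker_Approximation_Theorem"
begin

text \<open>
  Divide a pair \<open>\<alpha>, \<beta>\<close> by \<open>\<beta>\<close>. A decreasing chain for the pair then says that \<open>x = \<alpha> / \<beta>\<close> lies in a
  region \<open>\<bar>Nm (x - q)\<bar> < 1\<close> or \<open>\<bar>Nm (1 - u * (x - q))\<bar> < 1\<close> with integral \<open>q\<close> and \<open>u\<close>, so the field
  \<open>K = \<rat>(\<surd>d)\<close> is 2-stage euclidean iff these regions cover \<open>K\<close>. The two real embeddings put \<open>K\<close> into
  the plane, where the same inequalities define open sets that the lattice \<open>\<int>[\<surd>d]\<close> permutes. If the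
  whole plane is covered, compactness of a fundamental square yields a certificate: a subdivision of
  the square into small squares, each of which lies in one region by an explicit estimate in integers.
  A program can search for such a certificate, and conversely a certificate visibly covers \<open>K\<close>
  (\<open>certificate_sound\<close>, \<open>certificate_complete\<close>).

  The gap between covering \<open>K\<close> and covering the plane is closed by \<open>outside_field_covered\<close>: a point \<open>v\<close>
  of the plane outside \<open>K\<close> lies in a region for every \<open>d\<close>. Look for \<open>u\<close> among the products of a unit
  and a power of \<open>\<pi> = d + 1 + \<surd>d\<close>. It is enough to find \<open>l\<close> and \<open>\<alpha>\<close> such that \<open>\<pi> ^ l * v\<close> is close to
  \<open>\<alpha>\<close> up to a unit factor and \<open>\<alpha>\<close> is congruent to a unit modulo \<open>\<pi> ^ l\<close>. The residue rings of
  the powers of \<open>\<pi>\<close> are the rings \<open>\<int> / N ^ l\<close> with \<open>N = Nm \<pi>\<close>, so that a single unit \<open>\<epsilon>\<close> generates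
  an open subgroup of their limit, and \<open>\<alpha> = 1\<close> modulo a fixed \<open>M\<close> suffices
  for all \<open>l\<close> (\<open>units_open_mod_\<pi>_powers\<close>). The remaining condition asks that the products of
  powers of \<open>\<epsilon>\<close> and \<open>\<pi>\<close> carry \<open>v / M\<close> close to \<open>1 / M\<close> modulo the lattice. They even carry it densely into
  the plane modulo the lattice (\<open>orbit_dense\<close>). This is a case of Berend's theorem, the analogue of
  Furstenberg's theorem on multiplication by 2 and 3 on the circle; the proof adapts the
  elementary argument of Boshernitzan for the circle.

  In a 2-stage euclidean field the chains form a Euclidean algorithm with decreasing
  norms, so every element has a continued fraction, and the second program finds one by searching
  through all lists of elements.
\<close>

section \<open>Programming with recursive functions\<close>

definition computable :: "nat \<Rightarrow> (nat list \<Rightarrow> nat) \<Rightarrow> bool" where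
  "computable k f \<longleftrightarrow> (\<exists>P. \<forall>xs. length xs = k \<longrightarrow> eval_recf P xs = Some (f xs))"

definition decidable :: "nat \<Rightarrow> (nat list \<Rightarrow> bool) \<Rightarrow> bool" where
  "decidable k P \<longleftrightarrow> computable k (\<lambda>xs. of_bool (P xs))"

text \<open>
  Integer-valued functions are differences of computable functions, so that the ring operations
  and comparisons need no coding of signs.
\<close>

definition int_computable :: "nat \<Rightarrow> (nat list \<Rightarrow> int) \<Rightarrow> bool" where
  "int_computable k f \<longleftrightarrow> (\<exists>p q. computable k p \<and> computable k q \<and>
     (\<forall>xs. length xs = k \<longrightarrow> f xs = int (p xs) - int (q xs)))"

lemma computable_cong:
  assumes "computable k f" "\<And>xs. length xs = k \<Longrightarrow> f xs = g xs"
  shows "computable k g"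
  using assms unfolding computable_def by metis

lemma those_map_Some: "those (map (\<lambda>x. Some (f x)) xs) = Some (map f xs)"
  by (induction xs) auto

lemma computable_compose:
  assumes g: "computable (length fs) g" and fs: "\<And>f. f \<in> set fs \<Longrightarrow> computable k f"
  shows "computable k (\<lambda>xs. g (map (\<lambda>f. f xs) fs))"
proof -
  obtain G where G: "\<And>xs. length xs = length fs \<Longrightarrow> eval_recf G xs = Some (g xs)"
    using g unfolding computable_def by auto
  obtain p where p: "\<And>f xs. f \<in> set fs \<Longrightarrow> length xs = k \<Longrightarrow> eval_recf (p f) xs = Some (f xs)"
    using fs unfolding computable_def by metis
  have "eval_recf (Comp G (map p fs)) xs = Some (g (map (\<lambda>f. f xs) fs))" if "length xs = k" for xs
  proof -
    have "map (\<lambda>h. h xs) (map eval_recf (map p fs)) = map (\<lambda>f. Some (f xs)) fs"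
      using p that by simp
    then show ?thesis using G[of "map (\<lambda>f. f xs) fs"] by (simp only: eval_recf.simps those_map_Some) simp
  qed
  then show ?thesis unfolding computable_def by blast
qed

lemma computable_nth: "i < k \<Longrightarrow> computable k (\<lambda>xs. xs ! i)"
  unfolding computable_def by (intro exI[of _ "Proj i"]) auto

text \<open>
  Bounded sums and quantifiers put the bound variable in front of the parameters, which are then
  reached through \<open>tl\<close>.
\<close>

lemma computable_tl:
  assumes "computable k f" shows "computable (Suc k) (\<lambda>xs. f (tl xs))"
proof -
  have "computable (Suc k) (\<lambda>xs. f (map (\<lambda>h. h xs) (map (\<lambda>i xs. xs ! Suc i) [0..<k])))"
    using assms by (intro computable_compose) (auto intro: computable_nth)
  then show ?thesis
  proof (rule computable_cong)
    fix xs :: "nat list" assume "length xs = Suc k"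
    then have "map (\<lambda>i. xs ! Suc i) [0..<k] = tl xs" by (intro nth_equalityI) (auto simp: nth_tl)
    then show "f (map (\<lambda>h. h xs) (map (\<lambda>i xs. xs ! Suc i) [0..<k])) = f (tl xs)" by (simp add: comp_def)
  qed
qed

lemma computable_subst1:
  assumes "computable 1 (\<lambda>xs. g (xs ! 0))" "computable k f"
  shows "computable k (\<lambda>xs. g (f xs))"
  using computable_compose[of "[f]" "\<lambda>xs. g (xs ! 0)" k] assms by simp

lemma computable_subst2:
  assumes "computable 2 (\<lambda>xs. g (xs ! 0) (xs ! 1))" "computable k f1" "computable k f2"
  shows "computable k (\<lambda>xs. g (f1 xs) (f2 xs))"
  using computable_compose[of "[f1, f2]" "\<lambda>xs. g (xs ! 0) (xs ! 1)"] assms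
  by (auto simp: numeral_2_eq_2)

lemma computable_const: "computable k (\<lambda>xs. c)"
proof (induction c)
  case 0
  show ?case unfolding computable_def by (intro exI[of _ Zero]) auto
next
  case (Suc c)
  have "computable 1 (\<lambda>xs. Suc (xs ! 0))"
    unfolding computable_def by (intro exI[of _ Succ]) (auto simp: length_Suc_conv)
  from computable_subst1[OF this Suc] show ?case .
qed

lemma computable_Suc: "computable k f \<Longrightarrow> computable k (\<lambda>xs. Suc (f xs))"
  by (rule computable_subst1)
    (auto simp: computable_def length_Suc_conv intro!: exI[of _ Succ])

text \<open>Primitive recursion binds its counter and its accumulator in front of the parameters.\<close>

lemma computable_rec_nat:
  assumes n: "computable k n" and g: "computable k g"
    and h: "computable (Suc (Suc k)) (\<lambda>ys. h (ys ! 0) (ys ! 1) (tl (tl ys)))"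
  shows "computable k (\<lambda>xs. rec_nat (g xs) (\<lambda>i v. h i v xs) (n xs))"
proof -
  obtain G where G: "\<And>xs. length xs = k \<Longrightarrow> eval_recf G xs = Some (g xs)"
    using g unfolding computable_def by auto
  obtain H where H: "\<And>i v xs. length xs = k \<Longrightarrow> eval_recf H (i # v # xs) = Some (h i v xs)"
  proof -
    obtain H where "\<And>ys. length ys = Suc (Suc k) \<Longrightarrow>
        eval_recf H ys = Some (h (ys ! 0) (ys ! 1) (tl (tl ys)))"
      using h unfolding computable_def by auto
    from this[of "_ # _ # _"] show ?thesis by (intro that) simp
  qed
  have "eval_recf (PrimRec G H) ys = Some (rec_nat (g (tl ys)) (\<lambda>i v. h i v (tl ys)) (hd ys))"
    if len: "length ys = Suc k" for ys
  proof -
    obtain m xs where ys: "ys = m # xs" "length xs = k" using len by (auto simp: length_Suc_conv)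
    have "rec_nat (eval_recf G xs) (\<lambda>k r. Option.bind r (\<lambda>v. eval_recf H (k # v # xs))) m
            = Some (rec_nat (g xs) (\<lambda>i v. h i v xs) m)"
      by (induction m) (auto simp: G H ys)
    then show ?thesis by (simp add: ys)
  qed
  then have *: "computable (Suc k) (\<lambda>ys. rec_nat (g (tl ys)) (\<lambda>i v. h i v (tl ys)) (hd ys))"
    unfolding computable_def by blast
  let ?fs = "n # map (\<lambda>i xs. xs ! i) [0..<k]"
  from * have "computable k (\<lambda>xs. (\<lambda>ys. rec_nat (g (tl ys)) (\<lambda>i v. h i v (tl ys)) (hd ys))
                     (map (\<lambda>f. f xs) ?fs))"
    by (intro computable_compose) (auto intro: n computable_nth)
  then show ?thesis
  proof (rule computable_cong)
    fix xs :: "nat list" assume "length xs = k"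
    then have "map (\<lambda>i. xs ! i) [0..<k] = xs" using map_nth by blast
    then show "(\<lambda>ys. rec_nat (g (tl ys)) (\<lambda>i v. h i v (tl ys)) (hd ys)) (map (\<lambda>f. f xs) ?fs)
        = rec_nat (g xs) (\<lambda>i v. h i v xs) (n xs)"
      by (simp add: comp_def)
  qed
qed

lemma computable_add:
  assumes "computable k f" "computable k g" shows "computable k (\<lambda>xs. f xs + g xs)"
proof -
  have "computable k (\<lambda>xs. rec_nat (g xs) (\<lambda>i v. Suc v) (f xs))"
    by (intro computable_rec_nat assms computable_Suc computable_nth) simp
  moreover have "rec_nat b (\<lambda>i v. Suc v) a = a + b" for a b by (induction a) auto
  ultimately show ?thesis by simp
qed

lemma computable_mult:
  assumes "computable k f" "computable k g" shows "computable k (\<lambda>xs. f xs * g xs)"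
proof -
  have "computable 2 (\<lambda>xs. rec_nat 0 (\<lambda>i v. v + xs ! 1) (xs ! 0))"
    by (intro computable_rec_nat computable_add computable_nth computable_const computable_tl) auto
  moreover have "rec_nat 0 (\<lambda>i v. v + b) a = a * b" for a b by (induction a) auto
  ultimately show ?thesis by (intro computable_subst2[OF _ assms]) simp
qed

lemma computable_diff:
  assumes "computable k f" "computable k g" shows "computable k (\<lambda>xs. f xs - g xs)"
proof -
  have "computable 1 (\<lambda>xs. rec_nat 0 (\<lambda>i v. i) (xs ! 0))"
    by (intro computable_rec_nat computable_nth computable_const) auto
  moreover have "rec_nat 0 (\<lambda>i v. i) a = a - 1" for a by (cases a) auto
  ultimately have pred: "computable 1 (\<lambda>xs. xs ! 0 - 1)" by simp
  have "computable 2 (\<lambda>xs. rec_nat (xs ! 0) (\<lambda>i v. v - 1) (xs ! 1))"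
    by (intro computable_rec_nat computable_subst1[OF pred] computable_nth) auto
  moreover have "rec_nat a (\<lambda>i v. v - 1) b = a - b" for a b :: nat by (induction b) auto
  ultimately show ?thesis by (intro computable_subst2[OF _ assms]) simp
qed

lemma computable_sum:
  assumes n: "computable k n" and f: "computable (Suc k) (\<lambda>ys. f (ys ! 0) (tl ys))"
  shows "computable k (\<lambda>xs. \<Sum>i<n xs. f i xs)"
proof -
  let ?fs = "(\<lambda>ys. ys ! 0) # map (\<lambda>i ys. ys ! Suc (Suc i)) [0..<k]"
  have "computable (Suc (Suc k)) (\<lambda>ys. (\<lambda>ys. f (ys ! 0) (tl ys)) (map (\<lambda>f. f ys) ?fs))"
    by (intro computable_compose) (auto intro: f computable_nth)
  then have h: "computable (Suc (Suc k)) (\<lambda>ys. f (ys ! 0) (tl (tl ys)))"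
  proof (rule computable_cong)
    fix ys :: "nat list" assume len: "length ys = Suc (Suc k)"
    then have "map (\<lambda>i. ys ! Suc (Suc i)) [0..<k] = tl (tl ys)"
      by (intro nth_equalityI) (auto simp: nth_tl)
    then show "(\<lambda>ys. f (ys ! 0) (tl ys)) (map (\<lambda>f. f ys) ?fs) = f (ys ! 0) (tl (tl ys))"
      by (simp add: comp_def)
  qed
  have "computable k (\<lambda>xs. rec_nat 0 (\<lambda>i v. v + f i xs) (n xs))"
    by (intro computable_rec_nat n computable_const computable_add h computable_nth) auto
  moreover have "rec_nat 0 (\<lambda>i v. v + f i xs) m = (\<Sum>i<m. f i xs)" for m xs
    by (induction m) auto
  ultimately show ?thesis by simp
qed

lemma decidable_not: "decidable k P \<Longrightarrow> decidable k (\<lambda>xs. \<not> P xs)"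
  unfolding decidable_def
  by (rule computable_cong[OF computable_diff[OF computable_const[of k 1]]]) (auto split: if_splits)

lemma decidable_and: "decidable k P \<Longrightarrow> decidable k Q \<Longrightarrow> decidable k (\<lambda>xs. P xs \<and> Q xs)"
  unfolding decidable_def of_bool_conj by (rule computable_mult)

lemma decidable_or: "decidable k P \<Longrightarrow> decidable k Q \<Longrightarrow> decidable k (\<lambda>xs. P xs \<or> Q xs)"
  using decidable_not[OF decidable_and[OF decidable_not decidable_not]] by simp

lemma decidable_le:
  assumes "computable k f" "computable k g" shows "decidable k (\<lambda>xs. f xs \<le> g xs)"
  unfolding decidable_def
  by (rule computable_cong[OF computable_diff[OF computable_const[of k 1] computable_diff[OF assms]]])
    auto

lemma decidable_less:
  assumes "computable k f" "computable k g" shows "decidable k (\<lambda>xs. f xs < g xs)"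
  using decidable_le[OF computable_Suc[OF assms(1)] assms(2)] by (simp add: Suc_le_eq)

lemma decidable_eq:
  assumes "computable k f" "computable k g" shows "decidable k (\<lambda>xs. f xs = g xs)"
  using decidable_and[OF decidable_le[OF assms] decidable_le[OF assms(2,1)]]
  by (simp flip: eq_iff)

lemma computable_If:
  assumes "decidable k P" "computable k f" "computable k g"
  shows "computable k (\<lambda>xs. if P xs then f xs else g xs)"
  by (rule computable_cong[OF computable_add[OF computable_mult[OF _ assms(2)]
      computable_mult[OF _ assms(3)]], OF assms(1)[unfolded decidable_def]
      decidable_not[OF assms(1), unfolded decidable_def]]) auto

lemma decidable_all:
  assumes n: "computable k n" and P: "decidable (Suc k) (\<lambda>ys. P (ys ! 0) (tl ys))"
  shows "decidable k (\<lambda>xs. \<forall>i<n xs. P i xs)"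
proof -
  have "decidable k (\<lambda>xs. (\<Sum>i<n xs. of_bool (\<not> P i xs)) = (0::nat))"
    by (intro decidable_eq computable_sum n computable_const)
      (use decidable_not[OF P] in \<open>simp add: decidable_def\<close>)
  moreover have "(\<Sum>i<n xs. of_bool (\<not> P i xs)) = (0::nat) \<longleftrightarrow> (\<forall>i<n xs. P i xs)" for xs
    by (subst sum_eq_0_iff) auto
  ultimately show ?thesis by simp
qed

lemma decidable_ex:
  assumes n: "computable k n" and P: "decidable (Suc k) (\<lambda>ys. P (ys ! 0) (tl ys))"
  shows "decidable k (\<lambda>xs. \<exists>i<n xs. P i xs)"
  using decidable_not[OF decidable_all[OF n decidable_not[OF P]]] by simp

text \<open>
  A function with decidable graph and computable bound is a bounded sum with one nonzero term at most.
  In this way halving and the inverse of the pairing function need no recursion of their own.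
\<close>

lemma computable_bounded_The:
  assumes n: "computable k n" and P: "decidable (Suc k) (\<lambda>ys. P (ys ! 0) (tl ys))"
    and f: "\<And>xs. length xs = k \<Longrightarrow> f xs < n xs"
    and unique: "\<And>xs i. length xs = k \<Longrightarrow> P i xs \<longleftrightarrow> i = f xs"
  shows "computable k f"
proof -
  have "computable k (\<lambda>xs. \<Sum>i<n xs. i * of_bool (P i xs))"
    using P by (intro computable_sum n computable_mult computable_nth) (auto simp: decidable_def)
  then show ?thesis
  proof (rule computable_cong)
    fix xs :: "nat list" assume len: "length xs = k"
    have "(\<Sum>i<n xs. i * of_bool (P i xs)) = (\<Sum>i<n xs. if f xs = i then i else 0)"
      by (rule sum.cong) (use unique[OF len] in auto)
    then show "(\<Sum>i<n xs. i * of_bool (P i xs)) = f xs" using f[OF len] by simp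
  qed
qed

lemma computable_div2:
  assumes "computable k f" shows "computable k (\<lambda>xs. f xs div 2)"
proof -
  have "computable 1 (\<lambda>xs. xs ! 0 div 2)"
    by (rule computable_bounded_The[where n = "\<lambda>xs. Suc (xs ! 0)" and
        P = "\<lambda>i xs. i + i \<le> xs ! 0 \<and> xs ! 0 \<le> Suc (i + i)"])
      (auto intro!: decidable_and decidable_le computable_add computable_nth computable_tl computable_Suc)
  from computable_subst1[OF this assms] show ?thesis .
qed

lemma decidable_dvd:
  assumes "computable k f" "computable k g" shows "decidable k (\<lambda>xs. f xs dvd g xs)"
proof -
  have "decidable 2 (\<lambda>xs. \<exists>i<Suc (xs ! 1). xs ! 1 = xs ! 0 * i)"
    by (intro decidable_ex decidable_eq computable_mult computable_nth computable_tl computable_Suc)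
      auto
  moreover have "(\<exists>i<Suc b. b = a * i) \<longleftrightarrow> a dvd b" for a b :: nat
  proof
    assume "a dvd b"
    then obtain c where c: "b = a * c" by (elim dvdE)
    show "\<exists>i<Suc b. b = a * i"
    proof (cases "a = 0")
      case True
      then show ?thesis using c by auto
    next
      case False
      then show ?thesis using c by (intro exI[of _ c]) (auto simp: less_Suc_eq_le)
    qed
  qed auto
  ultimately have "decidable 2 (\<lambda>xs. xs ! 0 dvd xs ! 1)" by simp
  then show ?thesis unfolding decidable_def by (rule computable_subst2[OF _ assms])
qed

lemma computable_prod_encode:
  assumes "computable k f" "computable k g" shows "computable k (\<lambda>xs. prod_encode (f xs, g xs))"
  unfolding prod_encode_def triangle_def prod.case
  by (intro computable_add computable_mult computable_div2 computable_Suc assms)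

lemma computable_prod_decode:
  assumes "computable k f"
  shows "computable k (\<lambda>xs. fst (prod_decode (f xs)))" "computable k (\<lambda>xs. snd (prod_decode (f xs)))"
proof -
  have fst: "(\<exists>b<Suc n. n = prod_encode (a, b)) \<longleftrightarrow> a = fst (prod_decode n)" for a n
  proof
    assume "a = fst (prod_decode n)"
    then have "n = prod_encode (a, snd (prod_decode n))" by simp
    then show "\<exists>b<Suc n. n = prod_encode (a, b)"
      by (metis le_imp_less_Suc le_prod_encode_2)
  qed auto
  have snd: "(\<exists>a<Suc n. n = prod_encode (a, b)) \<longleftrightarrow> b = snd (prod_decode n)" for b n
  proof
    assume "b = snd (prod_decode n)"
    then have "n = prod_encode (fst (prod_decode n), b)" by simp
    then show "\<exists>a<Suc n. n = prod_encode (a, b)"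
      by (metis le_imp_less_Suc le_prod_encode_1)
  qed auto
  have less: "fst (prod_decode n) < Suc n" "snd (prod_decode n) < Suc n" for n
    using le_prod_encode_1[of "fst (prod_decode n)" "snd (prod_decode n)"]
      le_prod_encode_2[of "snd (prod_decode n)" "fst (prod_decode n)"] by auto
  have bound: "computable 1 (\<lambda>xs. Suc (xs ! 0))"
    by (intro computable_Suc computable_nth) simp
  have "decidable (Suc 1) (\<lambda>ys. \<exists>b<Suc (tl ys ! 0). tl ys ! 0 = prod_encode (ys ! 0, b))"
    by (intro decidable_ex decidable_eq computable_prod_encode computable_nth
        computable_tl computable_Suc) auto
  then have "computable 1 (\<lambda>xs. fst (prod_decode (xs ! 0)))"
    by (rule computable_bounded_The[where P = "\<lambda>a xs. \<exists>b<Suc (xs ! 0). xs ! 0 = prod_encode (a, b)",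
          OF bound]) (simp_all only: fst less)
  from computable_subst1[OF this assms] show "computable k (\<lambda>xs. fst (prod_decode (f xs)))" .
  have "decidable (Suc 1) (\<lambda>ys. \<exists>a<Suc (tl ys ! 0). tl ys ! 0 = prod_encode (a, ys ! 0))"
    by (intro decidable_ex decidable_eq computable_prod_encode computable_nth
        computable_tl computable_Suc) auto
  then have "computable 1 (\<lambda>xs. snd (prod_decode (xs ! 0)))"
    by (rule computable_bounded_The[where P = "\<lambda>b xs. \<exists>a<Suc (xs ! 0). xs ! 0 = prod_encode (a, b)",
          OF bound]) (simp_all only: snd less)
  from computable_subst1[OF this assms] show "computable k (\<lambda>xs. snd (prod_decode (f xs)))" .
qed

lemma int_computable_of_nat: "computable k f \<Longrightarrow> int_computable k (\<lambda>xs. int (f xs))"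
  unfolding int_computable_def by (intro exI[of _ f] exI[of _ "\<lambda>_. 0"]) (auto intro: computable_const)

lemma int_computable_numeral: "int_computable k (\<lambda>xs. numeral c)" "int_computable k (\<lambda>xs. 1)"
  using int_computable_of_nat[OF computable_const[of k "numeral c"]]
    int_computable_of_nat[OF computable_const[of k 1]] by simp_all

lemma int_computable_uminus: "int_computable k f \<Longrightarrow> int_computable k (\<lambda>xs. - f xs)"
  unfolding int_computable_def by force

lemma int_computable_add:
  assumes "int_computable k f" "int_computable k g" shows "int_computable k (\<lambda>xs. f xs + g xs)"
proof -
  obtain p q p' q' where *: "computable k p" "computable k q" "computable k p'" "computable k q'"
    "\<forall>xs. length xs = k \<longrightarrow> f xs = int (p xs) - int (q xs)"
    "\<forall>xs. length xs = k \<longrightarrow> g xs = int (p' xs) - int (q' xs)"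
    using assms unfolding int_computable_def by auto
  show ?thesis unfolding int_computable_def
    by (intro exI[of _ "\<lambda>xs. p xs + p' xs"] exI[of _ "\<lambda>xs. q xs + q' xs"])
      (use * in \<open>auto intro!: computable_add\<close>)
qed

lemma int_computable_diff:
  "int_computable k f \<Longrightarrow> int_computable k g \<Longrightarrow> int_computable k (\<lambda>xs. f xs - g xs)"
  using int_computable_add[OF _ int_computable_uminus] by fastforce

lemma int_computable_mult:
  assumes "int_computable k f" "int_computable k g" shows "int_computable k (\<lambda>xs. f xs * g xs)"
proof -
  obtain p q p' q' where *: "computable k p" "computable k q" "computable k p'" "computable k q'"
    "\<forall>xs. length xs = k \<longrightarrow> f xs = int (p xs) - int (q xs)"
    "\<forall>xs. length xs = k \<longrightarrow> g xs = int (p' xs) - int (q' xs)"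
    using assms unfolding int_computable_def by auto
  show ?thesis unfolding int_computable_def
    by (intro exI[of _ "\<lambda>xs. p xs * p' xs + q xs * q' xs"] exI[of _ "\<lambda>xs. p xs * q' xs + q xs * p' xs"])
      (use * in \<open>simp add: computable_add computable_mult left_diff_distrib right_diff_distrib\<close>)
qed

lemma int_computable_power2: "int_computable k f \<Longrightarrow> int_computable k (\<lambda>xs. (f xs)\<^sup>2)"
  unfolding power2_eq_square by (rule int_computable_mult)

lemma computable_nat:
  assumes "int_computable k f" shows "computable k (\<lambda>xs. nat (f xs))"
proof -
  obtain p q where *: "computable k p" "computable k q"
    "\<And>xs. length xs = k \<Longrightarrow> f xs = int (p xs) - int (q xs)"
    using assms unfolding int_computable_def by auto
  show ?thesis by (rule computable_cong[OF computable_diff[OF *(1,2)]]) (auto simp: *(3))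
qed

lemma int_decidable_le:
  assumes "int_computable k f" "int_computable k g" shows "decidable k (\<lambda>xs. f xs \<le> g xs)"
  using decidable_eq[OF computable_nat[OF int_computable_diff[OF assms]] computable_const[of k 0]]
  by simp

lemma int_decidable_less:
  assumes "int_computable k f" "int_computable k g" shows "decidable k (\<lambda>xs. f xs < g xs)"
  using decidable_not[OF int_decidable_le[OF assms(2,1)]] by (simp add: not_le)

lemma int_decidable_eq:
  assumes "int_computable k f" "int_computable k g" shows "decidable k (\<lambda>xs. f xs = g xs)"
  using decidable_and[OF int_decidable_le[OF assms] int_decidable_le[OF assms(2,1)]]
  by (simp flip: eq_iff)

lemma int_computable_If:
  assumes "decidable k P" "int_computable k f" "int_computable k g"
  shows "int_computable k (\<lambda>xs. if P xs then f xs else g xs)"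
proof -
  obtain p q p' q' where *: "computable k p" "computable k q" "computable k p'" "computable k q'"
    "\<forall>xs. length xs = k \<longrightarrow> f xs = int (p xs) - int (q xs)"
    "\<forall>xs. length xs = k \<longrightarrow> g xs = int (p' xs) - int (q' xs)"
    using assms unfolding int_computable_def by auto
  show ?thesis unfolding int_computable_def
    by (intro exI[of _ "\<lambda>xs. if P xs then p xs else p' xs"] exI[of _ "\<lambda>xs. if P xs then q xs else q' xs"])
      (use * in \<open>auto intro!: computable_If assms(1)\<close>)
qed

lemma int_computable_abs: "int_computable k f \<Longrightarrow> int_computable k (\<lambda>xs. \<bar>f xs\<bar>)"
  unfolding abs_if
  by (intro int_computable_If int_decidable_less int_computable_uminus
      int_computable_of_nat[OF computable_const[of k 0], simplified])

lemma int_decidable_dvd: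
  assumes "int_computable k f" "int_computable k g" shows "decidable k (\<lambda>xs. f xs dvd g xs)"
  using decidable_dvd[OF computable_nat[OF int_computable_abs] computable_nat[OF int_computable_abs],
      OF assms] by (simp add: nat_abs_dvd_iff)

lemma int_computable_int_decode:
  assumes "computable k f" shows "int_computable k (\<lambda>xs. int_decode (f xs))"
proof -
  have "int_decode n = (if 2 dvd n then int (n div 2) else - int (n div 2) - 1)" for n
    by (simp add: int_decode_def sum_decode_def)
  moreover have "int_computable k (\<lambda>xs. if 2 dvd f xs then int (f xs div 2) else - int (f xs div 2) - 1)"
    by (intro int_computable_If decidable_dvd int_computable_diff int_computable_uminus
        int_computable_of_nat computable_div2 computable_const assms int_computable_numeral)
  ultimately show ?thesis by simp
qed

lemma computable_int_encode:
  assumes "int_computable k f" shows "computable k (\<lambda>xs. int_encode (f xs))"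
proof -
  have "int_encode i = (if i < 0 then Suc (2 * nat (- i - 1)) else 2 * nat i)" for i
    by (simp add: int_encode_def sum_encode_def)
  moreover have "computable k (\<lambda>xs. if f xs < 0 then Suc (2 * nat (- f xs - 1)) else 2 * nat (f xs))"
    by (intro computable_If int_decidable_less computable_Suc computable_mult computable_nat
        int_computable_diff int_computable_uminus computable_const assms int_computable_numeral
        int_computable_of_nat[OF computable_const[of k 0], simplified])
  ultimately show ?thesis by simp
qed

lemmas computable_intros =
  computable_nth computable_tl computable_const computable_Suc
  computable_add computable_mult computable_diff computable_If computable_prod_encode
  computable_prod_decode computable_nat computable_int_encode
  decidable_not decidable_and decidable_or decidable_le decidable_less decidable_eq
  int_computable_numeral int_computable_uminus int_computable_add int_computable_diff
  int_computable_mult int_computable_power2 int_computable_If int_computable_abs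
  int_computable_int_decode int_computable_of_nat
  int_decidable_le int_decidable_less int_decidable_eq int_decidable_dvd

text \<open>
  Unbounded search terminates exactly on the projection of a decidable relation. It is applied to a
  total relation, so that no test in the course of the search can fail to terminate.
\<close>

lemma semidecide_by_search:
  assumes "decidable (Suc k) (\<lambda>ys. R (ys ! 0) (tl ys))"
  shows "\<exists>P. \<forall>xs. length xs = k \<longrightarrow>
    eval_recf P xs = (if \<exists>n. R n xs then Some (LEAST n. R n xs) else None)"
proof -
  have "computable (Suc k) (\<lambda>ys. of_bool (\<not> R (ys ! 0) (tl ys)))"
    using decidable_not[OF assms] by (simp add: decidable_def)
  then obtain T where T: "\<And>ys. length ys = Suc k \<Longrightarrow>
      eval_recf T ys = Some (of_bool (\<not> R (ys ! 0) (tl ys)))"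
    unfolding computable_def by auto
  have T: "eval_recf T (n # xs) = Some (of_bool (\<not> R n xs))" if "length xs = k" for n xs
    using T[of "n # xs"] that by simp
  have "eval_recf (Mu T) xs = (if \<exists>n. R n xs then Some (LEAST n. R n xs) else None)"
    if len: "length xs = k" for xs
  proof -
    have least: "(\<exists>n. R n xs \<and> (\<forall>i<n. \<not> R i xs)) \<longleftrightarrow> (\<exists>n. R n xs)"
      using exists_least_iff[of "\<lambda>n. R n xs"] by blast
    have "(\<exists>v. Some (of_bool (\<not> R i xs)) = Some (Suc v)) \<longleftrightarrow> \<not> R i xs" for i by auto
    then show ?thesis using least by (simp add: T[OF len])
  qed
  then show ?thesis by blast
qed

section \<open>Conjugation and integers of a real quadratic field\<close>

locale quadratic =
  fixes d :: nat
  assumes d_gt_1: "1 < d" and squarefree_d: "squarefree d"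
begin

abbreviation rd :: real where "rd \<equiv> sqrt (real d)"

abbreviation K :: "real set" where "K \<equiv> rat_sqrt d"

text \<open>
  Conjugation: for \<open>x\<close> in \<open>K\<close> the pair \<open>a, b\<close> is unique, elsewhere the value is unspecified.
\<close>

definition cj :: "real \<Rightarrow> real" where
  "cj x = (THE y. \<exists>a b. x = of_rat a + of_rat b * rd \<and> y = of_rat a - of_rat b * rd)"

text \<open>
  The order \<open>\<int>[\<surd>d]\<close> may be smaller than the ring of integers, but it has an explicit basis over the
  integers, and it is large enough to serve as the lattice of translations and as the
  source of quotients in all approximation arguments.
\<close>

definition Zs :: "real set" where
  "Zs = {of_int a + of_int b * rd | a b. True}"

lemma rd_irrational: "rd \<notin> \<rat>"
  using sqrt_squarefree_irrational d_gt_1 squarefree_d by blast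

lemma rd_square: "rd * rd = real d"
  by simp

lemma rd_gt_1: "rd > 1"
  using d_gt_1 by simp

lemma coords_unique:
  assumes "of_rat a + of_rat b * rd = of_rat a' + of_rat b' * rd"
  shows "a = a' \<and> b = b'"
proof -
  have "b = b'"
  proof (rule ccontr)
    assume "b \<noteq> b'"
    then have "rd = of_rat ((a' - a) / (b - b'))"
      using assms by (simp add: of_rat_divide of_rat_diff field_simps)
    with rd_irrational show False by (metis Rats_of_rat)
  qed
  with assms show ?thesis by simp
qed

lemma cj_coords [simp]: "cj (of_rat a + of_rat b * rd) = of_rat a - of_rat b * rd"
  unfolding cj_def by (rule the_equality) (use coords_unique in blast)+

lemma K_coords: "x \<in> K \<longleftrightarrow> (\<exists>a b. x = of_rat a + of_rat b * rd)"
  by (auto simp: rat_sqrt_def)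

lemma quadratic_K: "real_quadratic_field K"
  by (rule real_quadratic_field_rat_sqrt(1)[OF d_gt_1 squarefree_d])

lemma subfield_K: "real_subfield K"
  using quadratic_K by (simp add: real_quadratic_field_def)

lemmas K_closed [simp, intro] = real_subfield_closed[OF subfield_K]

lemma K_power [simp, intro]: "x \<in> K \<Longrightarrow> x ^ k \<in> K"
  by (induction k) auto

lemma rd_in_K [simp, intro]: "rd \<in> K"
  unfolding K_coords by (intro exI[of _ 0] exI[of _ 1]) simp

lemma cj_rat [simp]: "cj (of_rat q) = of_rat q"
  using cj_coords[of q 0] by simp

lemma cj_int [simp]: "cj (of_int k) = of_int k"
  using cj_rat[of "of_int k"] by simp

lemma cj_nat [simp]: "cj (of_nat k) = of_nat k"
  using cj_rat[of "of_nat k"] by simp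

lemma cj_0 [simp]: "cj 0 = 0" and cj_1 [simp]: "cj 1 = 1"
  using cj_int[of 0] cj_int[of 1] by simp_all

lemma cj_rd [simp]: "cj rd = - rd"
  using cj_coords[of 0 1] by simp

lemma cj_in_K [simp, intro]: "x \<in> K \<Longrightarrow> cj x \<in> K"
  unfolding K_coords by (elim exE) (metis cj_coords diff_conv_add_uminus mult_minus_left of_rat_minus)

lemma cj_add: "x \<in> K \<Longrightarrow> y \<in> K \<Longrightarrow> cj (x + y) = cj x + cj y"
proof -
  assume "x \<in> K" "y \<in> K"
  then obtain a b a' b' where xy: "x = of_rat a + of_rat b * rd" "y = of_rat a' + of_rat b' * rd"
    unfolding K_coords by blast
  have "x + y = of_rat (a + a') + of_rat (b + b') * rd"
    by (simp add: xy of_rat_add algebra_simps)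
  then show ?thesis by (simp only: cj_coords xy) (simp add: of_rat_add algebra_simps)
qed

lemma cj_mult: "x \<in> K \<Longrightarrow> y \<in> K \<Longrightarrow> cj (x * y) = cj x * cj y"
proof -
  assume "x \<in> K" "y \<in> K"
  then obtain a b a' b' where xy: "x = of_rat a + of_rat b * rd" "y = of_rat a' + of_rat b' * rd"
    unfolding K_coords by blast
  have "x * y = of_rat a * of_rat a' + of_rat b * of_rat b' * (rd * rd)
          + (of_rat a * of_rat b' + of_rat b * of_rat a') * rd"
    unfolding xy by (simp add: algebra_simps del: real_sqrt_mult_self)
  then have *: "x * y = of_rat (a * a' + b * b' * of_nat d) + of_rat (a * b' + b * a') * rd"
    unfolding rd_square by (simp add: of_rat_add of_rat_mult)
  have "cj x * cj y = of_rat a * of_rat a' + of_rat b * of_rat b' * (rd * rd)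
          - (of_rat a * of_rat b' + of_rat b * of_rat a') * rd"
    unfolding xy cj_coords by (simp add: algebra_simps del: real_sqrt_mult_self)
  then show ?thesis
    unfolding * rd_square cj_coords by (simp add: of_rat_add of_rat_mult)
qed

lemma cj_minus: "x \<in> K \<Longrightarrow> cj (- x) = - cj x"
  using cj_mult[of "-1" x] cj_int[of "-1"] by simp

lemma cj_diff: "x \<in> K \<Longrightarrow> y \<in> K \<Longrightarrow> cj (x - y) = cj x - cj y"
  using cj_add[of x "- y"] by (simp add: cj_minus)

lemma cj_power: "x \<in> K \<Longrightarrow> cj (x ^ k) = cj x ^ k"
  by (induction k) (auto simp: cj_mult)

lemma cj_cj: "x \<in> K \<Longrightarrow> cj (cj x) = x"
proof -
  assume "x \<in> K"
  then obtain a b where x: "x = of_rat a + of_rat b * rd" unfolding K_coords by blast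
  then have "cj x = of_rat a + of_rat (- b) * rd" by (simp add: of_rat_minus)
  then show ?thesis by (simp only: cj_coords) (simp add: x of_rat_minus)
qed

lemma cj_eq_0_iff: "x \<in> K \<Longrightarrow> cj x = 0 \<longleftrightarrow> x = 0"
  using cj_cj by force

lemma cj_divide: "x \<in> K \<Longrightarrow> y \<in> K \<Longrightarrow> cj (x / y) = cj x / cj y"
  using cj_mult[of "x / y" y] cj_eq_0_iff[of y] by (cases "y = 0") (auto simp: field_simps)

lemmas cj_simps = cj_add cj_mult cj_minus cj_diff cj_power cj_divide cj_cj cj_eq_0_iff

lemma norm_coords: "(of_rat a + of_rat b * rd) * cj (of_rat a + of_rat b * rd) =
    of_rat (a * a - of_nat d * (b * b))"
proof -
  have "(of_rat a + of_rat b * rd) * cj (of_rat a + of_rat b * rd)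
      = of_rat a * of_rat a - of_rat b * of_rat b * (rd * rd)"
    by (simp add: algebra_simps del: real_sqrt_mult_self)
  then show ?thesis unfolding rd_square by (simp add: of_rat_diff of_rat_mult)
qed

lemma norm_field_norm: "x \<in> K \<Longrightarrow> norm (field_norm K x) = \<bar>x * cj x\<bar>"
proof -
  assume "x \<in> K"
  then obtain a b where x: "x = of_rat a + of_rat b * rd" unfolding K_coords by blast
  show ?thesis
    unfolding x norm_coords field_norm_rat_sqrt[OF d_gt_1 squarefree_d]
    by (metis norm_of_real of_real_of_rat)
qed

lemma decreasing_iff: "\<beta> \<in> K \<Longrightarrow> r \<in> K \<Longrightarrow> decreasing K \<beta> r \<longleftrightarrow> \<bar>r * cj r\<bar> < \<bar>\<beta> * cj \<beta>\<bar>"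
  by (simp add: decreasing_def norm_field_norm)

lemma Zs_coords [simp]: "of_int a + of_int b * rd \<in> Zs"
  by (auto simp: Zs_def)

lemma cj_Zs_coords: "cj (of_int a + of_int b * rd) = of_int a - of_int b * rd"
  using cj_coords[of "of_int a" "of_int b"] by simp

lemma Zrd_in_K: "x \<in> Zs \<Longrightarrow> x \<in> K"
  by (auto simp: Zs_def)

lemma Zs_closed:
  "of_int k \<in> Zs" "of_nat n \<in> Zs" "0 \<in> Zs" "1 \<in> Zs" "rd \<in> Zs"
  "x \<in> Zs \<Longrightarrow> y \<in> Zs \<Longrightarrow> x + y \<in> Zs" "x \<in> Zs \<Longrightarrow> y \<in> Zs \<Longrightarrow> x - y \<in> Zs"
  "x \<in> Zs \<Longrightarrow> y \<in> Zs \<Longrightarrow> x * y \<in> Zs" "x \<in> Zs \<Longrightarrow> - x \<in> Zs" "x \<in> Zs \<Longrightarrow> cj x \<in> Zs"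
proof -
  show int: "of_int k \<in> Zs" for k using Zs_coords[of k 0] by simp
  show "of_nat n \<in> Zs" using int[of "int n"] by simp
  show "0 \<in> Zs" "1 \<in> Zs" using int[of 0] int[of 1] by simp_all
  show "rd \<in> Zs" using Zs_coords[of 0 1] by simp
  show "x + y \<in> Zs" "x - y \<in> Zs" "x * y \<in> Zs" if xy: "x \<in> Zs" "y \<in> Zs" for x y
  proof -
    obtain a b a' b' where xy: "x = of_int a + of_int b * rd" "y = of_int a' + of_int b' * rd"
      using xy unfolding Zs_def by blast
    have "x + y = of_int (a + a') + of_int (b + b') * rd" "x - y = of_int (a - a') + of_int (b - b') * rd"
      by (simp_all add: xy algebra_simps)
    then show "x + y \<in> Zs" "x - y \<in> Zs" by (metis Zs_coords)+
    have "x * y = of_int a * of_int a' + of_int b * of_int b' * (rd * rd)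
          + (of_int a * of_int b' + of_int b * of_int a') * rd"
      unfolding xy by (simp add: algebra_simps del: real_sqrt_mult_self)
    then have "x * y = of_int (a * a' + b * b' * int d) + of_int (a * b' + b * a') * rd"
      unfolding rd_square by simp
    then show "x * y \<in> Zs" by (metis Zs_coords)
  qed
  show "- x \<in> Zs" if x: "x \<in> Zs" for x
    using \<open>\<And>x y. x \<in> Zs \<Longrightarrow> y \<in> Zs \<Longrightarrow> x - y \<in> Zs\<close>[OF int[of 0] x] by simp
  show "cj x \<in> Zs" if "x \<in> Zs" for x
  proof -
    obtain a b where "x = of_int a + of_int b * rd" using \<open>x \<in> Zs\<close> unfolding Zs_def by blast
    then have "cj x = of_int a + of_int (- b) * rd" by (simp add: cj_Zs_coords)
    then show ?thesis by (metis Zs_coords)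
  qed
qed

lemma Zs_power: "x \<in> Zs \<Longrightarrow> x ^ k \<in> Zs"
  by (induction k) (auto intro: Zs_closed)

lemma Zs_sum: "(\<And>i. i \<in> A \<Longrightarrow> f i \<in> Zs) \<Longrightarrow> sum f A \<in> Zs"
  by (induction A rule: infinite_finite_induct) (auto intro: Zs_closed)

lemma norm_Zs_coords: "(of_int a + of_int b * rd) * cj (of_int a + of_int b * rd) =
    of_int (a * a - int d * (b * b))"
proof -
  have "(of_int a + of_int b * rd) * cj (of_int a + of_int b * rd)
      = of_int a * of_int a - of_int b * of_int b * (rd * rd)"
    unfolding cj_Zs_coords by (simp add: algebra_simps del: real_sqrt_mult_self)
  then show ?thesis unfolding rd_square by simp
qed

lemma norm_Zs_int: "x \<in> Zs \<Longrightarrow> x * cj x \<in> \<int>"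
  unfolding Zs_def by (auto simp: norm_Zs_coords simp del: of_int_diff of_int_mult)

lemma K_denominator:
  assumes "x \<in> K" obtains D :: nat where "D > 0" "real D * x \<in> Zs"
proof -
  obtain a b where x: "x = of_rat a + of_rat b * rd" using assms unfolding K_coords by blast
  obtain m k where a: "a = Fract m k" "k > 0" by (cases a) auto
  obtain m' k' where b: "b = Fract m' k'" "k' > 0" by (cases b) auto
  have "real (nat (k * k')) * x = of_int (m * k') + of_int (m' * k) * rd"
    unfolding x a b using a b by (simp add: of_rat_rat field_simps)
  then show ?thesis using a b by (intro that[of "nat (k * k')"]) (auto simp del: of_int_mult)
qed

subsection \<open>Integrality\<close>

text \<open>
  Algebraic integers of \<open>K\<close> are the elements whose powers have a common denominator. This
  form is visibly closed under the ring operations, and it forces trace and norm to be integers,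
  because a rational number whose powers have a common denominator is an integer.
\<close>

definition powers_bounded :: "real \<Rightarrow> bool" where
  "powers_bounded x \<longleftrightarrow> (\<exists>D>0. \<forall>k. real D * x ^ k \<in> Zs)"

lemma powers_bounded_add:
  assumes "powers_bounded x" "powers_bounded y" shows "powers_bounded (x + y)"
proof -
  obtain D E where D: "D > 0" "\<And>k. real D * x ^ k \<in> Zs" and E: "E > 0" "\<And>k. real E * y ^ k \<in> Zs"
    using assms unfolding powers_bounded_def by blast
  have "real (D * E) * (x + y) ^ k \<in> Zs" for k
  proof -
    have "real (D * E) * (x + y) ^ k =
        (\<Sum>i\<le>k. of_nat (k choose i) * ((real D * x ^ i) * (real E * y ^ (k - i))))"
      by (simp add: binomial_ring sum_distrib_left algebra_simps)
    also have "\<dots> \<in> Zs" by (intro Zs_sum Zs_closed D E)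
    finally show ?thesis .
  qed
  then show ?thesis using D(1) E(1) unfolding powers_bounded_def by (intro exI[of _ "D * E"]) auto
qed

lemma powers_bounded_mult:
  assumes "powers_bounded x" "powers_bounded y" shows "powers_bounded (x * y)"
proof -
  obtain D E where D: "D > 0" "\<And>k. real D * x ^ k \<in> Zs" and E: "E > 0" "\<And>k. real E * y ^ k \<in> Zs"
    using assms unfolding powers_bounded_def by blast
  have "real (D * E) * (x * y) ^ k \<in> Zs" for k
    using Zs_closed(8)[OF D(2)[of k] E(2)[of k]] by (simp add: power_mult_distrib mult_ac)
  then show ?thesis using D(1) E(1) unfolding powers_bounded_def by (intro exI[of _ "D * E"]) auto
qed

lemma powers_bounded_Zs: "x \<in> Zs \<Longrightarrow> powers_bounded x"
  unfolding powers_bounded_def by (intro exI[of _ 1]) (auto intro: Zs_power)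

lemma algebraic_int_powers_bounded:
  assumes "x \<in> K" "algebraic_int x" shows "powers_bounded x"
proof -
  obtain p where p: "poly p x = 0" "lead_coeff p = 1" "\<And>i. coeff p i \<in> \<int>"
    using assms(2) by (auto simp: algebraic_int.simps)
  define n where "n = degree p"
  obtain D where D: "D > 0" "real D * x \<in> Zs" using K_denominator[OF assms(1)] .
  have "real (D ^ n) * x ^ k \<in> Zs" for k
  proof (induction k rule: less_induct)
    case (less k)
    show ?case
    proof (cases "k < n")
      case True
      then have "real (D ^ n) * x ^ k = real (D ^ (n - k)) * (real D * x) ^ k"
        by (simp add: power_mult_distrib flip: power_add)
      then show ?thesis using D(2) by (auto intro: Zs_closed Zs_power simp flip: of_nat_power)
    next
      case False
      have "0 = (\<Sum>i\<le>n. coeff p i * x ^ i)" using p(1) by (simp add: poly_altdef n_def)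
      also have "\<dots> = (\<Sum>i<n. coeff p i * x ^ i) + x ^ n"
        using p(2) by (simp add: n_def flip: lessThan_Suc_atMost)
      finally have "x ^ n = - (\<Sum>i<n. coeff p i * x ^ i)" by simp
      moreover have "x ^ k = x ^ (k - n) * x ^ n" using False by (simp flip: power_add)
      ultimately have "real (D ^ n) * x ^ k
          = - (\<Sum>i<n. coeff p i * (real (D ^ n) * x ^ (k - n + i)))"
        by (simp add: sum_distrib_left power_add mult_ac)
      also have "\<dots> \<in> Zs"
      proof (intro Zs_closed(9) Zs_sum)
        fix i assume "i \<in> {..<n}"
        then have "real (D ^ n) * x ^ (k - n + i) \<in> Zs" using less False by simp
        moreover have "coeff p i \<in> Zs" using p(3)[of i] Zs_closed(1) by (auto elim: Ints_cases)
        ultimately show "coeff p i * (real (D ^ n) * x ^ (k - n + i)) \<in> Zs"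
          by (rule Zs_closed(8)[rotated])
      qed
      finally show ?thesis .
    qed
  qed
  then show ?thesis using D(1) unfolding powers_bounded_def by (intro exI[of _ "D ^ n"]) auto
qed

text \<open>
  The denominator \<open>b\<close> of \<open>q\<close> satisfies \<open>b ^ k dvd D\<close> for all \<open>k\<close>.
\<close>

lemma rational_bounded_powers_int:
  fixes D :: nat and q :: rat
  assumes "D > 0" "\<And>k. of_nat D * q ^ k \<in> \<int>"
  shows "q \<in> \<int>"
proof -
  obtain a b where q: "q = Fract a b" "b > 0" "coprime a b" by (cases q) auto
  have dvd: "b ^ k dvd int D" for k
  proof -
    obtain c where c: "of_nat D * q ^ k = of_int c" using assms(2)[of k] by (auto elim: Ints_cases)
    have qk: "q ^ k = of_int (a ^ k) / of_int (b ^ k)" using q by (simp add: Fract_of_int_quotient power_divide)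
    have "of_int (int D * a ^ k) = (of_int (c * b ^ k) :: rat)"
      using c q(2) unfolding qk by (simp add: field_simps)
    then have "int D * a ^ k = c * b ^ k" by (simp only: of_int_eq_iff)
    then have "b ^ k dvd int D * a ^ k" by simp
    moreover have "coprime (b ^ k) (a ^ k)" using q(3) by (simp add: coprime_commute)
    ultimately show ?thesis by (simp add: coprime_dvd_mult_left_iff)
  qed
  have "b = 1"
  proof (rule ccontr)
    assume "b \<noteq> 1"
    then have "2 ^ D \<le> b ^ D" using q(2) by (intro power_mono) auto
    also have "b ^ D \<le> int D" using dvd[of D] assms(1) by (intro zdvd_imp_le) auto
    finally have "int (2 ^ D) \<le> int D" by simp
    then have "2 ^ D \<le> D" by (simp only: of_nat_le_iff)
    then show False using less_exp[of D] by simp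
  qed
  then show ?thesis using q by (simp add: Fract_of_int_quotient)
qed

lemma powers_bounded_norm_int:
  assumes "x \<in> K" "powers_bounded x" shows "x * cj x \<in> \<int>"
proof -
  obtain a b where x: "x = of_rat a + of_rat b * rd" using assms(1) unfolding K_coords by blast
  define q where "q = a * a - of_nat d * (b * b)"
  have q: "x * cj x = of_rat q" unfolding x norm_coords q_def ..
  obtain D where D: "D > 0" "\<And>k. real D * x ^ k \<in> Zs"
    using assms unfolding powers_bounded_def by blast
  have "of_nat (D * D) * q ^ k \<in> \<int>" for k
  proof -
    have "of_rat (of_nat (D * D) * q ^ k) = real (D * D) * (x * cj x) ^ k"
      unfolding q by (simp add: of_rat_mult of_rat_power)
    also have "\<dots> = (real D * x ^ k) * cj (real D * x ^ k)"
      using assms(1) by (simp add: cj_simps power_mult_distrib mult_ac)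
    finally have "of_rat (of_nat (D * D) * q ^ k) \<in> (\<int> :: real set)"
      using norm_Zs_int[OF D(2)[of k]] by simp
    then obtain m where "real_of_rat (of_nat (D * D) * q ^ k) = of_rat (of_int m)"
      by (elim Ints_cases) auto
    then show ?thesis by (simp only: of_rat_eq_iff) auto
  qed
  moreover have "D * D > 0" using D(1) by simp
  ultimately have "q \<in> \<int>" by (rule rational_bounded_powers_int[rotated])
  then obtain m where "q = of_int m" by (elim Ints_cases)
  then show ?thesis unfolding q by simp
qed

text \<open>
  The trace is read off from the norms of \<open>x\<close> and \<open>x + 1\<close>.
\<close>

lemma powers_bounded_trace_int:
  assumes "x \<in> K" "powers_bounded x" shows "x + cj x \<in> \<int>"
proof -
  have "(x + 1) * cj (x + 1) \<in> \<int>"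
    by (intro powers_bounded_norm_int powers_bounded_add powers_bounded_Zs Zs_closed(4) K_closed assms)
  then have "(x + 1) * cj (x + 1) - x * cj x - 1 \<in> \<int>"
    using powers_bounded_norm_int[OF assms] by auto
  then show ?thesis using assms(1) by (simp add: cj_simps algebra_simps)
qed

lemma trace_norm_algebraic_int:
  assumes "x \<in> K" "x + cj x \<in> \<int>" "x * cj x \<in> \<int>" shows "algebraic_int x"
proof (rule algebraic_int.intros)
  show "poly [:x * cj x, - (x + cj x), 1:] x = 0" by (simp add: algebra_simps)
  have "- (x + cj x) \<in> \<int>" using assms by (simp only: Ints_minus)
  then show "\<forall>i. coeff [:x * cj x, - (x + cj x), 1:] i \<in> \<int>"
    using assms by (auto simp: coeff_pCons split: nat.splits)
qed simp

abbreviation OK :: "real set" where "OK \<equiv> ring_of_integers K"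

lemma OK_iff_trace_norm: "x \<in> OK \<longleftrightarrow> x \<in> K \<and> x + cj x \<in> \<int> \<and> x * cj x \<in> \<int>"
  unfolding ring_of_integers_def
  using trace_norm_algebraic_int algebraic_int_powers_bounded powers_bounded_norm_int
    powers_bounded_trace_int by blast

lemma OK_iff_powers_bounded: "x \<in> OK \<longleftrightarrow> x \<in> K \<and> powers_bounded x"
  using OK_iff_trace_norm algebraic_int_powers_bounded powers_bounded_norm_int
    powers_bounded_trace_int unfolding ring_of_integers_def by blast

lemma OK_in_K: "x \<in> OK \<Longrightarrow> x \<in> K"
  by (simp add: ring_of_integers_def)

lemma Zs_in_OK: "x \<in> Zs \<Longrightarrow> x \<in> OK"
  by (simp add: OK_iff_powers_bounded powers_bounded_Zs Zrd_in_K)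

lemma OK_closed: "x \<in> OK \<Longrightarrow> y \<in> OK \<Longrightarrow> x + y \<in> OK" "x \<in> OK \<Longrightarrow> y \<in> OK \<Longrightarrow> x * y \<in> OK"
  "x \<in> OK \<Longrightarrow> y \<in> OK \<Longrightarrow> x - y \<in> OK"
proof -
  show add: "x + y \<in> OK" and mult: "x * y \<in> OK" if "x \<in> OK" "y \<in> OK" for x y
    using that by (auto simp: OK_iff_powers_bounded intro: powers_bounded_add powers_bounded_mult)
  show "x - y \<in> OK" if "x \<in> OK" "y \<in> OK"
  proof -
    have "-1 \<in> OK" using Zs_in_OK[OF Zs_closed(1)[of "-1"]] by simp
    then show ?thesis using add[OF that(1) mult[of "-1" y]] that by simp
  qed
qed

section \<open>Units\<close>

text \<open>
  Pell's equation: infinitely many good approximations to \<open>\<surd>d\<close> have bounded norm, so two of them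
  agree in norm and modulo that norm. Their quotient is a unit, and it or its conjugate exceeds 1.
\<close>

lemma unit_exists: "\<exists>\<epsilon>\<in>Zs. \<epsilon> > 1 \<and> \<epsilon> * cj \<epsilon> = 1"
proof -
  define C :: int where "C = \<lceil>2 * rd + 1\<rceil>"
  define nm where "nm h k = h * h - int d * (k * k)" for h k :: int
  define f where "f = (\<lambda>(h, k). (nm h k, h mod nm h k, k mod nm h k))"
  have A: "0 < k \<and> 0 < h \<and> \<bar>nm h k\<bar> \<le> C" if "(h, k) \<in> approx_set rd" for h k
  proof -
    have k: "k > 0" and app: "\<bar>rd - of_int h / of_int k\<bar> < 1 / (of_int k)\<^sup>2"
      using that by (auto simp: approx_set_def)
    have "\<bar>of_int k * rd - of_int h\<bar> = of_int k * \<bar>rd - of_int h / of_int k\<bar>"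
      using k by (simp add: abs_if field_simps)
    also have "\<dots> < of_int k * (1 / (of_int k)\<^sup>2)"
      using app k by (intro mult_strict_left_mono) auto
    also have "\<dots> = 1 / of_int k" using k by (simp add: power2_eq_square)
    finally have 1: "\<bar>of_int k * rd - of_int h\<bar> < 1 / of_int k" .
    have "1 / of_int k \<le> (1::real)" using k by (simp add: field_simps)
    have "of_int k * rd \<ge> of_int k" using k rd_gt_1 by simp
    moreover have "of_int k \<ge> (1::real)" using k by simp
    ultimately have "real_of_int h > 0" using 1 \<open>1 / of_int k \<le> (1::real)\<close> by linarith
    have k1: "real_of_int k \<ge> 1" using k by simp
    have "\<bar>of_int h + of_int k * rd\<bar> \<le> 2 * of_int k * rd + 1"
      using 1 \<open>1 / of_int k \<le> (1::real)\<close> \<open>of_int k * rd \<ge> of_int k\<close> k1 \<open>real_of_int h > 0\<close> by linarith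
    also have "\<dots> \<le> of_int k * (2 * rd + 1)" using k1 by (simp add: algebra_simps)
    finally have 2: "\<bar>of_int h + of_int k * rd\<bar> \<le> of_int k * (2 * rd + 1)" .
    have "\<bar>real_of_int (nm h k)\<bar> = \<bar>of_int k * rd - of_int h\<bar> * \<bar>of_int h + of_int k * rd\<bar>"
    proof -
      have "real_of_int (nm h k) = (of_int h + of_int k * rd) * (of_int h - of_int k * rd)"
        unfolding nm_def using norm_Zs_coords[of h k] by (simp only: cj_Zs_coords)
      then show ?thesis by (simp add: abs_mult abs_minus_commute mult.commute)
    qed
    also have "\<dots> \<le> (1 / of_int k) * (of_int k * (2 * rd + 1))"
      using 1 2 k by (intro mult_mono) auto
    also have "\<dots> = 2 * rd + 1" using k by simp
    finally have "\<bar>nm h k\<bar> \<le> C" unfolding C_def by linarith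
    then show ?thesis using k \<open>real_of_int h > 0\<close> by simp
  qed
  have mod_bound: "\<bar>x mod m\<bar> \<le> C" if "\<bar>m\<bar> \<le> C" "m \<noteq> 0" for x m :: int
    using that abs_mod_less[of m x] by linarith
  have nz: "nm h k \<noteq> 0" if "k > 0" for h k
  proof
    assume "nm h k = 0"
    then have "(of_int h + of_int k * rd) * cj (of_int h + of_int k * rd) = 0"
      using norm_Zs_coords[of h k] by (simp only: nm_def)
    then have "of_int h + of_int k * rd = 0"
      using cj_eq_0_iff[OF Zrd_in_K, OF Zs_coords[of h k]] by auto
    then have "of_rat (of_int h) + of_rat (of_int k) * rd = of_rat 0 + of_rat 0 * rd" by simp
    then have "of_int k = (0::rat)" using coords_unique by blast
    then show False using that by simp
  qed
  have inf: "infinite (approx_set rd)" using rd_irrational rational_iff_finite_approx_set by blast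
  have "f ` approx_set rd \<subseteq> {-C..C} \<times> {-C..C} \<times> {-C..C}"
  proof (rule image_subsetI, clarsimp simp del: atLeastAtMost_iff mem_Sigma_iff)
    fix h k assume "(h, k) \<in> approx_set rd"
    from A[OF this] nz[of k h] mod_bound[of "nm h k"]
    have "\<bar>nm h k\<bar> \<le> C" "\<bar>h mod nm h k\<bar> \<le> C" "\<bar>k mod nm h k\<bar> \<le> C" by blast+
    then show "f (h, k) \<in> {-C..C} \<times> {-C..C} \<times> {-C..C}" unfolding f_def by auto
  qed
  then have "finite (f ` approx_set rd)" by (rule finite_subset) auto
  then have "\<not> inj_on f (approx_set rd)" using inf finite_imageD by blast
  then obtain h k h' k' where hk: "(h, k) \<in> approx_set rd" "(h', k') \<in> approx_set rd"
    "f (h, k) = f (h', k')" "(h, k) \<noteq> (h', k')"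
    unfolding inj_on_def by auto
  define m where "m = nm h k"
  have m: "nm h' k' = m" "h mod m = h' mod m" "k mod m = k' mod m"
    using hk(3) unfolding f_def m_def by auto
  have pos: "k > 0" "h > 0" "k' > 0" "h' > 0" using A hk(1,2) by auto
  have m0: "m \<noteq> 0" using nz pos m_def by auto
  define x y where "x = of_int h + of_int k * rd" and "y = of_int h' + of_int k' * rd"
  have xy: "x \<in> Zs" "y \<in> Zs" "x > 0" "y > 0" 
    using pos rd_gt_1 unfolding x_def y_def by (auto intro!: add_pos_pos mult_pos_pos)
  have Nx: "x * cj x = of_int m" unfolding x_def norm_Zs_coords m_def nm_def ..
  have Ny: "y * cj y = of_int m" unfolding y_def norm_Zs_coords m(1)[symmetric] nm_def ..
  define \<epsilon> where "\<epsilon> = x * cj y / of_int m"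
  have "x * cj y = of_int (h * h' - int d * (k * k')) + of_int (h' * k - h * k') * rd"
  proof -
    have "x * cj y = of_int h * of_int h' - of_int k * of_int k' * (rd * rd)
       + (of_int h' * of_int k - of_int h * of_int k') * rd"
      unfolding x_def y_def cj_Zs_coords by (simp add: algebra_simps del: real_sqrt_mult_self)
    then show ?thesis unfolding rd_square by simp
  qed
  moreover obtain u v where uv: "h' = h - m * u" "k' = k - m * v"
  proof -
    have "m dvd h - h'" "m dvd k - k'" using m(2,3) by (auto simp: mod_eq_dvd_iff)
    then obtain u v where "h - h' = m * u" "k - k' = m * v" by (auto elim!: dvdE)
    then show ?thesis by (intro that[of u v]) auto
  qed
  moreover have "h * h' - int d * (k * k') = m * (1 - h * u + int d * (k * v))"
    unfolding uv using m_def by (simp add: nm_def algebra_simps)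
  moreover have "h' * k - h * k' = m * (h * v - u * k)"
    unfolding uv by (simp add: algebra_simps)
  ultimately have "x * cj y = of_int (m * (1 - h * u + int d * (k * v))) + of_int (m * (h * v - u * k)) * rd"
    by (simp only:)
  then obtain a b where "x * cj y = of_int (m * a) + of_int (m * b) * rd" by blast
  then have "\<epsilon> = of_int a + of_int b * rd" using m0 by (simp add: \<epsilon>_def field_simps)
  then have eZ: "\<epsilon> \<in> Zs" by simp
  have xK: "x \<in> K" "y \<in> K" using xy Zrd_in_K by auto
  have "\<epsilon> * cj \<epsilon> = (x * cj x) * (y * cj y) / (of_int m * of_int m)"
    unfolding \<epsilon>_def using xK by (simp add: cj_simps mult_ac)
  then have Ne: "\<epsilon> * cj \<epsilon> = 1" using Nx Ny m0 by simp
  have "cj y / of_int m > 0"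
  proof -
    have "cj y / of_int m = 1 / y" using Ny m0 xy(4) by (simp add: field_simps)
    then show ?thesis using xy by simp
  qed
  from mult_pos_pos[OF xy(3) this] have e0: "\<epsilon> > 0" by (simp add: \<epsilon>_def)
  have e1: "\<epsilon> \<noteq> 1"
  proof
    assume "\<epsilon> = 1"
    then have "x * cj y = y * cj y" using m0 unfolding Ny by (simp add: \<epsilon>_def)
    moreover have "cj y \<noteq> 0" using xK cj_eq_0_iff xy by auto
    ultimately have "x = y" by simp
    then have "of_rat (of_int h) + of_rat (of_int k) * rd = of_rat (of_int h') + of_rat (of_int k') * rd"
      by (simp add: x_def y_def)
    then show False using coords_unique[of "of_int h" "of_int k" "of_int h'" "of_int k'"] hk(4) by auto
  qed
  show ?thesis
  proof (cases "\<epsilon> > 1")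
    case True
    then show ?thesis using eZ Ne by blast
  next
    case False
    then have "cj \<epsilon> > 1" using Ne e0 e1
      by (smt (verit, best) mult_le_cancel_left2)
    moreover have "cj \<epsilon> * cj (cj \<epsilon>) = 1" using Ne cj_cj[OF Zrd_in_K[OF eZ]] by (simp add: mult.commute)
    ultimately show ?thesis using Zs_closed(10)[OF eZ] by blast
  qed
qed

definition \<epsilon> :: real where "\<epsilon> = (SOME \<epsilon>. \<epsilon> \<in> Zs \<and> \<epsilon> > 1 \<and> \<epsilon> * cj \<epsilon> = 1)"

lemma \<epsilon>_unit: "\<epsilon> \<in> Zs" "\<epsilon> > 1" "\<epsilon> * cj \<epsilon> = 1"
  using someI_ex[of "\<lambda>\<epsilon>. \<epsilon> \<in> Zs \<and> \<epsilon> > 1 \<and> \<epsilon> * cj \<epsilon> = 1"] unit_exists unfolding \<epsilon>_def by auto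

lemma cj_\<epsilon>: "cj \<epsilon> = inverse \<epsilon>"
  using \<epsilon>_unit by (metis inverse_unique)

lemma \<epsilon>_powi: "\<epsilon> powi k \<in> Zs" "cj (\<epsilon> powi k) = \<epsilon> powi (- k)"
proof -
  have "\<epsilon> ^ k \<in> Zs" "inverse \<epsilon> ^ k \<in> Zs" "cj (\<epsilon> ^ k) = inverse \<epsilon> ^ k" "cj (inverse \<epsilon> ^ k) = \<epsilon> ^ k" for k
    using Zs_power[OF \<epsilon>_unit(1)] Zs_power[OF Zs_closed(10)[OF \<epsilon>_unit(1)]]
      cj_power[OF Zrd_in_K[OF \<epsilon>_unit(1)]] cj_power[OF cj_in_K[OF Zrd_in_K[OF \<epsilon>_unit(1)]]]
      cj_cj[OF Zrd_in_K[OF \<epsilon>_unit(1)]] by (auto simp: cj_\<epsilon>)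
  then show "\<epsilon> powi k \<in> Zs" "cj (\<epsilon> powi k) = \<epsilon> powi (- k)"
    by (auto simp: power_int_def power_inverse)
qed

subsection \<open>Units modulo powers of an element of split type\<close>

text \<open>
  The norm \<open>d * d + d + 1\<close> of \<open>\<pi>\<close> is odd and coprime to the trace \<open>2 * (d + 1)\<close>. Hence \<open>\<pi>\<close> and its
  conjugate are coprime, and the residue ring modulo a power of \<open>\<pi>\<close> is a quotient of the integers, as
  for a power of a prime of degree one. Unlike such a prime, \<open>\<pi>\<close> exists in closed form for every \<open>d\<close>.
\<close>

definition \<pi> :: real where "\<pi> = real (d + 1) + rd"

definition N\<pi> :: nat where "N\<pi> = d * d + d + 1"

lemma \<pi>_Zs: "\<pi> \<in> Zs" "cj \<pi> \<in> Zs"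
  unfolding \<pi>_def by (intro Zs_closed)+

lemma cj_\<pi>: "cj \<pi> = real (d + 1) - rd"
  unfolding \<pi>_def using cj_add[of "real (d + 1)" rd] cj_nat[of "d + 1"] by (simp only: K_closed rd_in_K cj_rd)

lemma norm_\<pi>: "\<pi> * cj \<pi> = real N\<pi>"
proof -
  have "\<pi> * cj \<pi> = real (d + 1) * real (d + 1) - rd * rd"
    by (simp only: cj_\<pi>) (simp add: \<pi>_def algebra_simps del: real_sqrt_mult_self)
  then show ?thesis unfolding rd_square by (simp add: N\<pi>_def algebra_simps)
qed

lemma cj_\<pi>_gt_1: "cj \<pi> > 1"
proof -
  have "rd < sqrt (real d * real d)" using d_gt_1 by (simp only: real_sqrt_less_iff) simp
  then have "rd < real d" by simp
  then show ?thesis unfolding cj_\<pi> by simp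
qed

lemma \<pi>_gt_1: "\<pi> > 1"
  unfolding \<pi>_def using rd_gt_1 by linarith

lemma N\<pi>_gt_1: "N\<pi> > 1"
  using d_gt_1 by (simp add: N\<pi>_def)

lemma odd_N\<pi>: "odd N\<pi>"
  by (simp add: N\<pi>_def)

lemma Zs_int_mod_\<pi>:
  assumes "b \<in> Zs" shows "\<exists>B::int. \<exists>q\<in>Zs. b = of_int B + \<pi> * q"
proof -
  obtain a1 a2 where b: "b = of_int a1 + of_int a2 * rd" using assms unfolding Zs_def by blast
  have "b = of_int (a1 - a2 * (int d + 1)) + \<pi> * of_int a2"
    unfolding b \<pi>_def by (simp add: algebra_simps)
  moreover have "of_int a2 \<in> Zs" by (rule Zs_closed)
  ultimately show ?thesis by blast
qed

lemma cj_\<pi>_power_mod_\<pi>: "\<exists>q\<in>Zs. cj \<pi> ^ t = of_nat ((2 * (d + 1)) ^ t) + \<pi> * q"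
proof (induction t)
  case 0
  show ?case using Zs_closed(3) by (intro bexI[of _ 0]) auto
next
  case (Suc t)
  then obtain q where q: "q \<in> Zs" "cj \<pi> ^ t = of_nat ((2 * (d + 1)) ^ t) + \<pi> * q" by blast
  have "cj \<pi> = of_nat (2 * (d + 1)) - \<pi>" by (simp only: cj_\<pi>) (simp add: \<pi>_def)
  then have "cj \<pi> * of_nat ((2 * (d + 1)) ^ t)
      = of_nat (2 * (d + 1)) * of_nat ((2 * (d + 1)) ^ t) - \<pi> * of_nat ((2 * (d + 1)) ^ t)"
    by (simp only: left_diff_distrib)
  then have "cj \<pi> ^ Suc t = of_nat ((2 * (d + 1)) ^ Suc t) + \<pi> * (q * cj \<pi> - of_nat ((2 * (d + 1)) ^ t))"
    unfolding power_Suc q(2) distrib_left of_nat_mult right_diff_distrib by (simp only: mult_ac)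
  moreover have "q * cj \<pi> - of_nat ((2 * (d + 1)) ^ t) \<in> Zs" by (intro Zs_closed q \<pi>_Zs)
  ultimately show ?case by blast
qed

lemma coprime_trace_norm_\<pi>: "coprime (2 * (d + 1)) N\<pi>"
proof -
  have "N\<pi> = 1 + d * (d + 1)" by (simp add: N\<pi>_def)
  then have "coprime (d + 1) N\<pi>" by (metis coprime_1_right coprime_iff_gcd_eq_1 gcd_add_mult add.commute mult.commute)
  moreover have "coprime 2 N\<pi>" using odd_N\<pi> by simp
  ultimately show ?thesis by (simp only: coprime_mult_left_iff)
qed

text \<open>
  Every residue modulo \<open>\<pi>\<close> is represented by an integer, and \<open>cj \<pi>\<close> is invertible modulo \<open>\<pi>\<close> because it is
  congruent to the trace.
\<close>

lemma solve_mod_\<pi>: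
  assumes "b \<in> Zs" shows "\<exists>r::nat. \<exists>q\<in>Zs. real r * cj \<pi> ^ t = b + \<pi> * q"
proof -
  obtain B q where q: "q \<in> Zs" "b = of_int B + \<pi> * q" using Zs_int_mod_\<pi>[OF assms] by blast
  obtain q' where q': "q' \<in> Zs" "cj \<pi> ^ t = of_nat ((2 * (d + 1)) ^ t) + \<pi> * q'"
    using cj_\<pi>_power_mod_\<pi> by blast
  define u where "u = int ((2 * (d + 1)) ^ t)"
  have "coprime ((2 * (d + 1)) ^ t) N\<pi>" using coprime_trace_norm_\<pi> by simp
  then have "coprime u (int N\<pi>)" unfolding u_def by (simp only: coprime_int_iff)
  then obtain v v' where "v * u + v' * int N\<pi> = 1" using bezout_int[of u "int N\<pi>"] by auto
  then have "u * v - 1 = int N\<pi> * (- v')" by (simp add: algebra_simps)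
  then have "int N\<pi> dvd u * v - 1" by simp
  then have "int N\<pi> dvd (u * v - 1) * B" by simp
  moreover define r where "r = nat ((v * B) mod int N\<pi>)"
  have r: "int r = (v * B) mod int N\<pi>" using N\<pi>_gt_1 by (simp add: r_def)
  then have "int N\<pi> dvd v * B - int r" by (metis mod_eq_dvd_iff mod_mod_trivial)
  then have "int N\<pi> dvd u * (v * B - int r)" by simp
  ultimately have "int N\<pi> dvd (u * v - 1) * B - u * (v * B - int r)" by (rule dvd_diff)
  then have "int N\<pi> dvd u * int r - B" by (simp add: algebra_simps)
  then obtain k where k: "u * int r - B = int N\<pi> * k" by (elim dvdE)
  have "real r * of_nat ((2 * (d + 1)) ^ t) - of_int B = of_int (u * int r - B)"
    unfolding u_def by (simp add: mult.commute)
  also have "\<dots> = \<pi> * (cj \<pi> * of_int k)" unfolding k using norm_\<pi> by (simp flip: mult.assoc)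
  finally have "real r * cj \<pi> ^ t = b + \<pi> * (cj \<pi> * of_int k - q + real r * q')"
    unfolding q' q by (simp add: algebra_simps)
  moreover have "cj \<pi> * of_int k - q + real r * q' \<in> Zs"
    using \<pi>_Zs q q' by (intro Zs_closed) auto
  ultimately show ?thesis by blast
qed

lemma power_expansion2: "h \<in> Zs \<Longrightarrow> \<exists>w\<in>Zs. (1 + h) ^ m = 1 + of_nat m * h + h\<^sup>2 * w"
proof (induction m)
  case 0
  then show ?case using Zs_closed(3) by (intro bexI[of _ 0]) auto
next
  case (Suc m)
  then obtain w where w: "w \<in> Zs" "(1 + h) ^ m = 1 + of_nat m * h + h\<^sup>2 * w" by blast
  have "(1 + h) ^ Suc m = 1 + of_nat (Suc m) * h + h\<^sup>2 * (of_nat m + w + h * w)"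
    unfolding power_Suc w by (simp add: algebra_simps power2_eq_square)
  moreover have "of_nat m + w + h * w \<in> Zs" by (intro Zs_closed w Suc.prems)
  ultimately show ?case by blast
qed

lemma power_expansion3:
  "h \<in> Zs \<Longrightarrow> \<exists>w\<in>Zs. (1 + h) ^ m = 1 + of_nat m * h + of_nat (m choose 2) * h\<^sup>2 + h ^ 3 * w"
proof (induction m)
  case 0
  then show ?case using Zs_closed(3) by (intro bexI[of _ 0]) auto
next
  case (Suc m)
  then obtain w where w: "w \<in> Zs"
    "(1 + h) ^ m = 1 + of_nat m * h + of_nat (m choose 2) * h\<^sup>2 + h ^ 3 * w" by blast
  have "(1 + h) ^ Suc m = 1 + of_nat (Suc m) * h + of_nat (Suc m choose 2) * h\<^sup>2
      + h ^ 3 * (of_nat (m choose 2) + w + h * w)"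
    unfolding power_Suc w
    by (simp add: numeral_2_eq_2 algebra_simps power2_eq_square power3_eq_cube)
  moreover have "of_nat (m choose 2) + w + h * w \<in> Zs" by (intro Zs_closed w Suc.prems)
  ultimately show ?case by blast
qed

lemma powers_eventually_periodic:
  fixes m :: nat
  assumes "x \<in> Zs" "m > 0" shows "\<exists>i T. T > 0 \<and> (\<exists>w\<in>Zs. x ^ (i + T) = x ^ i + of_nat m * w)"
proof -
  obtain a b where ab: "\<And>k. x ^ k = of_int (a k) + of_int (b k) * rd"
    using Zs_power[OF assms(1)] unfolding Zs_def by simp metis
  define f where "f k = (a k mod int m, b k mod int m)" for k :: nat
  have "range f \<subseteq> {0..<int m} \<times> {0..<int m}" using assms(2) by (auto simp: f_def)
  then have "finite (range f)" by (rule finite_subset) auto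
  then have "\<not> inj f" using finite_imageD by auto
  then obtain i j where ij: "i < j" "f i = f j" unfolding inj_on_def by (metis linorder_neqE_nat)
  then have "int m dvd a j - a i" "int m dvd b j - b i" by (auto simp: f_def mod_eq_dvd_iff dvd_diff_commute)
  then obtain u v where uv: "a j - a i = int m * u" "b j - b i = int m * v" by (auto elim!: dvdE)
  have "x ^ j - x ^ i = of_int (a j - a i) + of_int (b j - b i) * rd"
    unfolding ab by (simp add: algebra_simps)
  also have "\<dots> = of_nat m * (of_int u + of_int v * rd)" unfolding uv by (simp add: algebra_simps)
  finally have "x ^ (i + (j - i)) = x ^ i + of_nat m * (of_int u + of_int v * rd)" using ij(1) by simp
  then show ?thesis using ij(1) Zs_coords by (metis zero_less_diff)
qed

lemma unit_power_cong_1_mod: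
  fixes m :: nat
  assumes "m > 0" shows "\<exists>T>0. \<exists>w\<in>Zs. \<epsilon> ^ T = 1 + of_nat m * w"
proof -
  obtain i T w where T: "T > 0" "w \<in> Zs" "\<epsilon> ^ (i + T) = \<epsilon> ^ i + of_nat m * w"
    using powers_eventually_periodic[OF \<epsilon>_unit(1) assms] by blast
  have 1: "cj \<epsilon> ^ i * \<epsilon> ^ i = 1" using \<epsilon>_unit(3) by (simp add: mult.commute flip: power_mult_distrib)
  have "\<epsilon> ^ T = cj \<epsilon> ^ i * \<epsilon> ^ (i + T)" using 1 by (simp add: power_add flip: mult.assoc)
  also have "\<dots> = 1 + of_nat m * (cj \<epsilon> ^ i * w)"
    unfolding T(3) distrib_left 1 by (simp only: mult.left_commute)
  finally have "\<epsilon> ^ T = 1 + of_nat m * (cj \<epsilon> ^ i * w)" .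
  moreover have "cj \<epsilon> ^ i * w \<in> Zs"
    by (intro Zs_closed(8) Zs_power Zs_closed(10) \<epsilon>_unit T)
  ultimately show ?thesis using T(1) by blast
qed

text \<open>
  The residues modulo \<open>\<pi> ^ l\<close> form the ring \<open>\<int> / N\<pi> ^ l\<close>, and the elements that are 1 modulo \<open>N\<pi>\<close>
  form a cyclic group in it, because \<open>N\<pi>\<close> is odd. Uniformly in \<open>l\<close>, the powers of such an
  element \<open>g\<close> reach every residue that is 1 modulo \<open>g - 1\<close>. The exponent is refined from one power of \<open>\<pi>\<close> to the next, as
  \<open>g ^ (N\<pi> ^ t)\<close> moves exactly the digit in question.
\<close>

lemma unit_reaches_residue:
  assumes w: "w \<in> Zs" and g: "g = 1 + of_nat N\<pi> * w" "\<mu> = g - 1" and a: "a \<in> Zs"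
  shows "\<exists>j. \<exists>b\<in>Zs. g ^ j = 1 + \<mu> * a - \<mu> * \<pi> ^ t * b"
proof -
  obtain m where m: "N\<pi> = 2 * m + 1" using odd_N\<pi> by (elim oddE)
  have \<mu>: "\<mu> = of_nat N\<pi> * w" "\<mu> \<in> Zs" using g w Zs_closed by auto
  have lift: "\<exists>c\<in>Zs. g ^ (N\<pi> ^ t) = 1 + \<mu> * of_nat N\<pi> ^ t * (1 + of_nat N\<pi> * c)" for t
  proof (induction t)
    case 0
    show ?case using g by (intro bexI[of _ 0]) (auto intro: Zs_closed)
  next
    case (Suc t)
    then obtain c' where c': "c' \<in> Zs" "g ^ (N\<pi> ^ t) = 1 + \<mu> * of_nat N\<pi> ^ t * (1 + of_nat N\<pi> * c')" by blast
    define c where "c = 1 + of_nat N\<pi> * c'"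
    define h' where "h' = w * of_nat N\<pi> ^ t * c"
    define h where "h = \<mu> * of_nat N\<pi> ^ t * c"
    have Zs: "c \<in> Zs" "h' \<in> Zs" "h \<in> Zs" unfolding c_def h_def h'_def
      by (intro Zs_closed c' w Zs_power \<mu>)+
    have h': "h = of_nat N\<pi> * h'" by (simp add: h_def h'_def \<mu>)
    obtain v where v: "v \<in> Zs" "(1 + h) ^ N\<pi> = 1 + of_nat N\<pi> * h + of_nat (N\<pi> choose 2) * h\<^sup>2 + h ^ 3 * v"
      using power_expansion3[OF Zs(3)] by blast
    \<comment> \<open>as \<open>N\<pi>\<close> is odd, it divides the binomial coefficient, and the quadratic term only changes \<open>c\<close>\<close>
    have "N\<pi> choose 2 = N\<pi> * m" unfolding choose_two by (simp add: m)
    moreover have "g ^ (N\<pi> ^ Suc t) = (1 + h) ^ N\<pi>"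
      by (simp only: power_Suc2 power_mult c'(2) c_def h_def)
    ultimately have "g ^ (N\<pi> ^ Suc t) = 1 + of_nat N\<pi> * h + of_nat (N\<pi> * m) * h\<^sup>2 + h ^ 3 * v"
      using v(2) by simp
    also have "\<dots> = 1 + of_nat N\<pi> * h * (1 + of_nat N\<pi> * (of_nat m * h' + h' * h' * v))"
      by (simp add: h' power2_eq_square power3_eq_cube algebra_simps)
    also have "\<dots> = 1 + \<mu> * of_nat N\<pi> ^ Suc t * (1 + of_nat N\<pi> *
        (c' + c * (of_nat m * h' + h' * h' * v)))"
      by (simp add: h_def c_def algebra_simps)
    finally show ?case
      by (intro bexI[of _ "c' + c * (of_nat m * h' + h' * h' * v)"] Zs_closed Zs v c')
  qed
  show ?thesis
  proof (induction t)
    case 0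
    show ?case using a by (intro exI[of _ 0] bexI[of _ a]) auto
  next
    case (Suc t)
    then obtain j b where b: "b \<in> Zs" "g ^ j = 1 + \<mu> * a - \<mu> * \<pi> ^ t * b" by blast
    \<comment> \<open>\<open>r\<close> is the next digit of the exponent; the factors \<open>g ^ j\<close> and \<open>1 + N\<pi> * c\<close> below are 1 modulo \<open>\<pi>\<close>\<close>
    obtain r q where r: "q \<in> Zs" "real r * cj \<pi> ^ t = b + \<pi> * q" using solve_mod_\<pi>[OF b(1)] by blast
    obtain c where c: "c \<in> Zs" "g ^ (N\<pi> ^ t) = 1 + \<mu> * of_nat N\<pi> ^ t * (1 + of_nat N\<pi> * c)"
      using lift by blast
    define h where "h = \<mu> * of_nat N\<pi> ^ t * (1 + of_nat N\<pi> * c)"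
    have hZ: "h \<in> Zs" unfolding h_def by (intro Zs_closed c Zs_power \<mu>)
    obtain v where v: "v \<in> Zs" "(1 + h) ^ r = 1 + of_nat r * h + h\<^sup>2 * v"
      using power_expansion2[OF hZ] by blast
    define f where "f = w * (a - \<pi> ^ t * b)"
    have fZ: "f \<in> Zs" unfolding f_def by (intro Zs_closed w a Zs_power \<pi>_Zs b)
    have gj: "g ^ j = 1 + of_nat N\<pi> * f" unfolding b(2) f_def \<mu>(1) by (simp add: algebra_simps)
    have nt: "of_nat N\<pi> ^ t = \<pi> ^ t * cj \<pi> ^ t" by (simp flip: power_mult_distrib norm_\<pi>)
    have n1: "of_nat N\<pi> = \<pi> * cj \<pi>" by (simp add: norm_\<pi>)
    define x where "x = c + f + of_nat N\<pi> * c * f"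
    have xZ: "x \<in> Zs" unfolding x_def by (intro Zs_closed c fZ)
    have "g ^ (j + N\<pi> ^ t * r) = g ^ j * (1 + h) ^ r"
      using c(2) by (simp add: power_add power_mult h_def)
    also have "\<dots> = g ^ j + of_nat r * (g ^ j * h) + g ^ j * h\<^sup>2 * v"
      unfolding v by (simp add: algebra_simps)
    also have "g ^ j * h = \<mu> * \<pi> ^ t * cj \<pi> ^ t + \<mu> * \<pi> ^ t * cj \<pi> ^ t * of_nat N\<pi> * x"
      unfolding gj h_def x_def nt by (simp add: algebra_simps)
    also have "of_nat r * (\<mu> * \<pi> ^ t * cj \<pi> ^ t + \<mu> * \<pi> ^ t * cj \<pi> ^ t * of_nat N\<pi> * x)
        = \<mu> * \<pi> ^ t * (b + \<pi> * q) + of_nat r * \<mu> * \<pi> ^ t * cj \<pi> ^ t * of_nat N\<pi> * x"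
      unfolding r(2)[symmetric] by (simp add: algebra_simps)
    also have "g ^ j * h\<^sup>2 * v = \<mu> * \<pi> ^ t * \<pi> * (g ^ j * cj \<pi> ^ t * cj \<pi> * w * of_nat N\<pi> ^ t * (1 + of_nat N\<pi> * c)\<^sup>2 * v)"
      unfolding h_def power2_eq_square by (subst (2) \<mu>(1), subst (2) n1, subst nt) (simp add: algebra_simps)
    finally have "g ^ (j + N\<pi> ^ t * r) = 1 + \<mu> * a - \<mu> * \<pi> ^ Suc t *
      (- q - of_nat r * cj \<pi> ^ t * cj \<pi> * x - g ^ j * cj \<pi> ^ t * cj \<pi> * w * of_nat N\<pi> ^ t * (1 + of_nat N\<pi> * c)\<^sup>2 * v)"
      unfolding b(2) n1 by (simp add: algebra_simps)
    moreover have "g \<in> Zs" unfolding g by (intro Zs_closed w)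
    then have "- q - of_nat r * cj \<pi> ^ t * cj \<pi> * x
        - g ^ j * cj \<pi> ^ t * cj \<pi> * w * of_nat N\<pi> ^ t * (1 + of_nat N\<pi> * c)\<^sup>2 * v \<in> Zs"
      by (intro Zs_closed Zs_power r w c v xZ \<pi>_Zs)
    ultimately show ?case by blast
  qed
qed

text \<open>
  The modulus \<open>\<mu> = \<epsilon> ^ T - 1\<close> of the preceding lemma is replaced by the positive integer \<open>\<bar>\<mu> * cj \<mu>\<bar>\<close>,
  a multiple of \<open>\<mu>\<close>.
\<close>

lemma units_open_mod_\<pi>_powers:
  "\<exists>M>0. \<forall>l. \<forall>y\<in>Zs. \<exists>j::nat. \<exists>q\<in>Zs. 1 + real M * y = \<epsilon> ^ j + \<pi> ^ l * q"
proof -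
  obtain T w where T: "T > 0" "w \<in> Zs" "\<epsilon> ^ T = 1 + of_nat N\<pi> * w"
    using unit_power_cong_1_mod[of N\<pi>] N\<pi>_gt_1 by auto
  define \<mu> where "\<mu> = \<epsilon> ^ T - 1"
  have \<mu>Z: "\<mu> \<in> Zs" unfolding \<mu>_def by (intro Zs_closed Zs_power \<epsilon>_unit)
  have \<mu>0: "\<mu> \<noteq> 0" using one_less_power[OF \<epsilon>_unit(2) T(1)] by (simp add: \<mu>_def)
  obtain m where m: "\<mu> * cj \<mu> = of_int m" using norm_Zs_int[OF \<mu>Z] by (elim Ints_cases)
  have m0: "m \<noteq> 0" using m \<mu>0 cj_eq_0_iff[OF Zrd_in_K[OF \<mu>Z]] by auto
  have "\<exists>j::nat. \<exists>q\<in>Zs. 1 + real (nat \<bar>m\<bar>) * y = \<epsilon> ^ j + \<pi> ^ l * q" if "y \<in> Zs" for l y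
  proof -
    define a where "a = of_int (sgn m) * cj \<mu> * y"
    have aZ: "a \<in> Zs" unfolding a_def by (intro Zs_closed \<mu>Z that)
    have "real (nat \<bar>m\<bar>) = of_int (sgn m) * of_int m" by (simp add: sgn_if abs_if)
    then have "1 + real (nat \<bar>m\<bar>) * y = 1 + \<mu> * a"
      unfolding m[symmetric] a_def by (simp add: algebra_simps)
    moreover obtain j b where "b \<in> Zs" "(\<epsilon> ^ T) ^ j = 1 + \<mu> * a - \<mu> * \<pi> ^ l * b"
      using unit_reaches_residue[OF T(2,3) \<mu>_def aZ] by blast
    ultimately have "1 + real (nat \<bar>m\<bar>) * y = \<epsilon> ^ (T * j) + \<pi> ^ l * (\<mu> * b)"
      by (simp add: power_mult algebra_simps)
    then show ?thesis using \<mu>Z \<open>b \<in> Zs\<close> Zs_closed(8) by blast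
  qed
  then show ?thesis using m0 by (intro exI[of _ "nat \<bar>m\<bar>"]) auto
qed

end

section \<open>Dense orbits in the plane modulo the lattice\<close>

text \<open>
  After taking logarithms this is Kronecker's theorem for the irrational number \<open>ln b / ln a\<close>.
\<close>

lemma multiplicatively_independent_dense:
  fixes a b :: real
  assumes "a > 1" "b > 1" and indep: "\<And>i j::nat. j > 0 \<Longrightarrow> a ^ i \<noteq> b ^ j"
    and "x > 0" "\<eta> > 0"
  shows "\<exists>(k::int) (l::nat). \<bar>a powi k * b ^ l - x\<bar> < \<eta>"
proof -
  define \<theta> where "\<theta> = ln b / ln a"
  have pos: "ln a > 0" "ln b > 0" using assms by auto
  have "\<theta> \<notin> \<rat>"
  proof
    assume "\<theta> \<in> \<rat>"
    moreover have "\<theta> > 0" using pos by (simp add: \<theta>_def)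
    ultimately obtain i j :: nat where ij: "j \<noteq> 0" "\<bar>\<theta>\<bar> = real i / real j"
      using Rats_abs_nat_div_natE by metis
    then have "real i * ln a = real j * ln b" using \<open>\<theta> > 0\<close> pos by (simp add: \<theta>_def field_simps)
    then have "ln (a ^ i) = ln (b ^ j)" using assms(1,2) by (simp add: ln_realpow)
    then have "a ^ i = b ^ j" using assms(1,2) by simp
    then show False using indep ij(1) by auto
  qed
  define f where "f z = exp (ln a * z)" for z
  define \<alpha> where "\<alpha> = ln x / ln a"
  have fa: "f \<alpha> = x" using pos assms(4) by (simp add: f_def \<alpha>_def)
  have "isCont f \<alpha>" unfolding f_def by (intro continuous_intros)
  then obtain \<delta> where \<delta>: "\<delta> > 0" "\<And>z. \<bar>z - \<alpha>\<bar> < \<delta> \<Longrightarrow> \<bar>f z - f \<alpha>\<bar> < \<eta>"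
    using assms(5) unfolding isCont_def LIM_def dist_real_def by (metis abs_0 cancel_comm_monoid_add_class.diff_cancel)
  obtain h k where hk: "k > 0" "\<bar>of_int k * \<theta> - of_int h - \<alpha>\<bar> < \<delta>"
    using sequence_of_fractional_parts_is_dense[OF \<open>\<theta> \<notin> \<rat>\<close> \<delta>(1)] .
  have "ln a * (of_int k * \<theta> - of_int h) = of_int (- h) * ln a + of_int k * ln b"
    using pos by (simp add: \<theta>_def field_simps)
  moreover have "of_int k = real (nat k)" using hk(1) by simp
  ultimately have "f (of_int k * \<theta> - of_int h) = exp (of_int (- h) * ln a) * exp (real (nat k) * ln b)"
    unfolding f_def by (simp only: exp_add)
  also have "exp (real (nat k) * ln b) = b ^ nat k"
    using assms(2) exp_of_nat_mult[of "nat k" "ln b"] by simp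
  also have "exp (of_int (- h) * ln a) = a powi (- h)"
    using assms(1) exp_power_int[of "ln a" "- h"] by (simp add: mult.commute)
  finally show ?thesis using \<delta>(2)[OF hk(2)] unfolding fa by metis
qed

definition act :: "real \<Rightarrow> real \<Rightarrow> real \<times> real \<Rightarrow> real \<times> real" where
  "act a b v = (a * fst v, b * snd v)"

lemma act_diff: "act a b (v - w) = act a b v - act a b w"
  by (simp add: act_def algebra_simps)

lemma continuous_act: "continuous_on A (act a b)"
  unfolding act_def by (intro continuous_intros)

lemma norm_prod_le: "norm (v :: real \<times> real) \<le> \<bar>fst v\<bar> + \<bar>snd v\<bar>"
  using norm_Pair_le[of "fst v" "snd v"] by simp

lemma abs_le_norm_prod: "\<bar>fst v\<bar> \<le> norm (v :: real \<times> real)" "\<bar>snd v\<bar> \<le> norm (v :: real \<times> real)"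
  using norm_fst_le[of "fst v" "snd v"] norm_snd_le[of "snd v" "fst v"] by simp_all

context quadratic
begin

text \<open>
  The pair of real embeddings; it maps \<open>Zs\<close> to a lattice in the plane and multiplication by \<open>c\<close> to
  \<open>act c (cj c)\<close>.
\<close>

definition emb :: "real \<Rightarrow> real \<times> real" where
  "emb x = (x, cj x)"

lemma emb_simps: "x \<in> K \<Longrightarrow> y \<in> K \<Longrightarrow> emb (x + y) = emb x + emb y"
  "x \<in> K \<Longrightarrow> y \<in> K \<Longrightarrow> emb (x - y) = emb x - emb y"
  "x \<in> K \<Longrightarrow> y \<in> K \<Longrightarrow> emb (x * y) = act x (cj x) (emb y)"
  "fst (emb x) = x" "snd (emb x) = cj x" "emb 0 = 0"
  by (auto simp: emb_def cj_simps act_def zero_prod_def)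

definition periodic :: "(real \<times> real) set \<Rightarrow> bool" where
  "periodic D \<longleftrightarrow> (\<forall>v\<in>D. \<forall>y\<in>Zs. v + emb y \<in> D)"

text \<open>
  The first map is applied in both directions, as units have inverses in the lattice. The
  second map stands for multiplication by a power of \<open>\<pi>\<close> and is applied forwards only.
\<close>

definition invariant :: "real \<Rightarrow> real \<Rightarrow> real \<Rightarrow> (real \<times> real) set \<Rightarrow> bool" where
  "invariant a b b' D \<longleftrightarrow> closed D \<and> periodic D \<and>
     (\<forall>v\<in>D. act a (inverse a) v \<in> D \<and> act (inverse a) a v \<in> D \<and> act b b' v \<in> D)"

lemma invariantD:
  assumes "invariant a b b' D"
  shows "closed D" "\<And>v y. v \<in> D \<Longrightarrow> y \<in> Zs \<Longrightarrow> v + emb y \<in> D" "\<And>v. v \<in> D \<Longrightarrow> act a (inverse a) v \<in> D"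
    "\<And>v. v \<in> D \<Longrightarrow> act (inverse a) a v \<in> D" "\<And>v. v \<in> D \<Longrightarrow> act b b' v \<in> D"
  using assms unfolding invariant_def periodic_def by auto

lemma invariant_powi:
  assumes "invariant a b b' D" "v \<in> D" "a \<noteq> 0"
  shows "act (a powi k) (a powi (- k)) v \<in> D" "act (b ^ l) (b' ^ l) v \<in> D"
proof -
  have 1: "act (a ^ k) (inverse a ^ k) v \<in> D" "act (inverse a ^ k) (a ^ k) v \<in> D" "act (b ^ k) (b' ^ k) v \<in> D" for k
  proof (induction k)
    case 0
    show "act (a ^ 0) (inverse a ^ 0) v \<in> D" "act (inverse a ^ 0) (a ^ 0) v \<in> D" "act (b ^ 0) (b' ^ 0) v \<in> D"
      using assms(2) by (simp_all add: act_def)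
  next
    case (Suc k)
    have "act x y (act (x ^ k) (y ^ k) v) = act (x ^ Suc k) (y ^ Suc k) v" for x y
      by (simp add: act_def)
    then show "act (a ^ Suc k) (inverse a ^ Suc k) v \<in> D" "act (inverse a ^ Suc k) (a ^ Suc k) v \<in> D"
      "act (b ^ Suc k) (b' ^ Suc k) v \<in> D"
      using invariantD(3-5)[OF assms(1)] Suc by metis+
  qed
  then show "act (b ^ l) (b' ^ l) v \<in> D" by blast
  show "act (a powi k) (a powi (- k)) v \<in> D"
    using 1(1)[of "nat k"] 1(2)[of "nat (- k)"] by (auto simp: power_int_def)
qed

definition cell :: "(real \<times> real) set" where
  "cell = {- (1 + rd)..1 + rd} \<times> {- (1 + rd)..1 + rd}"

lemma compact_cell: "compact cell"
  unfolding cell_def by (intro compact_Times compact_Icc)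

lemma bounded_representative: "\<exists>y\<in>Zs. v + emb y \<in> cell"
proof -
  define a b where "a = (fst v + snd v) / 2" and "b = (fst v - snd v) / (2 * rd)"
  have v: "fst v = a + b * rd" "snd v = a - b * rd" using rd_gt_1 by (simp_all add: a_def b_def field_simps)
  define y where "y = of_int (- \<lfloor>a\<rfloor>) + of_int (- \<lfloor>b\<rfloor>) * rd"
  have "v + emb y = (frac a + frac b * rd, frac a - frac b * rd)"
    unfolding y_def emb_def cj_Zs_coords by (simp add: prod_eq_iff v frac_def algebra_simps)
  moreover have "0 \<le> frac a" "frac a \<le> 1" "0 \<le> frac b * rd" "frac b * rd \<le> rd"
    using frac_lt_1[of a] frac_lt_1[of b] rd_gt_1
    by (auto intro: less_imp_le mult_left_le_one_le)
  then have "- (1 + rd) \<le> frac a + frac b * rd" "frac a + frac b * rd \<le> 1 + rd"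
    "- (1 + rd) \<le> frac a - frac b * rd" "frac a - frac b * rd \<le> 1 + rd" by linarith+
  ultimately have "v + emb y \<in> {- (1 + rd)..1 + rd} \<times> {- (1 + rd)..1 + rd}" by simp
  moreover have "y \<in> Zs" unfolding y_def by (rule Zs_coords)
  ultimately show ?thesis unfolding cell_def by (intro bexI[of _ y])
qed

text \<open>
  Lattice points with prescribed second coordinate, up to \<open>\<eta>\<close>, and arbitrarily small or large first
  coordinate. They show that each half of the first axis is dense modulo the lattice.
\<close>

lemma conjugates_dense:
  assumes "\<eta> > 0" shows "\<exists>y\<in>Zs. \<bar>cj y - x\<bar> < \<eta> \<and> y < B" "\<exists>y\<in>Zs. \<bar>cj y - x\<bar> < \<eta> \<and> y > B"
proof -
  have 1: "\<exists>y\<in>Zs. \<bar>cj y - x\<bar> < \<eta> \<and> y < B" for x B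
  proof -
    obtain k where k: "\<epsilon> ^ k > 2 / \<eta>" using real_arch_pow[OF \<epsilon>_unit(2)] by blast
    define m where "m = \<lfloor>x * \<epsilon> ^ k\<rfloor>"
    obtain k' where k': "\<epsilon> ^ k' > max (2 / \<eta>) (of_int m * \<epsilon> ^ k - B)"
      using real_arch_pow[OF \<epsilon>_unit(2)] by blast
    \<comment> \<open>the last term makes \<open>y\<close> very negative and barely changes its conjugate\<close>
    define y where "y = of_int m * \<epsilon> ^ k - \<epsilon> ^ k'"
    have yZ: "y \<in> Zs" unfolding y_def by (intro Zs_closed Zs_power \<epsilon>_unit)
    have eK: "\<epsilon> \<in> K" using \<epsilon>_unit Zrd_in_K by blast
    have "cj y = of_int m * inverse (\<epsilon> ^ k) - inverse (\<epsilon> ^ k')"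
      unfolding y_def using eK by (simp add: cj_simps cj_\<epsilon> power_inverse)
    moreover have "\<bar>of_int m * inverse (\<epsilon> ^ k) - x\<bar> \<le> inverse (\<epsilon> ^ k)"
    proof -
      have "of_int m * inverse (\<epsilon> ^ k) - x = (of_int m - x * \<epsilon> ^ k) * inverse (\<epsilon> ^ k)"
        using \<epsilon>_unit(2) by (simp add: left_diff_distrib)
      moreover have "\<bar>of_int m - x * \<epsilon> ^ k\<bar> \<le> 1" unfolding m_def by linarith
      ultimately show ?thesis using \<epsilon>_unit(2) by (simp add: abs_mult mult_left_le_one_le)
    qed
    moreover have "inverse (\<epsilon> ^ j) < \<eta> / 2 \<and> inverse (\<epsilon> ^ j) > 0" if "\<epsilon> ^ j > 2 / \<eta>" for j
      using that assms \<epsilon>_unit(2) by (simp add: field_simps)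
    from this[OF k] this[of k'] k' have "inverse (\<epsilon> ^ k) < \<eta> / 2" "inverse (\<epsilon> ^ k') < \<eta> / 2" "inverse (\<epsilon> ^ k') > 0" by auto
    ultimately have "\<bar>cj y - x\<bar> < \<eta>" by linarith
    moreover have "y < B" using k' by (simp add: y_def)
    ultimately show ?thesis using yZ by blast
  qed
  from 1 show "\<exists>y\<in>Zs. \<bar>cj y - x\<bar> < \<eta> \<and> y < B" .
  obtain y where y: "y \<in> Zs" "\<bar>cj y - (- x)\<bar> < \<eta>" "y < - B" using 1 by blast
  then show "\<exists>y\<in>Zs. \<bar>cj y - x\<bar> < \<eta> \<and> y > B"
    using cj_minus[OF Zrd_in_K, of y] Zs_closed(9)[OF y(1)] by (intro bexI[of _ "- y"]) auto
qed

text \<open>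
  Iterating the hyperbolic map moves a point near the origin along the hyperbola through it to a point
  at bounded distance next to the first axis. In the limit this gives a nonzero point on the axis, which
  the two maps together spread densely over a half line, and this half line is dense modulo the lattice.
\<close>

lemma invariant_first_axis:
  assumes D: "invariant a b b' D" and a: "a > 1" and b: "b > 1"
    and indep: "\<And>i j::nat. j > 0 \<Longrightarrow> a ^ i \<noteq> b ^ j"
    and acc: "\<And>\<eta>. \<eta> > 0 \<Longrightarrow> \<exists>v\<in>D. fst v \<noteq> 0 \<and> norm v < \<eta>"
  shows "D = UNIV"
proof -
  define C where "C = ({1..a} \<union> {-a..-1}) \<times> {0::real}"
  have "compact C" unfolding C_def by (intro compact_Times compact_Un compact_Icc) auto
  have "C \<inter> D \<noteq> {}"
  proof
    assume "C \<inter> D = {}"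
    then obtain \<eta> where \<eta>: "\<eta> > 0" "\<And>x y. x \<in> C \<Longrightarrow> y \<in> D \<Longrightarrow> \<eta> \<le> dist x y"
      using separate_compact_closed[OF \<open>compact C\<close> invariantD(1)[OF D]] by metis
    obtain v where v: "v \<in> D" "fst v \<noteq> 0" "norm v < min \<eta> 1" using acc[of "min \<eta> 1"] \<eta>(1) by auto
    define k where "k = (LEAST k. a ^ k * \<bar>fst v\<bar> \<ge> 1)"
    have "\<exists>k. a ^ k * \<bar>fst v\<bar> \<ge> 1"
      using real_arch_pow[OF a, of "1 / \<bar>fst v\<bar>"] v(2) by (auto simp: field_simps intro: less_imp_le)
    then have k1: "a ^ k * \<bar>fst v\<bar> \<ge> 1" unfolding k_def by (rule LeastI_ex)
    have "\<bar>fst v\<bar> < 1" "\<bar>snd v\<bar> < \<eta>" using v(3) abs_le_norm_prod[of v] by auto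
    then obtain k' where k': "k = Suc k'" using k1 by (cases k) auto
    then have "\<not> a ^ k' * \<bar>fst v\<bar> \<ge> 1" using not_less_Least[of k' "\<lambda>k. a ^ k * \<bar>fst v\<bar> \<ge> 1"] k_def by auto
    then have k2: "a ^ k * \<bar>fst v\<bar> \<le> a" using a by (simp add: k' mult.assoc)
    define w where "w = act (a powi int k) (a powi - int k) v"
    have "w \<in> D" unfolding w_def by (rule invariant_powi(1)[OF D v(1)]) (use a in auto)
    moreover have "(fst w, 0) \<in> C" using k1 k2 a unfolding w_def C_def
      by (auto simp: act_def abs_if split: if_splits)
    ultimately have "\<eta> \<le> dist (fst w, 0) w" using \<eta>(2) by blast
    also have "\<dots> = \<bar>snd w\<bar>" by (simp add: dist_prod_def dist_real_def)
    also have "\<dots> = \<bar>snd v\<bar> / a ^ k" using a by (simp add: w_def act_def power_int_minus divide_inverse abs_mult power_abs)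
    also have "\<dots> \<le> \<bar>snd v\<bar>" using a by (simp add: divide_le_eq mult_le_cancel_left1 one_le_power)
    also have "\<dots> < \<eta>" by fact
    finally show False by simp
  qed
  then obtain t where "(t, 0) \<in> D" "t \<in> {1..a} \<union> {-a..-1}" unfolding C_def by blast
  then have t: "(t, 0) \<in> D" "t \<noteq> 0" by auto
  have ray: "(x * sgn t, 0) \<in> D" if "x > 0" for x
  proof -
    have "\<exists>y\<in>D. dist y (x * sgn t, 0) < \<eta>" if \<eta>: "\<eta> > 0" for \<eta>
    proof -
      obtain k l where kl: "\<bar>a powi k * b ^ l - x / \<bar>t\<bar>\<bar> < \<eta> / \<bar>t\<bar>"
        using multiplicatively_independent_dense[OF a b indep, of "x / \<bar>t\<bar>" "\<eta> / \<bar>t\<bar>"] \<open>x > 0\<close> t(2) \<eta> by auto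
      have "act (a powi k) (a powi - k) (act (b ^ l) (b' ^ l) (t, 0)) \<in> D"
        by (intro invariant_powi[OF D] t(1)) (use a in auto)
      then have "(a powi k * b ^ l * t, 0) \<in> D" by (simp add: act_def mult.assoc)
      moreover have "dist (a powi k * b ^ l * t, 0) (x * sgn t, 0::real) < \<eta>"
      proof -
        have "a powi k * b ^ l * t - x * sgn t = (a powi k * b ^ l - x / \<bar>t\<bar>) * t"
          using t(2) by (simp add: left_diff_distrib sgn_if)
        then have "\<bar>a powi k * b ^ l * t - x * sgn t\<bar> = \<bar>a powi k * b ^ l - x / \<bar>t\<bar>\<bar> * \<bar>t\<bar>"
          by (simp only: abs_mult)
        also have "\<dots> < \<eta>" using kl t(2) by (simp add: pos_less_divide_eq)
        finally show ?thesis by (simp add: dist_prod_def dist_real_def)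
      qed
      ultimately show ?thesis by blast
    qed
    then show ?thesis using closed_approachable[OF invariantD(1)[OF D]] by blast
  qed
  have "v \<in> D" for v
  proof -
    have "\<exists>y\<in>D. dist y v < \<eta>" if \<eta>: "\<eta> > 0" for \<eta>
    proof -
      obtain y where y: "y \<in> Zs" "\<bar>cj y - snd v\<bar> < \<eta>" "(fst v - y) * sgn t > 0"
        using conjugates_dense[OF \<eta>, of "snd v" "fst v"] t(2)
        by (cases "t > 0") (auto simp: sgn_if)
      have "((fst v - y) * sgn t * sgn t, 0) \<in> D" using ray[OF y(3)] by simp
      then have "(fst v - y, 0) \<in> D" using t(2) by (simp add: sgn_if split: if_splits)
      then have "(fst v - y, 0) + emb y \<in> D" using invariantD(2)[OF D] y(1) by blast
      then have "(fst v, cj y) \<in> D" by (simp add: emb_def)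
      moreover have "dist (fst v, cj y) v < \<eta>"
        using y(2) by (simp add: dist_prod_def dist_real_def)
      ultimately show ?thesis by blast
    qed
    then show ?thesis using closed_approachable[OF invariantD(1)[OF D]] by blast
  qed
  then show ?thesis by blast
qed

text \<open>
  Exchanging the coordinates replaces \<open>\<epsilon>\<close> and \<open>\<pi>\<close> by their conjugates; this reduces the second
  axis to the first.
\<close>

lemma invariant_swap:
  assumes "invariant a b b' D"
  shows "invariant a b' b {v. prod.swap v \<in> D}"
proof -
  have sw: "prod.swap (act x y v) = act y x (prod.swap v)" for x y v by (simp add: act_def prod_eq_iff)
  have "prod.swap (v + emb y) = prod.swap v + emb (cj y)" if "y \<in> Zs" for v y
    using cj_cj[OF Zrd_in_K[OF that]] by (simp add: emb_def prod_eq_iff)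
  moreover have "closed {v. prod.swap v \<in> D}"
    using closed_vimage[OF invariantD(1)[OF assms], of prod.swap] continuous_on_swap[of UNIV]
    by (simp add: vimage_def)
  ultimately show ?thesis
    using invariantD(2-5)[OF assms] Zs_closed(10)
    unfolding invariant_def periodic_def by (simp add: sw)
qed

text \<open>
  The norm of \<open>\<epsilon> ^ i\<close> is \<open>1\<close>, and that of \<open>\<pi> ^ j\<close> is \<open>N\<pi> ^ j\<close>.
\<close>

lemma \<epsilon>_\<pi>_independent:
  fixes i j :: nat
  assumes "j > 0" shows "\<epsilon> ^ i \<noteq> \<pi> ^ j" "\<epsilon> ^ i \<noteq> cj \<pi> ^ j"
proof -
  have N\<pi>: "real N\<pi> ^ j \<noteq> 1" using one_less_power[of "real N\<pi>" j] N\<pi>_gt_1 assms by fastforce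
  have \<epsilon>: "\<epsilon> ^ i * cj (\<epsilon> ^ i) = 1"
    using \<epsilon>_unit(3) by (simp add: cj_power Zrd_in_K \<epsilon>_unit flip: power_mult_distrib)
  have \<pi>: "\<pi> ^ j * cj (\<pi> ^ j) = real N\<pi> ^ j" "cj \<pi> ^ j * cj (cj \<pi> ^ j) = real N\<pi> ^ j"
    using norm_\<pi> by (simp_all add: cj_power cj_cj Zrd_in_K \<pi>_Zs mult.commute flip: power_mult_distrib)
  show "\<epsilon> ^ i \<noteq> \<pi> ^ j" "\<epsilon> ^ i \<noteq> cj \<pi> ^ j" using \<epsilon> \<pi> N\<pi> by auto
qed

abbreviation inv_\<epsilon>_\<pi> :: "nat \<Rightarrow> (real \<times> real) set \<Rightarrow> bool" where
  "inv_\<epsilon>_\<pi> T D \<equiv> invariant (\<epsilon> ^ T) (\<pi> ^ T) (cj \<pi> ^ T) D"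

lemma invariant_accumulating_at_0:
  assumes D: "inv_\<epsilon>_\<pi> T D" and T: "T > 0"
    and acc: "\<And>\<eta>. \<eta> > 0 \<Longrightarrow> \<exists>v\<in>D. v \<noteq> 0 \<and> norm v < \<eta>"
  shows "D = UNIV"
proof -
  have gt: "\<epsilon> ^ T > 1" "\<pi> ^ T > 1" "cj \<pi> ^ T > 1"
    using \<epsilon>_unit \<pi>_gt_1 cj_\<pi>_gt_1 T by (auto intro: one_less_power)
  have ind: "(\<epsilon> ^ T) ^ i \<noteq> (\<pi> ^ T) ^ j" "(\<epsilon> ^ T) ^ i \<noteq> (cj \<pi> ^ T) ^ j" if "j > 0" for i j
    using \<epsilon>_\<pi>_independent[of "T * j" "T * i"] that T by (simp_all add: power_mult)
  show ?thesis
  proof (cases "\<forall>\<eta>>0. \<exists>v\<in>D. fst v \<noteq> 0 \<and> norm v < \<eta>")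
    case True
    then show ?thesis using invariant_first_axis[OF D gt(1,2) ind(1)] by blast
  next
    case False
    then obtain \<eta>0 where \<eta>0: "\<eta>0 > 0" "\<And>v. v \<in> D \<Longrightarrow> norm v < \<eta>0 \<Longrightarrow> fst v = 0" by blast
    let ?D = "{v. prod.swap v \<in> D}"
    have "\<exists>v\<in>?D. fst v \<noteq> 0 \<and> norm v < \<eta>" if \<eta>: "\<eta> > 0" for \<eta>
    proof -
      obtain v where v: "v \<in> D" "v \<noteq> 0" "norm v < min \<eta> \<eta>0" 
        using acc[of "min \<eta> \<eta>0"] \<eta> \<eta>0(1) by (metis min_less_iff_conj)
      then have "fst v = 0" using \<eta>0(2)[of v] by simp
      then show ?thesis using v by (intro bexI[of _ "prod.swap v"])
        (auto simp: prod_eq_iff norm_prod_def add.commute)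
    qed
    then have "?D = UNIV" using invariant_first_axis[OF invariant_swap[OF D] gt(1,3) ind(2)] by blast
    then show ?thesis by (metis (no_types, lifting) UNIV_I UNIV_eq_I mem_Collect_eq swap_swap)
  qed
qed

text \<open>
  If two points of an orbit under \<open>\<epsilon> ^ T\<close> agree modulo the lattice, solving for the initial point shows
  that it belongs to \<open>K\<close>.
\<close>

lemma infinite_orbit:
  assumes D: "inv_\<epsilon>_\<pi> T D" and T: "T > 0" and ne: "D \<noteq> {}" and irr: "D \<inter> emb ` K = {}"
  shows "infinite (D \<inter> cell)"
proof
  assume fin: "finite (D \<inter> cell)"
  define a where "a = \<epsilon> ^ T"
  have a: "a > 1" "a \<in> Zs" "cj a = inverse a"
    using \<epsilon>_unit T by (auto simp: a_def Zs_power cj_power Zrd_in_K cj_\<epsilon> power_inverse intro: one_less_power)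
  obtain v where v: "v \<in> D" using ne by blast
  define w where "w k = act (a ^ k) (inverse a ^ k) v" for k :: nat
  have wD: "w k \<in> D" for k
    using invariant_powi(1)[OF D v, of "int k"] a(1) unfolding w_def a_def[symmetric]
    by (simp add: power_int_minus power_inverse)
  have "\<forall>k. \<exists>y. y \<in> Zs \<and> w k + emb y \<in> cell" using bounded_representative by blast
  then obtain y where y: "\<And>k. y k \<in> Zs" "\<And>k. w k + emb (y k) \<in> cell" by metis
  define r where "r k = w k + emb (y k)" for k
  have "range r \<subseteq> D \<inter> cell" unfolding r_def using y invariantD(2)[OF D] wD by blast
  then have "\<not> inj r" using fin finite_subset finite_imageD by blast
  then obtain i j where ij: "i < j" "r i = r j" unfolding inj_on_def by (metis linorder_neqE_nat)
  define z where "z = y j - y i"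
  define c where "c = a ^ i - a ^ j"
  have zK: "z \<in> K" and cK: "c \<in> K" unfolding z_def c_def using y(1) Zrd_in_K a(2) by auto
  have c0: "c \<noteq> 0" unfolding c_def using a(1) ij(1) power_strict_increasing[of i j a] by simp
  have cc: "cj c = inverse a ^ i - inverse a ^ j"
    unfolding c_def using a Zrd_in_K by (simp add: cj_simps)
  have "c * fst v = z" "cj c * snd v = cj z"
    using ij(2) y(1) Zrd_in_K unfolding cc unfolding r_def w_def c_def z_def emb_def
    by (auto simp: act_def cj_simps algebra_simps)
  then have "v = emb (z / c)"
    using c0 cj_eq_0_iff[OF cK] by (auto simp: emb_def prod_eq_iff cj_divide zK cK field_simps)
  then show False using irr v zK cK by blast
qed

text \<open>
  The differences of points of \<open>D\<close> form a closed invariant set, and they accumulate at \<open>0\<close>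
  because \<open>D\<close> has infinitely many points in a compact cell. Hence every \<open>\<tau>\<close> is a difference.
\<close>

lemma invariant_differences:
  assumes D: "inv_\<epsilon>_\<pi> T D" and T: "T > 0" and ne: "D \<noteq> {}" and irr: "D \<inter> emb ` K = {}"
  shows "\<exists>v\<in>D. v + \<tau> \<in> D"
proof -
  define DD where "DD = (\<Union>x\<in>D. \<Union>y\<in>D. {x - y})"
  have DDI: "x - y \<in> DD" if "x \<in> D" "y \<in> D" for x y using that by (auto simp: DD_def)
  have "DD = (\<Union>x\<in>D. \<Union>y\<in>D \<inter> cell. {x - y})"
  proof
    show "DD \<subseteq> (\<Union>x\<in>D. \<Union>y\<in>D \<inter> cell. {x - y})"
    proof
      fix w assume "w \<in> DD"
      then obtain x y where xy: "x \<in> D" "y \<in> D" "w = x - y" by (auto simp: DD_def)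
      obtain z where z: "z \<in> Zs" "y + emb z \<in> cell" using bounded_representative[of y] by (elim bexE)
      have "w = (x + emb z) - (y + emb z)"
        unfolding xy(3) by (rule add_diff_cancel_right[symmetric])
      moreover have "x + emb z \<in> D" "y + emb z \<in> D \<inter> cell" using z xy invariantD(2)[OF D] by auto
      ultimately show "w \<in> (\<Union>x\<in>D. \<Union>y\<in>D \<inter> cell. {x - y})" by blast
    qed
  qed (auto simp: DD_def)
  moreover have "compact (D \<inter> cell)"
    by (intro closed_Int_compact invariantD(1)[OF D] compact_cell)
  ultimately have "closed DD"
    using closed_compact_differences[OF invariantD(1)[OF D], of "D \<inter> cell"] by simp
  moreover have "w + emb z \<in> DD" if w: "w \<in> DD" "z \<in> Zs" for w z
  proof -
    obtain x y where xy: "x \<in> D" "y \<in> D" "w = x - y" using w unfolding DD_def by blast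
    have "w + emb z = (x + emb z) - y" by (simp add: xy)
    then show ?thesis using DDI invariantD(2)[OF D] xy w by metis
  qed
  moreover have "act a b w \<in> DD" if w: "w \<in> DD" and act: "\<And>v. v \<in> D \<Longrightarrow> act a b v \<in> D" for a b w
  proof -
    obtain x y where xy: "x \<in> D" "y \<in> D" "w = x - y" using w unfolding DD_def by blast
    then show ?thesis using DDI[OF act act] by (simp add: act_diff)
  qed
  ultimately have inv: "inv_\<epsilon>_\<pi> T DD"
    unfolding invariant_def periodic_def using invariantD(3-5)[OF D] by blast
  have "\<exists>v\<in>DD. v \<noteq> 0 \<and> norm v < \<eta>" if \<eta>: "\<eta> > 0" for \<eta>
  proof -
    obtain x where x: "x islimpt (D \<inter> cell)"
      using infinite_orbit[OF assms] compact_cell unfolding compact_eq_Bolzano_Weierstrass by (meson inf_le2)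
    obtain v where v: "v \<in> D" "v \<noteq> x" "dist v x < \<eta> / 2"
      using x \<eta> unfolding islimpt_approachable by (meson IntD1 half_gt_zero)
    then obtain w where w: "w \<in> D" "w \<noteq> x" "dist w x < dist v x"
      using x unfolding islimpt_approachable by (meson IntD1 zero_less_dist_iff)
    have "v - w \<noteq> 0" using w by auto
    moreover have "norm (v - w) < \<eta>"
      using dist_triangle2[of v w x] v w by (simp add: dist_norm)
    ultimately show ?thesis using DDI v(1) w(1) by blast
  qed
  then have "DD = UNIV" by (rule invariant_accumulating_at_0[OF inv T])
  then obtain x y where "x \<in> D" "y \<in> D" "\<tau> = x - y" unfolding DD_def by blast
  then show ?thesis by (intro bexI[of _ y]) auto
qed

text \<open>
  The assumptions on \<open>x\<close> say that both maps fix \<open>emb x\<close> modulo the lattice.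
\<close>

lemma invariant_translate:
  assumes D: "inv_\<epsilon>_\<pi> T D" and x: "x \<in> K" "(\<epsilon> ^ T - 1) * x \<in> Zs" "(\<pi> ^ T - 1) * x \<in> Zs"
  shows "inv_\<epsilon>_\<pi> T {v. v + emb x \<in> D}"
proof -
  have eK: "\<epsilon> ^ T \<in> K" "\<pi> ^ T \<in> K" using \<epsilon>_unit \<pi>_Zs Zrd_in_K by auto
  have tr: "act c (cj c) v + emb x \<in> D"
    if "v + emb x \<in> D" "\<And>v. v \<in> D \<Longrightarrow> act c (cj c) v \<in> D" "c \<in> K" "(c - 1) * x \<in> Zs" for c v
  proof -
    have "act c (cj c) v + emb x = act c (cj c) (v + emb x) + emb (- ((c - 1) * x))"
      using that(3) x(1) by (simp add: emb_def act_def prod_eq_iff cj_simps algebra_simps)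
    then show ?thesis using that invariantD(2)[OF D] Zs_closed(9) by metis
  qed
  have cje: "cj (\<epsilon> ^ T) = inverse (\<epsilon> ^ T)" "cj (inverse (\<epsilon> ^ T)) = \<epsilon> ^ T" "cj (\<pi> ^ T) = cj \<pi> ^ T"
    using eK \<epsilon>_unit \<pi>_Zs Zrd_in_K cj_cj[of "\<epsilon> ^ T"] by (auto simp: cj_power cj_\<epsilon> power_inverse)
  have "inverse (\<epsilon> ^ T) * ((\<epsilon> ^ T - 1) * x) \<in> Zs"
    using x(2) cje(1) Zs_closed(8,10) Zs_power \<epsilon>_unit(1) by metis
  then have "- ((inverse (\<epsilon> ^ T) - 1) * x) \<in> Zs" using \<epsilon>_unit(2) by (simp add: algebra_simps)
  then have ei: "(inverse (\<epsilon> ^ T) - 1) * x \<in> Zs" using Zs_closed(9) by fastforce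
  have "inverse (\<epsilon> ^ T) \<in> K" using eK K_closed(6)[OF K_closed(2), of "\<epsilon> ^ T"] by (simp add: divide_inverse)
  note tr' = tr[of _ "\<epsilon> ^ T", unfolded cje] tr[of _ "inverse (\<epsilon> ^ T)", unfolded cje] tr[of _ "\<pi> ^ T", unfolded cje]
  have "closed ((\<lambda>v. v + emb x) -` D)"
    by (intro closed_vimage invariantD(1)[OF D] continuous_intros)
  moreover have "v + emb y + emb x \<in> D" if "v + emb x \<in> D" "y \<in> Zs" for v y
    using invariantD(2)[OF D that] by (simp add: algebra_simps)
  ultimately show ?thesis
    unfolding invariant_def periodic_def vimage_def
    using tr' x ei invariantD(3-5)[OF D] eK \<open>inverse (\<epsilon> ^ T) \<in> K\<close> by auto
qed

lemma invariant_Int: "invariant a b b' D \<Longrightarrow> invariant a b b' E \<Longrightarrow> invariant a b b' (D \<inter> E)"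
  unfolding invariant_def periodic_def by auto

lemma invariant_power:
  assumes "inv_\<epsilon>_\<pi> T D" shows "inv_\<epsilon>_\<pi> (T * m) D"
  unfolding invariant_def
proof (intro conjI ballI)
  have \<epsilon>: "\<epsilon> ^ T \<noteq> 0" using \<epsilon>_unit by simp
  fix v assume v: "v \<in> D"
  note 1 = invariant_powi[OF assms v \<epsilon>]
  show "act (\<epsilon> ^ (T * m)) (inverse (\<epsilon> ^ (T * m))) v \<in> D" "act (inverse (\<epsilon> ^ (T * m))) (\<epsilon> ^ (T * m)) v \<in> D"
    "act (\<pi> ^ (T * m)) (cj \<pi> ^ (T * m)) v \<in> D"
    using 1(1)[of "int m"] 1(1)[of "- int m"] 1(2)[of m]
    by (simp_all add: power_mult power_int_minus)
qed (use assms in \<open>auto simp: invariant_def\<close>)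

lemma power_stays_cong_1:
  assumes "w \<in> Zs" "c \<in> Zs" "x = 1 + c * w"
  shows "\<exists>w\<in>Zs. x ^ k = 1 + c * w"
proof -
  obtain v where v: "v \<in> Zs" "x ^ k = 1 + of_nat k * (c * w) + (c * w)\<^sup>2 * v"
    using power_expansion2[OF Zs_closed(8)[OF assms(2,1)]] assms(3) by blast
  have "x ^ k = 1 + c * (of_nat k * w + w * (c * w) * v)"
    unfolding v by (simp add: algebra_simps power2_eq_square)
  moreover have "of_nat k * w + w * (c * w) * v \<in> Zs" by (intro Zs_closed assms v)
  ultimately show ?thesis by blast
qed

lemma Zs_cancel_coprime:
  assumes "x \<in> Zs" "coprime (int c) (int m)" "of_nat c * x = of_nat m * w" "w \<in> Zs"
  shows "\<exists>w\<in>Zs. x = of_nat m * w"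
proof -
  obtain u v where uv: "u * int c + v * int m = 1" using bezout_int[of "int c" "int m"] assms(2) by auto
  have "x = of_int (u * int c + v * int m) * x" unfolding uv by simp
  also have "\<dots> = of_int u * (of_nat c * x) + of_int v * of_nat m * x" by (simp add: algebra_simps)
  also have "\<dots> = of_nat m * (of_int u * w + of_int v * x)" unfolding assms(3) by (simp add: algebra_simps)
  finally have "x = of_nat m * (of_int u * w + of_int v * x)" .
  moreover have "of_int u * w + of_int v * x \<in> Zs" by (intro Zs_closed assms)
  ultimately show ?thesis by blast
qed

text \<open>
  Modulo \<open>m\<close> the element \<open>\<pi>\<close> is invertible, as its norm is coprime to \<open>m\<close>.
\<close>

lemma common_period:
  fixes m :: nat
  assumes "m > 0" "coprime N\<pi> m"
  shows "\<exists>T>0. (\<exists>w\<in>Zs. \<epsilon> ^ T = 1 + of_nat m * w) \<and> (\<exists>w\<in>Zs. \<pi> ^ T = 1 + of_nat m * w)"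
proof -
  obtain T1 w1 where T1: "T1 > 0" "w1 \<in> Zs" "\<epsilon> ^ T1 = 1 + of_nat m * w1"
    using unit_power_cong_1_mod[OF assms(1)] by blast
  obtain i T2 w where T2: "T2 > 0" "w \<in> Zs" "\<pi> ^ (i + T2) = \<pi> ^ i + of_nat m * w"
    using powers_eventually_periodic[OF \<pi>_Zs(1) assms(1)] by blast
  have nm: "cj \<pi> ^ i * \<pi> ^ i = of_nat (N\<pi> ^ i)"
    using norm_\<pi> by (simp add: mult.commute flip: power_mult_distrib)
  have "of_nat (N\<pi> ^ i) * (\<pi> ^ T2 - 1) = cj \<pi> ^ i * (\<pi> ^ i * \<pi> ^ T2 - \<pi> ^ i)"
    unfolding nm[symmetric] by (simp add: algebra_simps)
  also have "\<dots> = of_nat m * (cj \<pi> ^ i * w)" using T2(3) by (simp add: power_add)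
  finally have *: "of_nat (N\<pi> ^ i) * (\<pi> ^ T2 - 1) = of_nat m * (cj \<pi> ^ i * w)" .
  have "\<exists>w\<in>Zs. \<pi> ^ T2 - 1 = of_nat m * w"
  proof (rule Zs_cancel_coprime[OF _ _ *])
    show "coprime (int (N\<pi> ^ i)) (int m)" using assms(2) unfolding coprime_int_iff by simp
  qed (intro Zs_closed Zs_power \<pi>_Zs T2)+
  then obtain w2 where w2: "w2 \<in> Zs" "\<pi> ^ T2 = 1 + of_nat m * w2" by (metis add_diff_cancel_left' diff_add_cancel add.commute)
  have "\<exists>w\<in>Zs. (\<epsilon> ^ T1) ^ T2 = 1 + of_nat m * w"
    by (rule power_stays_cong_1[OF T1(2) Zs_closed(2) T1(3)])
  moreover have "\<exists>w\<in>Zs. (\<pi> ^ T2) ^ T1 = 1 + of_nat m * w"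
    by (rule power_stays_cong_1[OF w2(1) Zs_closed(2) w2(2)])
  ultimately show ?thesis using T1(1) T2(1)
    by (intro exI[of _ "T1 * T2"]) (auto simp: power_mult mult.commute simp flip: power_mult)
qed


text \<open>
  Boshernitzan's step: the points \<open>v\<close> of a set \<open>E\<close> for which \<open>v + emb x\<close> is again in \<open>E\<close> form a closed
  invariant set, which is nonempty because \<open>emb x\<close> is a difference. Iterating it produces long arithmetic
  progressions.
\<close>

lemma invariant_progression:
  assumes D: "inv_\<epsilon>_\<pi> T D" and T: "T > 0" and ne: "D \<noteq> {}" and irr: "D \<inter> emb ` K = {}"
    and x: "x \<in> K" "(\<epsilon> ^ T - 1) * x \<in> Zs" "(\<pi> ^ T - 1) * x \<in> Zs"
  shows "\<exists>E\<subseteq>D. inv_\<epsilon>_\<pi> T E \<and> E \<noteq> {} \<and> (\<forall>v\<in>E. \<forall>i\<le>N. v + of_nat i *\<^sub>R emb x \<in> D)"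
proof (induction N)
  case 0
  show ?case using D ne by (intro exI[of _ D]) auto
next
  case (Suc N)
  then obtain E where E: "E \<subseteq> D" "inv_\<epsilon>_\<pi> T E" "E \<noteq> {}"
    "\<And>v i. v \<in> E \<Longrightarrow> i \<le> N \<Longrightarrow> v + of_nat i *\<^sub>R emb x \<in> D" by blast
  define E' where "E' = E \<inter> {v. v + emb x \<in> E}"
  have "inv_\<epsilon>_\<pi> T E'" unfolding E'_def
    by (intro invariant_Int invariant_translate x E)
  moreover have "E \<inter> emb ` K = {}" using E(1) irr by blast
  from invariant_differences[OF E(2) T E(3) this, of "emb x"] have "E' \<noteq> {}" unfolding E'_def by blast
  moreover have "v + of_nat i *\<^sub>R emb x \<in> D" if "v \<in> E'" "i \<le> Suc N" for v i
  proof (cases i)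
    case 0
    then show ?thesis using that E(1) by (auto simp: E'_def)
  next
    case (Suc j)
    then have "v + emb x + of_nat j *\<^sub>R emb x \<in> D" using that E(4) by (auto simp: E'_def)
    then show ?thesis by (simp add: Suc algebra_simps)
  qed
  ultimately show ?case using E(1) by (intro exI[of _ E']) (auto simp: E'_def)
qed

text \<open>
  A closed invariant set without points of \<open>K\<close> would contain, up to the lattice, a translate of
  all \<open>m\<close>-division points for suitable arbitrarily large \<open>m\<close>, hence come close to \<open>0\<close>.
\<close>

lemma invariant_meets_field:
  assumes D: "inv_\<epsilon>_\<pi> T D" and T: "T > 0" and ne: "D \<noteq> {}"
  shows "D \<inter> emb ` K \<noteq> {}"
proof
  assume irr: "D \<inter> emb ` K = {}"
  have "0 \<notin> D" using irr emb_simps(6) K_closed(1) by (metis disjoint_iff image_eqI)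
  then obtain \<eta> where \<eta>: "\<eta> > 0" "\<And>v. norm v < \<eta> \<Longrightarrow> v \<notin> D"
    using invariantD(1)[OF D] by (metis closed_approachable dist_0_norm dist_commute)
  obtain k where k: "real k > 2 * (1 + rd) / \<eta>" using reals_Archimedean2 by blast
  \<comment> \<open>this \<open>t\<close> is coprime to \<open>N\<pi>\<close> and as large as desired\<close>
  define t where "t = N\<pi> * (k + 1) + 1"
  have "k \<le> N\<pi> * k" using N\<pi>_gt_1 by simp
  then have "k \<le> t" unfolding t_def distrib_left by linarith
  then have "\<eta> * real k \<le> \<eta> * real t" using \<eta>(1) by simp
  moreover have "2 * (1 + rd) < \<eta> * real k" using k \<eta>(1) by (simp add: pos_divide_less_eq mult.commute)
  ultimately have "2 * (1 + rd) < \<eta> * real t" by linarith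
  moreover have "t > 0" by (simp add: t_def)
  ultimately have t: "t > 0" "2 * (1 + rd) / real t < \<eta>" by (simp_all only: pos_divide_less_eq of_nat_0_less_iff)
  have cop: "coprime N\<pi> t" unfolding t_def by (rule coprimeI) (metis dvd_add_right_iff dvd_mult2)
  obtain T' w w' where T': "T' > 0" "w \<in> Zs" "\<epsilon> ^ T' = 1 + of_nat t * w" "w' \<in> Zs" "\<pi> ^ T' = 1 + of_nat t * w'"
    using common_period[OF t(1) cop] by blast
  define N where "N = T * T'"
  have N: "N > 0" using T T'(1) by (simp add: N_def)
  have tZ: "real t \<in> Zs" by (rule Zs_closed)
  obtain u u' where u: "u \<in> Zs" "\<epsilon> ^ N = 1 + of_nat t * u" "u' \<in> Zs" "\<pi> ^ N = 1 + of_nat t * u'"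
    using power_stays_cong_1[OF T'(2) tZ T'(3), of T] power_stays_cong_1[OF T'(4) tZ T'(5), of T]
    by (metis N_def mult.commute power_mult)
  have per: "(\<epsilon> ^ N - 1) * (x / real t) \<in> Zs" "(\<pi> ^ N - 1) * (x / real t) \<in> Zs" if "x \<in> Zs" for x
    using u t(1) that Zs_closed(8) by simp_all
  have DN: "inv_\<epsilon>_\<pi> N D" unfolding N_def by (rule invariant_power[OF D])
  obtain E where E: "E \<subseteq> D" "inv_\<epsilon>_\<pi> N E" "E \<noteq> {}"
    "\<And>v i. v \<in> E \<Longrightarrow> i \<le> t \<Longrightarrow> v + of_nat i *\<^sub>R emb (1 / real t) \<in> D"
    using invariant_progression[OF DN N ne irr _ per, of 1 t] Zs_closed(4) by auto
  have irrE: "E \<inter> emb ` K = {}" using E(1) irr by blast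
  obtain E' where E': "E' \<noteq> {}" "\<And>v i. v \<in> E' \<Longrightarrow> i \<le> t \<Longrightarrow> v + of_nat i *\<^sub>R emb (rd / real t) \<in> E"
    using invariant_progression[OF E(2) N E(3) irrE _ per, of rd t] Zs_closed(5) by auto
  obtain v where v: "v \<in> E'" using E'(1) by blast
  define a b where "a = (fst v + snd v) / 2" and "b = (fst v - snd v) / (2 * rd)"
  have v': "fst v = a + b * rd" "snd v = a - b * rd" using rd_gt_1 by (simp_all add: a_def b_def field_simps)
  have round: "\<exists>i A. i \<le> t \<and> 0 \<le> x + real i / real t + of_int A \<and> x + real i / real t + of_int A \<le> 1 / real t"
    for x :: real
  proof -
    define i where "i = nat ((- \<lfloor>x * real t\<rfloor>) mod int t)"
    have i: "int i = (- \<lfloor>x * real t\<rfloor>) mod int t" using t(1) by (simp add: i_def)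
    then have "int t dvd int i + \<lfloor>x * real t\<rfloor>" by (metis diff_minus_eq_add mod_eq_dvd_iff mod_mod_trivial)
    then obtain A where A: "int i + \<lfloor>x * real t\<rfloor> = int t * A" by (elim dvdE)
    have "real i + of_int \<lfloor>x * real t\<rfloor> = real t * of_int A"
      using A by (metis of_int_add of_int_mult of_int_of_nat_eq)
    moreover have "0 \<le> x * real t - of_int \<lfloor>x * real t\<rfloor>" "x * real t - of_int \<lfloor>x * real t\<rfloor> \<le> 1" by linarith+
    moreover have "x + real i / real t + of_int (- A) = (x * real t + real i - real t * of_int A) / real t"
      using t(1) by (simp add: field_simps)
    ultimately have "x + real i / real t + of_int (- A) = (x * real t - of_int \<lfloor>x * real t\<rfloor>) / real t"
      by (simp add: algebra_simps)
    moreover have "i \<le> t" using i t(1) by (metis less_imp_le of_nat_0_less_iff of_nat_le_iff pos_mod_bound)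
    ultimately show ?thesis
      using \<open>0 \<le> x * real t - of_int \<lfloor>x * real t\<rfloor>\<close> \<open>x * real t - of_int \<lfloor>x * real t\<rfloor> \<le> 1\<close>
      by (intro exI[of _ i] exI[of _ "- A"]) (auto simp: divide_right_mono)
  qed
  obtain i A where i: "i \<le> t" "0 \<le> a + real i / real t + of_int A" "a + real i / real t + of_int A \<le> 1 / real t"
    using round by blast
  obtain j B where j: "j \<le> t" "0 \<le> b + real j / real t + of_int B" "b + real j / real t + of_int B \<le> 1 / real t"
    using round by blast
  define a' b' where "a' = a + real i / real t + of_int A" and "b' = b + real j / real t + of_int B"
  have "v + of_nat j *\<^sub>R emb (rd / real t) + of_nat i *\<^sub>R emb (1 / real t) + emb (of_int A + of_int B * rd) \<in> D"
    by (intro invariantD(2)[OF D] E(4) E'(2) v i j Zs_coords)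
  moreover have "cj (rd / real t) = - rd / real t" "cj (1 / real t) = 1 / real t"
    by (simp_all add: cj_divide)
  ultimately have "(a' + b' * rd, a' - b' * rd) \<in> D"
    unfolding emb_def cj_Zs_coords by (simp add: prod_eq_iff v' a'_def b'_def algebra_simps add_divide_distrib
      flip: surjective_pairing) (simp add: plus_prod_def v' algebra_simps)
  moreover have "norm (a' + b' * rd, a' - b' * rd) < \<eta>"
  proof -
    have "\<bar>a'\<bar> \<le> 1 / real t" "\<bar>b'\<bar> \<le> 1 / real t"
      using i j by (simp_all add: a'_def b'_def)
    moreover from this(2) have "\<bar>b'\<bar> * rd \<le> 1 / real t * rd" using rd_gt_1 by (intro mult_right_mono) auto
    ultimately have ab: "\<bar>a'\<bar> \<le> 1 / real t" "\<bar>b' * rd\<bar> \<le> 1 / real t * rd"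
      using rd_gt_1 by (simp_all add: abs_mult)
    have "norm (a' + b' * rd, a' - b' * rd) \<le> \<bar>a' + b' * rd\<bar> + \<bar>a' - b' * rd\<bar>"
      using norm_prod_le[of "(a' + b' * rd, a' - b' * rd)"] by simp
    also have "\<dots> \<le> 2 * (\<bar>a'\<bar> + \<bar>b' * rd\<bar>)"
      unfolding mult_2 by (rule add_mono[OF abs_triangle_ineq abs_triangle_ineq4])
    also have "\<dots> \<le> 2 * (1 / real t + 1 / real t * rd)" by (rule mult_left_mono[OF add_mono[OF ab]]) simp
    also have "\<dots> = 2 * (1 + rd) / real t" by (simp add: distrib_left add_divide_distrib mult.commute)
    finally show ?thesis using t(2) by linarith
  qed
  ultimately show False using \<eta>(2) by blast
qed

definition orbit :: "real \<times> real \<Rightarrow> (real \<times> real) set" where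
  "orbit v = {act (\<epsilon> powi k * \<pi> ^ l) (\<epsilon> powi (- k) * cj \<pi> ^ l) v + emb y | k l y. y \<in> Zs}"

lemma orbitI: "y \<in> Zs \<Longrightarrow> act (\<epsilon> powi k * \<pi> ^ l) (\<epsilon> powi (- k) * cj \<pi> ^ l) v + emb y \<in> orbit v"
  unfolding orbit_def by (intro CollectI exI[of _ k] exI[of _ l] exI[of _ y]) simp

lemma orbitE:
  assumes "w \<in> orbit v"
  obtains k l y where "y \<in> Zs" "w = act (\<epsilon> powi k * \<pi> ^ l) (\<epsilon> powi (- k) * cj \<pi> ^ l) v + emb y"
  using assms unfolding orbit_def by (elim CollectE exE conjE)

lemma orbit_closure_invariant: "inv_\<epsilon>_\<pi> 1 (closure (orbit v))"
proof -
  have cl: "f w \<in> closure (orbit v)"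
    if "w \<in> closure (orbit v)" "continuous_on UNIV f" "\<And>w. w \<in> orbit v \<Longrightarrow> f w \<in> orbit v" for f w
  proof -
    have "f ` closure (orbit v) \<subseteq> closure (orbit v)"
      by (rule image_closure_subset) (use that continuous_on_subset closure_subset in blast)+
    then show ?thesis using that(1) by blast
  qed
  have e0: "\<epsilon> \<noteq> 0" using \<epsilon>_unit by simp
  have mult: "act c (cj c) (act a b v + emb y) = act (c * a) (cj c * b) v + emb (c * y)"
    if "c \<in> Zs" "y \<in> Zs" for c a b y
    using that Zrd_in_K by (simp add: act_def emb_def cj_mult algebra_simps)
  have "act \<epsilon> (inverse \<epsilon>) w \<in> orbit v \<and> act (inverse \<epsilon>) \<epsilon> w \<in> orbit v \<and> act \<pi> (cj \<pi>) w \<in> orbit v"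
    if w: "w \<in> orbit v" for w
  proof -
    obtain k l y where y: "y \<in> Zs" "w = act (\<epsilon> powi k * \<pi> ^ l) (\<epsilon> powi (- k) * cj \<pi> ^ l) v + emb y"
      using w by (rule orbitE)
    have "act \<epsilon> (inverse \<epsilon>) w = act (\<epsilon> powi (k + 1) * \<pi> ^ l) (\<epsilon> powi (- (k + 1)) * cj \<pi> ^ l) v + emb (\<epsilon> * y)"
      using mult[OF \<epsilon>_unit(1) y(1)] e0 unfolding y(2) cj_\<epsilon>
      by (simp add: power_int_add power_int_diff power_int_minus field_simps)
    moreover have "act (inverse \<epsilon>) \<epsilon> w
        = act (\<epsilon> powi (k - 1) * \<pi> ^ l) (\<epsilon> powi (- (k - 1)) * cj \<pi> ^ l) v + emb (inverse \<epsilon> * y)"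
      using mult[OF Zs_closed(10)[OF \<epsilon>_unit(1)] y(1)] e0 cj_cj[OF Zrd_in_K[OF \<epsilon>_unit(1)]] unfolding y(2) cj_\<epsilon>
      by (simp add: power_int_add power_int_diff power_int_minus field_simps)
    moreover have "act \<pi> (cj \<pi>) w
        = act (\<epsilon> powi k * \<pi> ^ Suc l) (\<epsilon> powi (- k) * cj \<pi> ^ Suc l) v + emb (\<pi> * y)"
      using mult[OF \<pi>_Zs(1) y(1)] unfolding y(2) by (simp add: mult_ac)
    moreover have "\<epsilon> * y \<in> Zs" "inverse \<epsilon> * y \<in> Zs" "\<pi> * y \<in> Zs"
      using Zs_closed(8)[OF _ y(1)] \<epsilon>_unit(1) Zs_closed(10)[OF \<epsilon>_unit(1)] \<pi>_Zs unfolding cj_\<epsilon> by auto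
    ultimately show ?thesis by (simp only: orbitI)
  qed
  moreover have "w + emb z \<in> orbit v" if w: "w \<in> orbit v" and z: "z \<in> Zs" for w z
  proof -
    obtain k l y where y: "y \<in> Zs" "w = act (\<epsilon> powi k * \<pi> ^ l) (\<epsilon> powi (- k) * cj \<pi> ^ l) v + emb y"
      using w by (rule orbitE)
    have "w + emb z = act (\<epsilon> powi k * \<pi> ^ l) (\<epsilon> powi (- k) * cj \<pi> ^ l) v + emb (y + z)"
      using y z Zrd_in_K by (simp add: emb_simps)
    then show ?thesis using orbitI[OF Zs_closed(6)[OF y(1) z]] by simp
  qed
  moreover have "continuous_on UNIV (\<lambda>w. w + emb z)" for z by (intro continuous_intros)
  ultimately show ?thesis
    unfolding invariant_def periodic_def
    using cl[of _ "act \<epsilon> (inverse \<epsilon>)"] cl[of _ "act (inverse \<epsilon>) \<epsilon>"] cl[of _ "act \<pi> (cj \<pi>)"]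
      cl[of _ "\<lambda>w. w + emb _"] continuous_act by simp
qed

lemma orbit_avoids_field: "v \<notin> emb ` K \<Longrightarrow> orbit v \<inter> emb ` K = {}"
proof (rule ccontr)
  assume v: "v \<notin> emb ` K" and "orbit v \<inter> emb ` K \<noteq> {}"
  then obtain x where "x \<in> K" and "emb x \<in> orbit v" by blast
  from this(2) obtain k l y where "y \<in> Zs"
    "emb x = act (\<epsilon> powi k * \<pi> ^ l) (\<epsilon> powi (- k) * cj \<pi> ^ l) v + emb y"
    by (rule orbitE)
  note x = \<open>x \<in> K\<close> this
  define c where "c = \<epsilon> powi k * \<pi> ^ l"
  have cK: "c \<in> K" unfolding c_def using \<epsilon>_powi(1) \<pi>_Zs Zrd_in_K by auto
  have cc: "cj c = \<epsilon> powi (- k) * cj \<pi> ^ l"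
    unfolding c_def using \<epsilon>_powi \<pi>_Zs Zrd_in_K by (simp add: cj_simps)
  have c0: "c \<noteq> 0" unfolding c_def using \<epsilon>_unit \<pi>_gt_1 by simp
  have "emb x = act c (cj c) v + emb y" unfolding cc using x(3) by (simp only: c_def)
  then have "c * fst v = x - y" "cj c * snd v = cj x - cj y"
    by (auto simp: emb_def act_def)
  then have "v = emb ((x - y) / c)"
    using c0 cj_eq_0_iff[OF cK] cK x(1,2) Zrd_in_K
    by (auto simp: emb_def prod_eq_iff cj_divide cj_diff field_simps)
  moreover have "(x - y) / c \<in> K" using x cK Zrd_in_K by auto
  ultimately show False using v by blast
qed

text \<open>
  The closure \<open>X\<close> of the orbit contains a point of \<open>K\<close>. Powers of \<open>\<pi>\<close> modulo its denominator
  are eventually periodic, so after multiplication by a power of \<open>\<pi>\<close> both maps, raised to some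
  power, fix the point modulo the lattice. The orbit does not meet \<open>K\<close>, hence \<open>X\<close> accumulates at
  this point, and translating it to \<open>0\<close> exhibits an invariant set that accumulates at \<open>0\<close>.
\<close>

theorem orbit_dense:
  assumes v: "v \<notin> emb ` K" shows "closure (orbit v) = UNIV"
proof -
  let ?X = "closure (orbit v)"
  note X = orbit_closure_invariant[of v]
  have "orbit v \<noteq> {}" using orbitI[OF Zs_closed(3)] by blast
  then have "?X \<noteq> {}" using closure_subset by blast
  from invariant_meets_field[OF X _ this] obtain x where x: "x \<in> K" "emb x \<in> ?X" by auto
  obtain m where m: "m > 0" "real m * x \<in> Zs" using K_denominator[OF x(1)] .
  obtain i T1 w where T1: "T1 > 0" "w \<in> Zs" "\<pi> ^ (i + T1) = \<pi> ^ i + of_nat m * w"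
    using powers_eventually_periodic[OF \<pi>_Zs(1) m(1)] by blast
  obtain T2 w2 where T2: "T2 > 0" "w2 \<in> Zs" "\<epsilon> ^ T2 = 1 + of_nat m * w2"
    using unit_power_cong_1_mod[OF m(1)] by blast
  define x' where "x' = \<pi> ^ i * x"
  have x'K: "x' \<in> K" unfolding x'_def using x(1) \<pi>_Zs Zrd_in_K by auto
  have "act (\<pi> ^ i) (cj \<pi> ^ i) (emb x) \<in> ?X"
    using invariant_powi(2)[OF X x(2), of i] \<epsilon>_unit(2) by simp
  then have x'X: "emb x' \<in> ?X"
    using x(1) \<pi>_Zs Zrd_in_K by (simp add: x'_def emb_def act_def cj_simps)
  have mx': "real m * x' \<in> Zs" unfolding x'_def
    using Zs_closed(8)[OF Zs_power[OF \<pi>_Zs(1)] m(2), of i] by (simp add: mult.left_commute)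
  define T where "T = T1 * T2"
  have T: "T > 0" using T1 T2 by (simp add: T_def)
  have "(\<epsilon> ^ T - 1) * x' \<in> Zs"
  proof -
    obtain u where "u \<in> Zs" "(\<epsilon> ^ T2) ^ T1 = 1 + of_nat m * u"
      using power_stays_cong_1[OF T2(2) Zs_closed(2) T2(3), of T1] by blast
    then have "(\<epsilon> ^ T - 1) * x' = u * (real m * x')"
      by (simp add: T_def mult.commute mult.left_commute flip: power_mult)
    then show ?thesis using Zs_closed(8)[OF \<open>u \<in> Zs\<close> mx'] by (simp only:)
  qed
  moreover have "(\<pi> ^ T - 1) * x' \<in> Zs"
  proof -
    have "(\<pi> ^ (T1 * j) - 1) * x' \<in> Zs" for j
    proof (induction j)
      case 0
      show ?case by (simp add: Zs_closed)
    next
      case (Suc j)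
      have "(\<pi> ^ T1 - 1) * x' = w * (real m * x)"
        using T1(3) by (simp add: x'_def power_add algebra_simps)
      then have "(\<pi> ^ T1 - 1) * x' \<in> Zs" using T1(2) m(2) Zs_closed(8) by simp
      then have "\<pi> ^ (T1 * j) * ((\<pi> ^ T1 - 1) * x') + (\<pi> ^ (T1 * j) - 1) * x' \<in> Zs"
        by (intro Zs_closed(6)[OF Zs_closed(8)] Zs_power \<pi>_Zs Suc)
      then show ?case by (simp add: power_add algebra_simps)
    qed
    then show ?thesis by (simp add: T_def)
  qed
  ultimately have inv: "inv_\<epsilon>_\<pi> T {u. u + emb x' \<in> ?X}"
    using invariant_power[OF X, of T] by (intro invariant_translate x'K) auto
  have "\<exists>u\<in>{u. u + emb x' \<in> ?X}. u \<noteq> 0 \<and> norm u < \<eta>" if \<eta>: "\<eta> > 0" for \<eta>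
  proof -
    obtain o' where o: "o' \<in> orbit v" "dist o' (emb x') < \<eta>"
      using x'X \<eta> unfolding closure_approachable by blast
    have "o' \<noteq> emb x'" using orbit_avoids_field[OF v] o(1) x'K by blast
    then show ?thesis using o closure_subset[of "orbit v"]
      by (intro bexI[of _ "o' - emb x'"]) (auto simp: dist_norm)
  qed
  then have "{u. u + emb x' \<in> ?X} = UNIV" by (rule invariant_accumulating_at_0[OF inv T])
  then have "u - emb x' + emb x' \<in> ?X" for u by blast
  then show ?thesis by auto
qed

section \<open>Points outside the field\<close>

definition chain2_region :: "real \<Rightarrow> real \<Rightarrow> (real \<times> real) set" where
  "chain2_region q u = {v. \<bar>(1 - u * (fst v - q)) * (1 - cj u * (snd v - cj q))\<bar> < 1}"

text \<open>
  Density provides \<open>c = \<epsilon> ^ k * \<pi> ^ l\<close> such that \<open>c * v\<close> is close to some \<open>\<alpha> = 1\<close> modulo \<open>M\<close>. Such an \<open>\<alpha>\<close>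
  equals \<open>\<epsilon> ^ j + \<pi> ^ l * q\<close>; dividing by \<open>\<epsilon> ^ j\<close> turns \<open>c * v - \<alpha>\<close> into \<open>u * (v - r) - 1\<close>
  without changing its norm.
\<close>

theorem outside_field_covered:
  assumes v: "v \<notin> emb ` K" shows "\<exists>q\<in>Zs. \<exists>u\<in>Zs. v \<in> chain2_region q u"
proof -
  obtain M where M: "M > 0" "\<And>l y. y \<in> Zs \<Longrightarrow> \<exists>j::nat. \<exists>q\<in>Zs. 1 + real M * y = \<epsilon> ^ j + \<pi> ^ l * q"
    using units_open_mod_\<pi>_powers by blast
  define v' where "v' = act (1 / real M) (1 / real M) v"
  have "v' \<notin> emb ` K"
  proof
    assume "v' \<in> emb ` K"
    then obtain x where x: "x \<in> K" "v' = emb x" by blast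
    then have "v = emb (real M * x)"
      using M(1) by (simp add: v'_def act_def emb_def prod_eq_iff cj_simps field_simps)
    then show False using v x(1) by auto
  qed
  from orbit_dense[OF this] have "emb (1 / real M) \<in> closure (orbit v')" by simp
  \<comment> \<open>after multiplication by \<open>M\<close> each coordinate is off by less than \<open>1 / 2\<close>\<close>
  then obtain w where w: "w \<in> orbit v'" "dist w (emb (1 / real M)) < 1 / (2 * real M)"
    unfolding closure_approachable using M(1) by (metis divide_pos_pos mult_pos_pos of_nat_0_less_iff zero_less_numeral zero_less_one)
  obtain k l y where y: "y \<in> Zs" "w = act (\<epsilon> powi k * \<pi> ^ l) (\<epsilon> powi (- k) * cj \<pi> ^ l) v' + emb y"
    using w(1) by (rule orbitE)
  define c where "c = \<epsilon> powi k * \<pi> ^ l"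
  have cZ: "c \<in> Zs" unfolding c_def using Zs_closed(8)[OF \<epsilon>_powi(1) Zs_power[OF \<pi>_Zs(1)]] .
  have cc: "cj c = \<epsilon> powi (- k) * cj \<pi> ^ l"
    unfolding c_def using \<epsilon>_powi \<pi>_Zs Zrd_in_K by (simp add: cj_simps)
  have cjM: "cj (1 / real M) = 1 / real M" by (simp add: cj_divide)
  have "\<bar>c * fst v / real M + y - 1 / real M\<bar> < 1 / (2 * real M)"
    "\<bar>cj c * snd v / real M + cj y - 1 / real M\<bar> < 1 / (2 * real M)"
    using abs_le_norm_prod[of "w - emb (1 / real M)"] w(2) cjM
    unfolding y(2) cc[symmetric] c_def[symmetric] dist_norm
    by (simp_all add: act_def emb_def v'_def)
  moreover have "\<bar>a * real M\<bar> < 1 / 2" if "\<bar>a\<bar> < 1 / (2 * real M)" for a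
    using that M(1) by (simp add: abs_mult pos_less_divide_eq mult_ac)
  ultimately have "\<bar>(c * fst v / real M + y - 1 / real M) * real M\<bar> < 1 / 2"
    "\<bar>(cj c * snd v / real M + cj y - 1 / real M) * real M\<bar> < 1 / 2" by blast+
  then have close: "\<bar>c * fst v + real M * y - 1\<bar> < 1 / 2" "\<bar>cj c * snd v + real M * cj y - 1\<bar> < 1 / 2"
    using M(1) by (simp_all add: algebra_simps)
  obtain j q where q: "q \<in> Zs" "1 + real M * (- y) = \<epsilon> ^ j + \<pi> ^ l * q"
    using M(2)[OF Zs_closed(9)[OF y(1)], of l] by blast
  have q': "1 - real M * cj y = cj \<epsilon> ^ j + cj \<pi> ^ l * cj q"
  proof -
    have "cj (1 + real M * (- y)) = cj (\<epsilon> ^ j + \<pi> ^ l * q)" using q(2) by simp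
    then show ?thesis using q(1) y(1) \<epsilon>_unit \<pi>_Zs Zrd_in_K by (simp add: cj_simps)
  qed
  define u where "u = \<epsilon> powi (k - int j) * \<pi> ^ l"
  define r where "r = \<epsilon> powi (- k) * q"
  have uZ: "u \<in> Zs" unfolding u_def using Zs_closed(8)[OF \<epsilon>_powi(1) Zs_power[OF \<pi>_Zs(1)]] .
  have rZ: "r \<in> Zs" unfolding r_def using Zs_closed(8)[OF \<epsilon>_powi(1) q(1)] .
  have cu: "cj u = \<epsilon> powi (int j - k) * cj \<pi> ^ l" "cj r = \<epsilon> powi k * cj q"
    unfolding u_def r_def using \<epsilon>_powi \<pi>_Zs Zrd_in_K q(1) by (simp_all add: cj_simps)
  have e0: "\<epsilon> \<noteq> 0" using \<epsilon>_unit by simp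
  have 1: "1 - u * (fst v - r) = - (\<epsilon> powi (- int j) * (c * fst v + real M * y - 1))"
  proof -
    have *: "c * fst v + real M * y - 1 = c * fst v - \<epsilon> ^ j - \<pi> ^ l * q" using q(2) by simp
    show ?thesis
      unfolding * unfolding u_def r_def c_def using e0
      by (simp add: power_int_diff power_int_minus field_simps)
  qed
  have 2: "1 - cj u * (snd v - cj r) = - (\<epsilon> powi int j * (cj c * snd v + real M * cj y - 1))"
  proof -
    have *: "cj c * snd v + real M * cj y - 1 = cj c * snd v - inverse \<epsilon> ^ j - cj \<pi> ^ l * cj q"
      using q' by (simp add: cj_\<epsilon>)
    show ?thesis
      unfolding * unfolding cu cc using e0
      by (simp add: power_int_diff power_int_minus power_inverse field_simps)
  qed
  have "(1 - u * (fst v - r)) * (1 - cj u * (snd v - cj r))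
      = (c * fst v + real M * y - 1) * (cj c * snd v + real M * cj y - 1)"
    unfolding 1 2 using e0 by (simp add: power_int_minus field_simps)
  also have "\<bar>\<dots>\<bar> < 1"
  proof -
    have "\<bar>c * fst v + real M * y - 1\<bar> * \<bar>cj c * snd v + real M * cj y - 1\<bar> \<le> 1 / 2 * (1 / 2)"
      using close by (intro mult_mono) auto
    then show ?thesis by (simp add: abs_mult)
  qed
  finally show ?thesis using uZ rZ unfolding chain2_region_def by blast
qed

section \<open>Continued fractions by descent on the norm\<close>

lemma two_stage_decreasing:
  assumes "two_stage_euclidean K" "\<alpha> \<in> OK" "\<beta> \<in> OK" "\<beta> \<noteq> 0"
  obtains (one) q r where "q \<in> OK" "r \<in> OK" "\<alpha> = q * \<beta> + r" "\<bar>r * cj r\<bar> < \<bar>\<beta> * cj \<beta>\<bar>"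
  | (two) q q' r r' where "q \<in> OK" "q' \<in> OK" "r \<in> OK" "r' \<in> OK" "\<alpha> = q * \<beta> + r" "\<beta> = q' * r + r'"
      "\<bar>r' * cj r'\<bar> < \<bar>\<beta> * cj \<beta>\<bar>"
proof -
  have dec: "r \<in> OK \<Longrightarrow> decreasing K \<beta> r \<Longrightarrow> \<bar>r * cj r\<bar> < \<bar>\<beta> * cj \<beta>\<bar>" for r
    using decreasing_iff OK_in_K assms(3) by blast
  have "(\<exists>q1 r1. division_chain1 K \<alpha> \<beta> q1 r1 \<and> decreasing K \<beta> r1) \<or>
      (\<exists>q1 q2 r1 r2. division_chain2 K \<alpha> \<beta> q1 q2 r1 r2 \<and> decreasing K \<beta> r2)"
    using assms unfolding two_stage_euclidean_def by blast
  then show ?thesis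
  proof (elim disjE exE conjE)
    fix q r assume "division_chain1 K \<alpha> \<beta> q r" "decreasing K \<beta> r"
    then show ?thesis by (intro one[of q r] dec) (simp_all add: division_chain1_def)
  next
    fix q q' r r' assume "division_chain2 K \<alpha> \<beta> q q' r r'" "decreasing K \<beta> r'"
    then show ?thesis by (intro two[of q q' r r'] dec) (simp_all add: division_chain2_def)
  qed
qed

lemma continued_fraction_Cons:
  "continued_fraction qs = Some y \<Longrightarrow> y \<noteq> 0 \<Longrightarrow> continued_fraction (q # qs) = Some (q + 1 / y)"
  by (cases qs) auto

text \<open>
  Each division chain yields one or two partial quotients and a pair whose second entry has smaller
  norm, unless a remainder vanishes and the expansion ends. Norms of integral elements are
  integers, so this terminates.
\<close>

lemma continued_fraction_exists:
  assumes "two_stage_euclidean K" "\<alpha> \<in> OK" "\<beta> \<in> OK" "\<beta> \<noteq> 0"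
  shows "\<exists>qs. set qs \<subseteq> OK \<and> continued_fraction qs = Some (\<alpha> / \<beta>)"
  using assms(2-4)
proof (induction "nat \<lfloor>\<bar>\<beta> * cj \<beta>\<bar>\<rfloor>" arbitrary: \<alpha> \<beta> rule: less_induct)
  case (less \<beta>)
  have smaller: "nat \<lfloor>\<bar>r * cj r\<bar>\<rfloor> < nat \<lfloor>\<bar>\<beta> * cj \<beta>\<bar>\<rfloor>"
    if "r \<in> OK" "\<bar>r * cj r\<bar> < \<bar>\<beta> * cj \<beta>\<bar>" for r
  proof -
    have "r * cj r \<in> \<int>" "\<beta> * cj \<beta> \<in> \<int>" using that(1) less.prems(2) unfolding OK_iff_trace_norm by simp_all
    then obtain k m where km: "r * cj r = of_int k" "\<beta> * cj \<beta> = of_int m" by (elim Ints_cases)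
    show ?thesis using that(2) unfolding km by (simp flip: of_int_abs)
  qed
  show ?case
    using assms(1) less.prems
  proof (cases rule: two_stage_decreasing)
    case (one q r)
    show ?thesis
    proof (cases "r = 0")
      case True
      then show ?thesis using one less.prems by (intro exI[of _ "[q]"]) auto
    next
      case False
      obtain qs where qs: "set qs \<subseteq> OK" "continued_fraction qs = Some (\<beta> / r)"
        using less.hyps[OF smaller[OF one(2,4)] less.prems(2) one(2) False] by blast
      have "\<alpha> / \<beta> = q + 1 / (\<beta> / r)" using one(3) less.prems(3) by (simp add: field_simps)
      then show ?thesis
        using qs one(1) continued_fraction_Cons[OF qs(2), of q] False less.prems(3)
        by (intro exI[of _ "q # qs"]) auto
    qed
  next
    case (two q q' r r')
    have x: "\<alpha> / \<beta> = q + 1 / (\<beta> / r)" if "r \<noteq> 0" using two(5) less.prems(3) that by (simp add: field_simps)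
    consider "r = 0" | "r \<noteq> 0" "r' = 0" | "r \<noteq> 0" "r' \<noteq> 0" by blast
    then show ?thesis
    proof cases
      case 1
      then show ?thesis using two(1,5) less.prems by (intro exI[of _ "[q]"]) auto
    next
      case 2
      then have "\<beta> / r = q'" using two(6) by simp
      moreover from this have "q' \<noteq> 0" using 2 less.prems(3) by auto
      ultimately show ?thesis using x[OF 2(1)] two(1,2) by (intro exI[of _ "[q, q']"]) auto
    next
      case 3
      obtain qs where qs: "set qs \<subseteq> OK" "continued_fraction qs = Some (r / r')"
        using less.hyps[OF smaller[OF two(4,7)] two(3,4) 3(2)] by blast
      have "\<beta> / r = q' + 1 / (r / r')" using two(6) 3 by (simp add: field_simps)
      then have "continued_fraction (q' # qs) = Some (\<beta> / r)"
        using continued_fraction_Cons[OF qs(2), of q'] 3 by simp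
      from continued_fraction_Cons[OF this, of q]
      have "continued_fraction (q # q' # qs) = Some (\<alpha> / \<beta>)" using x 3 less.prems(3) by simp
      then show ?thesis using qs(1) two(1,2) by (intro exI[of _ "q # q' # qs"]) auto
    qed
  qed
qed

end

section \<open>A finite certificate\<close>

text \<open>
  A code stands for \<open>(num1 + num2 \<surd>d) / den\<close>.
\<close>

definition num1 :: "nat \<Rightarrow> int" where
  "num1 k = int_decode (fst (prod_decode k))"

definition num2 :: "nat \<Rightarrow> int" where
  "num2 k = int_decode (fst (prod_decode (snd (prod_decode k))))"

definition den :: "nat \<Rightarrow> int" where
  "den k = int (Suc (snd (prod_decode (snd (prod_decode k)))))"

definition integral_code :: "nat \<Rightarrow> nat \<Rightarrow> bool" where
  "integral_code d k \<longleftrightarrow> den k dvd 2 * num1 k \<and> (den k)\<^sup>2 dvd (num1 k)\<^sup>2 - int d * (num2 k)\<^sup>2"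

text \<open>
  Here \<open>y1 / m\<close> and \<open>y2 / m\<close> are the coordinates of \<open>x - q\<close> or \<open>1 - u * (x - q)\<close> at the corner \<open>x\<close> of a
  square, and \<open>r / m\<close> bounds their variation over the square. The left side bounds \<open>m\<^sup>2\<close> times the
  norm on the whole square.
\<close>

definition margin_ok :: "nat \<Rightarrow> int \<Rightarrow> int \<Rightarrow> int \<Rightarrow> int \<Rightarrow> bool" where
  "margin_ok d y1 y2 r m \<longleftrightarrow>
     \<bar>y1\<^sup>2 - int d * y2\<^sup>2\<bar> + 2 * r * (\<bar>y1\<bar> + int d * \<bar>y2\<bar>) + (1 + int d) * r\<^sup>2 < m\<^sup>2"

text \<open>
  A test which guarantees that the square with lower left corner \<open>(i / w, j / w)\<close> and side \<open>1 / w\<close>,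
  in coordinates with respect to \<open>1\<close> and \<open>\<surd>d\<close>, lies in one of the two regions of the integral
  elements \<open>q\<close> and \<open>u\<close> with the codes \<open>k\<close> and \<open>l\<close>.
\<close>

definition square_ok :: "nat \<Rightarrow> nat \<Rightarrow> nat \<Rightarrow> nat \<Rightarrow> nat \<Rightarrow> nat \<Rightarrow> bool" where
  "square_ok d w i j k l \<longleftrightarrow> integral_code d k \<and> integral_code d l \<and>
     (let y1 = int i * den k - int w * num1 k; y2 = int j * den k - int w * num2 k; m = int w * den k
      in margin_ok d y1 y2 (den k) m \<or>
         margin_ok d (den l * m - (num1 l * y1 + int d * num2 l * y2)) (- (num1 l * y2 + num2 l * y1))
           ((\<bar>num1 l\<bar> + int d * \<bar>num2 l\<bar>) * den k) (den l * m))"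

definition certificate :: "nat \<Rightarrow> nat \<Rightarrow> bool" where
  "certificate d w \<longleftrightarrow> 0 < w \<and> (\<forall>i<w. \<forall>j<w. \<exists>c<w. square_ok d w i j (fst (prod_decode c)) (snd (prod_decode c)))"

context quadratic
begin

abbreviation elt :: "nat \<Rightarrow> real" where "elt \<equiv> element_of_code d"

lemma den_pos: "den k > 0"
  by (simp add: den_def)

lemma elt_eq: "elt k = (of_int (num1 k) + of_int (num2 k) * rd) / of_int (den k)"
  by (simp add: element_of_code_def num1_def num2_def den_def split: prod.split)

lemma elt_coords: "elt k = of_int (num1 k) / of_int (den k) + of_int (num2 k) / of_int (den k) * rd"
  by (simp add: elt_eq add_divide_distrib)

lemma elt_in_K: "elt k \<in> K"
  using range_element_of_code by blast

lemma elt_surj: "x \<in> K \<Longrightarrow> \<exists>k. elt k = x"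
  using range_element_of_code by (metis image_iff)

lemma cj_elt: "cj (elt k) = (of_int (num1 k) - of_int (num2 k) * rd) / of_int (den k)"
  unfolding elt_eq by (subst cj_divide) (auto simp: cj_Zs_coords Zrd_in_K)

lemma cj_elt_coords: "cj (elt k) = of_int (num1 k) / of_int (den k) - of_int (num2 k) / of_int (den k) * rd"
  by (simp add: cj_elt diff_divide_distrib)

lemma divide_in_Ints_iff:
  fixes a b :: int assumes "b \<noteq> 0" shows "(of_int a / of_int b :: real) \<in> \<int> \<longleftrightarrow> b dvd a"
proof
  assume "(of_int a / of_int b :: real) \<in> \<int>"
  then obtain k where "(of_int a / of_int b :: real) = of_int k" by (elim Ints_cases)
  then have "real_of_int a = of_int (b * k)" using assms by (simp add: field_simps)
  then show "b dvd a" by (simp only: of_int_eq_iff) simp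
qed (use assms in auto)

lemma integral_code_iff: "integral_code d k \<longleftrightarrow> elt k \<in> OK"
proof -
  have dk: "den k \<noteq> 0" using den_pos[of k] by simp
  have "elt k + cj (elt k) = of_int (2 * num1 k) / of_int (den k)"
    unfolding cj_elt unfolding elt_eq by (simp flip: add_divide_distrib)
  moreover have "elt k * cj (elt k) = of_int ((num1 k)\<^sup>2 - int d * (num2 k)\<^sup>2) / of_int ((den k)\<^sup>2)"
    unfolding cj_elt unfolding elt_eq using norm_Zs_coords[of "num1 k" "num2 k"]
    unfolding cj_Zs_coords by (simp add: power2_eq_square)
  moreover have "(den k)\<^sup>2 \<noteq> 0" using dk by simp
  ultimately show ?thesis
    unfolding integral_code_def OK_iff_trace_norm
    by (simp only: divide_in_Ints_iff[OF dk] divide_in_Ints_iff[of "(den k)\<^sup>2"] elt_in_K simp_thms)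
qed

text \<open>
  The value of \<open>margin w1 w2 h\<close> bounds the absolute norm of every \<open>(w1 + t1) + (w2 + t2) rd\<close> with
  \<open>t1\<close> and \<open>t2\<close> at most \<open>h\<close> in absolute value.
\<close>

definition margin :: "real \<Rightarrow> real \<Rightarrow> real \<Rightarrow> real" where
  "margin w1 w2 h = \<bar>w1\<^sup>2 - real d * w2\<^sup>2\<bar> + 2 * h * (\<bar>w1\<bar> + real d * \<bar>w2\<bar>) + (1 + real d) * h\<^sup>2"

lemma margin_bound:
  assumes "\<bar>t1\<bar> \<le> h" "\<bar>t2\<bar> \<le> h"
  shows "\<bar>(w1 + t1)\<^sup>2 - real d * (w2 + t2)\<^sup>2\<bar> \<le> margin w1 w2 h"
proof -
  have "\<bar>w1\<bar> * \<bar>t1\<bar> \<le> \<bar>w1\<bar> * h" "(real d * \<bar>w2\<bar>) * \<bar>t2\<bar> \<le> (real d * \<bar>w2\<bar>) * h"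
    using assms by (intro mult_left_mono; simp)+
  then have linear: "\<bar>2 * w1 * t1\<bar> \<le> 2 * h * \<bar>w1\<bar>" "\<bar>real d * (2 * w2 * t2)\<bar> \<le> 2 * h * (real d * \<bar>w2\<bar>)"
    by (simp_all add: abs_mult mult_ac)
  have "\<bar>t1\<bar> \<le> \<bar>h\<bar>" "\<bar>t2\<bar> \<le> \<bar>h\<bar>" using assms by linarith+
  then have quadratic: "t1\<^sup>2 \<le> h\<^sup>2" "real d * t2\<^sup>2 \<le> real d * h\<^sup>2"
    unfolding abs_le_square_iff by (auto intro: mult_left_mono)
  have sum: "\<bar>A + X - Y + P - Q\<bar> \<le> \<bar>A\<bar> + (a + b) + (H + H')"
    if "\<bar>X\<bar> \<le> a" "\<bar>Y\<bar> \<le> b" "0 \<le> P" "P \<le> H" "0 \<le> Q" "Q \<le> H'" for A X Y P Q a b H H' :: real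
    using that by linarith
  have "(w1 + t1)\<^sup>2 - real d * (w2 + t2)\<^sup>2
      = (w1\<^sup>2 - real d * w2\<^sup>2) + 2 * w1 * t1 - real d * (2 * w2 * t2) + t1\<^sup>2 - real d * t2\<^sup>2"
    by (simp add: power2_eq_square algebra_simps)
  moreover have "margin w1 w2 h = \<bar>w1\<^sup>2 - real d * w2\<^sup>2\<bar> + (2 * h * \<bar>w1\<bar> + 2 * h * (real d * \<bar>w2\<bar>))
      + (h\<^sup>2 + real d * h\<^sup>2)"
    unfolding margin_def by (simp add: algebra_simps)
  ultimately show ?thesis using sum[OF linear zero_le_power2 quadratic(1) _ quadratic(2)] by simp
qed

lemma margin_ok_iff:
  assumes "m > 0"
  shows "margin_ok d y1 y2 r m \<longleftrightarrow> margin (of_int y1 / of_int m) (of_int y2 / of_int m) (of_int r / of_int m) < 1"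
proof -
  let ?x = "\<bar>y1\<^sup>2 - int d * y2\<^sup>2\<bar> + 2 * r * (\<bar>y1\<bar> + int d * \<bar>y2\<bar>) + (1 + int d) * r\<^sup>2"
  have "(of_int y1 / of_int m)\<^sup>2 - real d * (of_int y2 / of_int m)\<^sup>2
      = of_int (y1\<^sup>2 - int d * y2\<^sup>2) / (of_int m)\<^sup>2"
    by (simp add: power_divide diff_divide_distrib)
  moreover have "2 * (of_int r / of_int m) * (\<bar>of_int y1 / of_int m\<bar> + real d * \<bar>of_int y2 / of_int m\<bar>)
     = of_int (2 * r * (\<bar>y1\<bar> + int d * \<bar>y2\<bar>)) / (of_int m)\<^sup>2"
    using assms by (simp add: power2_eq_square field_simps)
  moreover have "(1 + real d) * (of_int r / of_int m)\<^sup>2 = of_int ((1 + int d) * r\<^sup>2) / (of_int m)\<^sup>2"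
    by (simp add: power_divide)
  ultimately have "margin (of_int y1 / of_int m) (of_int y2 / of_int m) (of_int r / of_int m)
      = of_int ?x / of_int (m\<^sup>2)"
    unfolding margin_def by (simp add: abs_divide add_divide_distrib)
  moreover have "of_int ?x / real_of_int (m\<^sup>2) < 1 \<longleftrightarrow> real_of_int ?x < of_int (m\<^sup>2)"
    using assms by (subst divide_less_eq_1_pos) auto
  ultimately show ?thesis unfolding margin_ok_def by (simp only: of_int_less_iff)
qed

text \<open>
  The coordinates of \<open>x - q\<close> and of \<open>1 - u * (x - q)\<close> with respect to \<open>1\<close> and \<open>\<surd>d\<close>, as functions of the
  coordinates \<open>a, b\<close> of \<open>x\<close>.
\<close>

definition step1 :: "nat \<Rightarrow> real \<Rightarrow> real \<Rightarrow> real \<times> real" where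
  "step1 k a b = (a - of_int (num1 k) / of_int (den k), b - of_int (num2 k) / of_int (den k))"

definition step2 :: "nat \<Rightarrow> nat \<Rightarrow> real \<Rightarrow> real \<Rightarrow> real \<times> real" where
  "step2 k l a b =
     (1 - (of_int (num1 l) / of_int (den l) * fst (step1 k a b) + real d * (of_int (num2 l) / of_int (den l)) * snd (step1 k a b)),
      - (of_int (num1 l) / of_int (den l) * snd (step1 k a b) + of_int (num2 l) / of_int (den l) * fst (step1 k a b)))"

text \<open>
  The amount by which the coordinates of \<open>u * x\<close> change at most when those of \<open>x\<close> change by at most 1.
\<close>

definition slope :: "nat \<Rightarrow> real" where
  "slope l = \<bar>of_int (num1 l) / of_int (den l)\<bar> + real d * \<bar>of_int (num2 l) / of_int (den l)\<bar>"

definition nrm :: "real \<times> real \<Rightarrow> real" where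
  "nrm v = (fst v)\<^sup>2 - real d * (snd v)\<^sup>2"

lemma nrm_conjugates: "(a + b * rd) * (a - b * rd) = nrm (a, b)"
proof -
  have "(a + b * rd) * (a - b * rd) = a\<^sup>2 - b\<^sup>2 * (rd * rd)" by (simp add: power2_eq_square algebra_simps del: real_sqrt_mult_self)
  then show ?thesis by (simp add: nrm_def mult.commute)
qed

lemma step1_conjugates:
  "(a + b * rd - elt k) * (a - b * rd - cj (elt k)) = nrm (step1 k a b)"
  using nrm_conjugates[of "fst (step1 k a b)" "snd (step1 k a b)"]
  unfolding cj_elt_coords unfolding elt_coords step1_def fst_conv snd_conv by (simp add: algebra_simps)

lemma step2_conjugates:
  "(1 - elt l * (a + b * rd - elt k)) * (1 - cj (elt l) * (a - b * rd - cj (elt k))) = nrm (step2 k l a b)"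
proof -
  define u1 u2 where "u1 = real_of_int (num1 l) / of_int (den l)" and "u2 = real_of_int (num2 l) / of_int (den l)"
  define x1 x2 where "x1 = fst (step1 k a b)" and "x2 = snd (step1 k a b)"
  have x: "a + b * rd - elt k = x1 + x2 * rd" "a - b * rd - cj (elt k) = x1 - x2 * rd"
    unfolding cj_elt_coords by (simp_all add: x1_def x2_def step1_def elt_coords algebra_simps)
  have "u2 * rd * (x2 * rd) = u2 * x2 * real d" by simp
  then have "1 - elt l * (x1 + x2 * rd) = (1 - (u1 * x1 + real d * u2 * x2)) + (- (u1 * x2 + u2 * x1)) * rd"
    "1 - cj (elt l) * (x1 - x2 * rd) = (1 - (u1 * x1 + real d * u2 * x2)) - (- (u1 * x2 + u2 * x1)) * rd"
    unfolding cj_elt_coords unfolding elt_coords u1_def[symmetric] u2_def[symmetric]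
    by (simp_all add: algebra_simps)
  then show ?thesis unfolding x
    by (simp only: nrm_conjugates) (simp add: step2_def u1_def u2_def x1_def x2_def)
qed

lemma square_ok_iff:
  assumes w: "w > 0"
  shows "square_ok d w i j k l \<longleftrightarrow> elt k \<in> OK \<and> elt l \<in> OK \<and>
    (margin (fst (step1 k (real i / real w) (real j / real w))) (snd (step1 k (real i / real w) (real j / real w))) (1 / real w) < 1 \<or>
     margin (fst (step2 k l (real i / real w) (real j / real w))) (snd (step2 k l (real i / real w) (real j / real w))) (slope l / real w) < 1)"
proof -
  let ?y1 = "int i * den k - int w * num1 k" and ?y2 = "int j * den k - int w * num2 k" and ?m = "int w * den k"
  have m: "?m > 0" "den l * ?m > 0" using w den_pos by simp_all
  have nz: "real_of_int (den k) \<noteq> 0" "real_of_int (den l) \<noteq> 0" "real w \<noteq> 0" using w den_pos[of k] den_pos[of l] by auto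
  have 1: "fst (step1 k (real i / real w) (real j / real w)) = of_int ?y1 / of_int ?m"
    "snd (step1 k (real i / real w) (real j / real w)) = of_int ?y2 / of_int ?m"
    "1 / real w = of_int (den k) / of_int ?m"
    using nz by (simp_all add: step1_def field_simps)
  have combine: "1 - (real_of_int n1 / of_int l' * (of_int y1 / of_int m') + real d * (of_int n2 / of_int l') * (of_int y2 / of_int m'))
        = of_int (l' * m' - (n1 * y1 + int d * n2 * y2)) / of_int (l' * m')"
    "- (real_of_int n1 / of_int l' * (of_int y2 / of_int m') + of_int n2 / of_int l' * (of_int y1 / of_int m'))
        = of_int (- (n1 * y2 + n2 * y1)) / of_int (l' * m')"
    if "real_of_int l' \<noteq> 0" "m' \<noteq> 0" for n1 n2 y1 y2 l' m'
    using that by (simp_all add: field_simps)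
  have 2: "fst (step2 k l (real i / real w) (real j / real w))
      = of_int (den l * ?m - (num1 l * ?y1 + int d * num2 l * ?y2)) / of_int (den l * ?m)"
    "snd (step2 k l (real i / real w) (real j / real w))
      = of_int (- (num1 l * ?y2 + num2 l * ?y1)) / of_int (den l * ?m)"
    unfolding step2_def fst_conv snd_conv 1 using combine nz(2) m(1) by (metis less_irrefl of_int_0_eq_iff)+
  have 3: "slope l / real w = of_int ((\<bar>num1 l\<bar> + int d * \<bar>num2 l\<bar>) * den k) / of_int (den l * ?m)"
    using nz den_pos[of l] by (simp add: slope_def abs_divide field_simps)
  show ?thesis
    unfolding square_ok_def Let_def 2 3 unfolding 1 integral_code_iff
    unfolding margin_ok_iff[OF m(1)] margin_ok_iff[OF m(2)] by blast
qed

lemma covered_square: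
  assumes w: "w > 0" and ok: "square_ok d w i j k l"
    and a: "real i / real w \<le> a" "a \<le> real i / real w + 1 / real w"
    and b: "real j / real w \<le> b" "b \<le> real j / real w + 1 / real w"
  shows "elt k \<in> OK" "elt l \<in> OK" "\<bar>nrm (step1 k a b)\<bar> < 1 \<or> \<bar>nrm (step2 k l a b)\<bar> < 1"
proof -
  let ?a = "real i / real w" and ?b = "real j / real w"
  show "elt k \<in> OK" "elt l \<in> OK" using ok square_ok_iff[OF w] by auto
  define t1 t2 where "t1 = a - ?a" and "t2 = b - ?b"
  define h where "h = 1 / real w"
  have t: "\<bar>t1\<bar> \<le> h" "\<bar>t2\<bar> \<le> h" using a b by (simp_all add: t1_def t2_def h_def)
  define u1 u2 where "u1 = real_of_int (num1 l) / of_int (den l)" and "u2 = real_of_int (num2 l) / of_int (den l)"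
  have s1: "step1 k a b = (fst (step1 k ?a ?b) + t1, snd (step1 k ?a ?b) + t2)"
    by (simp add: step1_def t1_def t2_def)
  have s2: "step2 k l a b = (fst (step2 k l ?a ?b) + (- (u1 * t1 + real d * u2 * t2)),
      snd (step2 k l ?a ?b) + (- (u1 * t2 + u2 * t1)))"
    unfolding step2_def s1 by (simp add: u1_def u2_def algebra_simps)
  have "\<bar>u1 * t1\<bar> \<le> \<bar>u1\<bar> * h" "\<bar>u1 * t2\<bar> \<le> \<bar>u1\<bar> * h"
    "\<bar>real d * u2 * t2\<bar> \<le> real d * \<bar>u2\<bar> * h" "\<bar>u2 * t1\<bar> \<le> \<bar>u2\<bar> * h"
    using t by (auto simp: abs_mult intro!: mult_left_mono)
  moreover have "\<bar>u2\<bar> * h \<le> real d * \<bar>u2\<bar> * h"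
    using d_gt_1 by (intro mult_right_mono) (auto simp: mult_le_cancel_right1 h_def)
  moreover have "slope l / real w = \<bar>u1\<bar> * h + real d * \<bar>u2\<bar> * h"
    by (simp add: slope_def u1_def u2_def h_def add_divide_distrib)
  ultimately have t': "\<bar>- (u1 * t1 + real d * u2 * t2)\<bar> \<le> slope l / real w"
    "\<bar>- (u1 * t2 + u2 * t1)\<bar> \<le> slope l / real w" by linarith+
  from margin_bound[OF t[unfolded h_def]] margin_bound[OF t'] ok
  show "\<bar>nrm (step1 k a b)\<bar> < 1 \<or> \<bar>nrm (step2 k l a b)\<bar> < 1"
    unfolding square_ok_iff[OF w] s1 s2 nrm_def fst_conv snd_conv by (meson le_less_trans)
qed

text \<open>
  A lattice translation moves \<open>\<alpha> / \<beta>\<close> into the unit square; the region that contains its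
  small square yields the quotients of a chain.
\<close>

lemma certificate_sound:
  assumes "certificate d w" shows "two_stage_euclidean K"
  unfolding two_stage_euclidean_def
proof (intro ballI impI)
  fix \<alpha> \<beta> assume \<alpha>\<beta>: "\<alpha> \<in> OK" "\<beta> \<in> OK" "\<beta> \<noteq> 0"
  have w: "w > 0" using assms by (simp add: certificate_def)
  have "\<alpha> / \<beta> \<in> K" using \<alpha>\<beta> OK_in_K by auto
  then obtain a b where ab: "\<alpha> / \<beta> = of_rat a + of_rat b * rd" unfolding K_coords by blast
  have corner: "\<exists>i<w. real i / real w \<le> frac x \<and> frac x \<le> real i / real w + 1 / real w" for x :: real
  proof -
    define i where "i = nat \<lfloor>frac x * real w\<rfloor>"
    have "0 \<le> frac x * real w" using frac_ge_0[of x] by simp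
    then have i: "real i \<le> frac x * real w" "frac x * real w \<le> real i + 1" unfolding i_def by linarith+
    have "frac x * real w < real w" using frac_lt_1[of x] w by simp
    then have "i < w" using i by linarith
    moreover have "real i / real w \<le> frac x" using i(1) w by (simp add: pos_divide_le_eq)
    moreover have "frac x \<le> real i / real w + 1 / real w"
      using i(2) w by (simp add: pos_le_divide_eq flip: add_divide_distrib)
    ultimately show ?thesis by blast
  qed
  define a' b' where "a' = frac (of_rat a :: real)" and "b' = frac (of_rat b :: real)"
  obtain i j where ij: "i < w" "j < w" "real i / real w \<le> a'" "a' \<le> real i / real w + 1 / real w"
    "real j / real w \<le> b'" "b' \<le> real j / real w + 1 / real w"
    using corner[of "of_rat a"] corner[of "of_rat b"] unfolding a'_def b'_def by blast
  obtain c where c: "square_ok d w i j (fst (prod_decode c)) (snd (prod_decode c))"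
    using assms ij(1,2) unfolding certificate_def by blast
  define k l where "k = fst (prod_decode c)" and "l = snd (prod_decode c)"
  note cov = covered_square[OF w c ij(3-6), folded k_def l_def]
  define z where "z = of_int \<lfloor>of_rat a :: real\<rfloor> + of_int \<lfloor>of_rat b :: real\<rfloor> * rd"
  have zO: "z \<in> OK" unfolding z_def by (intro Zs_in_OK Zs_coords)
  define q where "q = z + elt k"
  define r where "r = \<alpha> - q * \<beta>"
  define r' where "r' = \<beta> - elt l * r"
  have O: "q \<in> OK" "r \<in> OK" "r' \<in> OK" unfolding q_def r_def r'_def
    by (intro OK_closed zO cov \<alpha>\<beta>)+
  have x: "\<alpha> / \<beta> - z = a' + b' * rd"
    unfolding ab z_def a'_def b'_def frac_def by (simp add: algebra_simps)
  have zK: "z \<in> K" "elt k \<in> K" "elt l \<in> K" "\<alpha> \<in> K" "\<beta> \<in> K" using zO \<alpha>\<beta> OK_in_K elt_in_K by auto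
  have "cj (\<alpha> / \<beta>) - cj z = a' - b' * rd"
    unfolding ab z_def cj_Zs_coords cj_coords a'_def b'_def frac_def by (simp add: algebra_simps)
  then have x': "cj (\<alpha> / \<beta> - z) = a' - b' * rd" using zK by (simp add: cj_diff)
  define y where "y = \<alpha> / \<beta> - z - elt k"
  have yK: "y \<in> K" unfolding y_def using zK by auto
  have cy: "cj y = a' - b' * rd - cj (elt k)" unfolding y_def using zK x' by (simp add: cj_diff)
  have r: "r = \<beta> * y" unfolding r_def q_def y_def using \<alpha>\<beta>(3) by (simp add: field_simps)
  have r': "r' = \<beta> * (1 - elt l * y)" unfolding r'_def r by (simp add: algebra_simps)
  have \<beta>pos: "\<bar>\<beta> * cj \<beta>\<bar> > 0" using \<alpha>\<beta>(3) cj_eq_0_iff[OF zK(5)] by simp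
  have small: "\<bar>\<beta> * t * cj (\<beta> * t)\<bar> < \<bar>\<beta> * cj \<beta>\<bar>" if "\<bar>t * cj t\<bar> < 1" "t \<in> K" for t
  proof -
    have "\<bar>\<beta> * t * cj (\<beta> * t)\<bar> = \<bar>\<beta> * cj \<beta>\<bar> * \<bar>t * cj t\<bar>"
      using that(2) zK(5) by (simp add: cj_mult abs_mult)
    then show ?thesis using that(1) \<beta>pos by (simp only: mult_less_cancel_left1) simp
  qed
  from cov(3) show "(\<exists>q1 r1. division_chain1 K \<alpha> \<beta> q1 r1 \<and> decreasing K \<beta> r1) \<or>
      (\<exists>q1 q2 r1 r2. division_chain2 K \<alpha> \<beta> q1 q2 r1 r2 \<and> decreasing K \<beta> r2)"
  proof
    assume "\<bar>nrm (step1 k a' b')\<bar> < 1"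
    then have "\<bar>y * cj y\<bar> < 1" unfolding cy unfolding y_def x by (simp add: step1_conjugates)
    from small[OF this yK] have "decreasing K \<beta> r" using O OK_in_K zK(5) by (simp add: decreasing_iff r)
    moreover have "division_chain1 K \<alpha> \<beta> q r" unfolding division_chain1_def using O by (simp add: r_def)
    ultimately show ?thesis by blast
  next
    assume "\<bar>nrm (step2 k l a' b')\<bar> < 1"
    then have "\<bar>(1 - elt l * y) * (1 - cj (elt l) * cj y)\<bar> < 1"
      unfolding cy unfolding y_def x by (simp add: step2_conjugates)
    moreover have "cj (1 - elt l * y) = 1 - cj (elt l) * cj y" "1 - elt l * y \<in> K"
      using yK zK by (auto simp: cj_simps)
    ultimately have "decreasing K \<beta> r'"
      using small[of "1 - elt l * y"] O(3) OK_in_K zK(5) by (simp add: decreasing_iff r')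
    moreover have "division_chain2 K \<alpha> \<beta> q (elt l) r r'"
      unfolding division_chain2_def using O cov(2) by (simp add: r_def r'_def)
    ultimately show ?thesis by blast
  qed
qed

text \<open>
  Only points of \<open>K\<close> depend on the assumption. They are written as \<open>(D * x) / D\<close> with a positive integer
  \<open>D\<close>, and a chain for this pair is divided by \<open>D\<close>.
\<close>

lemma plane_covered:
  assumes "two_stage_euclidean K"
  shows "\<exists>k l. elt k \<in> OK \<and> elt l \<in> OK \<and> (\<bar>nrm (step1 k a b)\<bar> < 1 \<or> \<bar>nrm (step2 k l a b)\<bar> < 1)"
proof (cases "(a + b * rd, a - b * rd) \<in> emb ` K")
  case False
  from outside_field_covered[OF this] obtain q u where qu: "q \<in> Zs" "u \<in> Zs"
    "\<bar>(1 - u * (a + b * rd - q)) * (1 - cj u * (a - b * rd - cj q))\<bar> < 1"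
    unfolding chain2_region_def by auto
  obtain k l where "elt k = q" "elt l = u" using elt_surj qu Zrd_in_K by metis
  then show ?thesis using qu Zs_in_OK step2_conjugates[of l a b k] by metis
next
  case True
  then obtain x where x: "x \<in> K" "x = a + b * rd" "cj x = a - b * rd" by (auto simp: emb_def)
  obtain D where D: "D > 0" "real D * x \<in> Zs" using K_denominator[OF x(1)] .
  have DO: "real D \<in> OK" "real D * x \<in> OK" "real D \<noteq> 0" using D Zs_in_OK Zs_closed(2) by auto
  have O0: "0 \<in> OK" using Zs_in_OK Zs_closed(3) by blast
  obtain l0 where l0: "elt l0 = 0" using elt_surj K_closed(1) by blast
  have cancel: "\<bar>t * cj t\<bar> < 1" if "t \<in> K" "\<bar>(real D * t) * cj (real D * t)\<bar> < \<bar>real D * cj (real D)\<bar>" for t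
  proof -
    have "(real D * t) * cj (real D * t) = (real D * cj (real D)) * (t * cj t)"
      using that(1) by (simp add: cj_mult)
    then have "\<bar>real D * cj (real D)\<bar> * \<bar>t * cj t\<bar> < \<bar>real D * cj (real D)\<bar> * 1"
      using that(2) by (simp only: abs_mult mult_1_right)
    then show ?thesis using mult_less_cancel_left_pos[of "\<bar>real D * cj (real D)\<bar>"] D(1) by simp
  qed
  show ?thesis using assms DO(2,1,3)
  proof (cases rule: two_stage_decreasing)
    case (one q r)
    obtain k where k: "elt k = q" using elt_surj one(1) OK_in_K by blast
    have "r = real D * (x - q)" using one(3) by (simp add: algebra_simps)
    then have "\<bar>(x - q) * cj (x - q)\<bar> < 1"
      using one(1,4) x(1) OK_in_K cancel[of "x - q"] by auto
    then have "\<bar>nrm (step1 k a b)\<bar> < 1"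
      using step1_conjugates[of a b k] x one(1) OK_in_K by (simp add: k cj_diff)
    then show ?thesis using k one(1) l0 O0 by metis
  next
    case (two q q' r r')
    obtain k l where kl: "elt k = q" "elt l = q'" using elt_surj two(1,2) OK_in_K by metis
    have qK: "q \<in> K" "q' \<in> K" using two OK_in_K by auto
    have "r = real D * (x - q)" using two(5) by (simp add: algebra_simps)
    moreover have "r' = real D - q' * r" using two(6) by simp
    ultimately have r': "r' = real D * (1 - q' * (x - q))" by (simp add: right_diff_distrib mult.left_commute)
    have "1 - q' * (x - q) \<in> K" using qK x(1) by auto
    from cancel[OF this] have "\<bar>(1 - q' * (x - q)) * cj (1 - q' * (x - q))\<bar> < 1"
      using two(7) unfolding r' by blast
    then have "\<bar>nrm (step2 k l a b)\<bar> < 1"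
      using step2_conjugates[of l a b k] x qK by (simp add: kl cj_simps)
    then show ?thesis using kl two(1,2) by metis
  qed
qed

text \<open>
  The mesh size becomes a third coordinate \<open>h\<close>. For \<open>h = 0\<close> the margin is the norm itself, so the open
  sets \<open>U c\<close> cover the compact square at height \<open>0\<close>; finitely many of them also cover a
  neighbourhood of the square, which contains the corners of every sufficiently fine subdivision at height
  \<open>1 / w\<close>.
\<close>

lemma certificate_complete:
  assumes "two_stage_euclidean K" shows "\<exists>w. certificate d w"
proof -
  define U where "U c = (let k = fst (prod_decode c); l = snd (prod_decode c) in
    {(a, b, h). elt k \<in> OK \<and> elt l \<in> OK \<and>
      (margin (fst (step1 k a b)) (snd (step1 k a b)) h < 1 \<or>
       margin (fst (step2 k l a b)) (snd (step2 k l a b)) (slope l * h) < 1)})" for c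
  have openU: "open (U c)" for c
  proof -
    define k l where "k = fst (prod_decode c)" and "l = snd (prod_decode c)"
    have 1: "continuous_on UNIV (\<lambda>v. margin (fst (step1 k (fst v) (fst (snd v)))) (snd (step1 k (fst v) (fst (snd v)))) (snd (snd v)))"
      unfolding margin_def step1_def fst_conv snd_conv by (intro continuous_intros)
    have 2: "continuous_on UNIV (\<lambda>v. margin (fst (step2 k l (fst v) (fst (snd v)))) (snd (step2 k l (fst v) (fst (snd v)))) (slope l * snd (snd v)))"
      unfolding margin_def step1_def step2_def fst_conv snd_conv by (intro continuous_intros)
    have "U c = (if elt k \<in> OK \<and> elt l \<in> OK then
      {v. margin (fst (step1 k (fst v) (fst (snd v)))) (snd (step1 k (fst v) (fst (snd v)))) (snd (snd v)) < 1} \<union>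
      {v. margin (fst (step2 k l (fst v) (fst (snd v)))) (snd (step2 k l (fst v) (fst (snd v)))) (slope l * snd (snd v)) < 1} else {})"
      by (auto simp: U_def Let_def k_def l_def)
    then show ?thesis using open_Collect_less[OF 1 continuous_on_const] open_Collect_less[OF 2 continuous_on_const] by auto
  qed
  define S where "S = {0..1::real} \<times> {0..1::real} \<times> {0::real}"
  have compS: "compact S" unfolding S_def by (intro compact_Times) auto
  have "S \<subseteq> (\<Union>c. U c)"
  proof
    fix v assume "v \<in> S"
    then obtain a b where v: "v = (a, b, 0)" unfolding S_def by auto
    obtain k l where "elt k \<in> OK" "elt l \<in> OK" "\<bar>nrm (step1 k a b)\<bar> < 1 \<or> \<bar>nrm (step2 k l a b)\<bar> < 1"
      using plane_covered[OF assms] by blast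
    then have "v \<in> U (prod_encode (k, l))" by (simp add: U_def v margin_def nrm_def)
    then show "v \<in> (\<Union>c. U c)" by blast
  qed
  then obtain C where C: "finite C" "S \<subseteq> (\<Union>c\<in>C. U c)"
    using compactE_image[OF compS, of UNIV U] openU by auto
  have "closed (- (\<Union>c\<in>C. U c))" using openU by (intro closed_Compl open_UN) auto
  moreover have "S \<inter> - (\<Union>c\<in>C. U c) = {}" using C(2) by blast
  ultimately obtain \<eta> where \<eta>: "\<eta> > 0" "\<And>x y. x \<in> S \<Longrightarrow> y \<in> - (\<Union>c\<in>C. U c) \<Longrightarrow> \<eta> \<le> dist x y"
    using separate_compact_closed[OF compS] by metis
  obtain N where N: "\<forall>c\<in>C. c < N" using C(1) unfolding finite_nat_set_iff_bounded by (elim exE)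
  obtain N' where N': "real N' > 1 / \<eta>" using reals_Archimedean2 by blast
  define w where "w = Suc (N + N')"
  have w: "w > 0" by (simp add: w_def)
  have "real w > 1 / \<eta>" using N' by (simp add: w_def)
  then have w\<eta>: "1 / real w < \<eta>" using \<eta>(1) w by (simp add: field_simps)
  have "\<exists>c<w. square_ok d w i j (fst (prod_decode c)) (snd (prod_decode c))" if ij: "i < w" "j < w" for i j
  proof -
    let ?x = "(real i / real w, real j / real w, 0::real)" and ?y = "(real i / real w, real j / real w, 1 / real w)"
    have "?x \<in> S" using ij by (auto simp: S_def)
    moreover have "dist ?x ?y = 1 / real w" by (simp add: dist_prod_def dist_real_def)
    ultimately have "?y \<in> (\<Union>c\<in>C. U c)" using \<eta>(2)[of ?x ?y] w\<eta> by fastforce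
    then obtain c where c: "c \<in> C" "?y \<in> U c" by blast
    then have "square_ok d w i j (fst (prod_decode c)) (snd (prod_decode c))"
      unfolding square_ok_iff[OF w] by (simp add: U_def Let_def)
    then show ?thesis using bspec[OF N c(1)] by (intro exI[of _ c]) (simp add: w_def)
  qed
  then show ?thesis using w unfolding certificate_def by blast
qed

theorem two_stage_iff_certificate: "two_stage_euclidean K \<longleftrightarrow> (\<exists>w. certificate d w)"
  using certificate_sound certificate_complete by blast

end

section \<open>The programs that search for certificates and expansions\<close>

lemma int_computable_code:
  assumes "computable k f"
  shows "int_computable k (\<lambda>xs. num1 (f xs))" "int_computable k (\<lambda>xs. num2 (f xs))"
    "int_computable k (\<lambda>xs. den (f xs))"
  unfolding num1_def num2_def den_def by (intro computable_intros assms)+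

lemma decidable_integral_code:
  assumes "computable k d" "computable k f" shows "decidable k (\<lambda>xs. integral_code (d xs) (f xs))"
  unfolding integral_code_def by (intro computable_intros int_computable_code assms)

lemma decidable_margin_ok:
  assumes "computable k d" "int_computable k y1" "int_computable k y2" "int_computable k r" "int_computable k m"
  shows "decidable k (\<lambda>xs. margin_ok (d xs) (y1 xs) (y2 xs) (r xs) (m xs))"
  unfolding margin_ok_def by (intro computable_intros assms)

lemma decidable_square_ok:
  assumes "computable k d" "computable k w" "computable k i" "computable k j" "computable k a" "computable k b"
  shows "decidable k (\<lambda>xs. square_ok (d xs) (w xs) (i xs) (j xs) (a xs) (b xs))"
  unfolding square_ok_def Let_def
  by (intro decidable_and decidable_or decidable_integral_code decidable_margin_ok int_computable_diff
      int_computable_mult int_computable_add int_computable_uminus int_computable_abs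
      int_computable_of_nat int_computable_code assms)

lemma decidable_certificate: "decidable (Suc 1) (\<lambda>ys. certificate (tl ys ! 0) (ys ! 0))"
  unfolding certificate_def
  by (intro decidable_and decidable_less decidable_all decidable_ex decidable_square_ok
      computable_prod_decode computable_const computable_nth computable_tl) simp_all

definition same_code :: "nat \<Rightarrow> nat \<Rightarrow> bool" where
  "same_code x k \<longleftrightarrow> num1 x * den k = num1 k * den x \<and> num2 x * den k = num2 k * den x"

text \<open>
  The code of \<open>1 / (x - k)\<close>. The sign of the norm \<open>N\<close> of the numerator of \<open>x - k\<close> moves to the numerator
  of the result, as denominators of codes are positive.
\<close>

definition invert_code :: "nat \<Rightarrow> nat \<Rightarrow> nat \<Rightarrow> nat" where
  "invert_code d x k =
     (let a = num1 x * den k - num1 k * den x; b = num2 x * den k - num2 k * den x;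
          N = a\<^sup>2 - int d * b\<^sup>2; c = (if N < 0 then - (den x * den k) else den x * den k)
      in prod_encode (int_encode (c * a), prod_encode (int_encode (- (c * b)), nat \<bar>N\<bar> - 1)))"

definition tail_code :: "nat \<Rightarrow> nat" where
  "tail_code m = snd (prod_decode (m - 1))"

definition head_code :: "nat \<Rightarrow> nat" where
  "head_code m = fst (prod_decode (m - 1))"

text \<open>
  A state pairs the code of the current complete quotient with the code of the partial quotients
  that are still to be read; the empty remainder marks failure. The last partial quotient stays
  in place, so that surplus steps do no harm.
\<close>

definition expansion_step :: "nat \<Rightarrow> nat \<Rightarrow> nat" where
  "expansion_step d v =
     (let x = fst (prod_decode v); m = snd (prod_decode v) in
      if tail_code m = 0 then v
      else if integral_code d (head_code m) \<and> \<not> same_code x (head_code m)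
      then prod_encode (invert_code d x (head_code m), tail_code m)
      else prod_encode (x, 0))"

definition expansion_done :: "nat \<Rightarrow> nat \<Rightarrow> bool" where
  "expansion_done d v \<longleftrightarrow>
     (let x = fst (prod_decode v); m = snd (prod_decode v) in
      0 < m \<and> tail_code m = 0 \<and> integral_code d (head_code m) \<and> same_code x (head_code m))"

definition is_expansion :: "nat \<Rightarrow> nat \<Rightarrow> nat \<Rightarrow> bool" where
  "is_expansion d x m \<longleftrightarrow>
     expansion_done d (rec_nat (prod_encode (x, m)) (\<lambda>_. expansion_step d) m)"

lemma decidable_is_expansion: "decidable (Suc 3) (\<lambda>ys. is_expansion (tl ys ! 0) (tl ys ! 2) (ys ! 0))"
proof -
  have same: "decidable k (\<lambda>xs. same_code (f xs) (g xs))" if "computable k f" "computable k g" for k f g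
    unfolding same_code_def using that by (intro computable_intros int_computable_code)
  have inv: "computable k (\<lambda>xs. invert_code (d xs) (f xs) (g xs))"
    if "computable k d" "computable k f" "computable k g" for k d f g
    unfolding invert_code_def Let_def using that
    by (intro computable_intros int_computable_code int_computable_of_nat[OF computable_const[of _ 0], simplified])
  have ht: "computable k (\<lambda>xs. tail_code (f xs))" "computable k (\<lambda>xs. head_code (f xs))"
    if "computable k f" for k f
    unfolding tail_code_def head_code_def by (intro computable_intros that)+
  have step: "computable k (\<lambda>xs. expansion_step (d xs) (f xs))" if "computable k d" "computable k f" for k d f
    unfolding expansion_step_def Let_def using that
    by (intro computable_If computable_prod_encode computable_prod_decode decidable_eq decidable_and
        decidable_not decidable_integral_code same inv ht computable_const)
  have fin: "decidable k (\<lambda>xs. expansion_done (d xs) (f xs))" if "computable k d" "computable k f" for k d f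
    unfolding expansion_done_def Let_def using that
    by (intro computable_prod_decode decidable_less decidable_eq decidable_and
        decidable_integral_code same ht computable_const)
  show ?thesis
    unfolding is_expansion_def
    by (intro fin computable_rec_nat computable_prod_encode step computable_nth computable_tl) simp_all
qed

text \<open>
  Continued fractions are evaluated from the right, but an expansion of a given element can be verified
  from the left by computing its complete quotients; this is the order in which lists are decoded.
\<close>

fun expands :: "nat \<Rightarrow> nat \<Rightarrow> nat list \<Rightarrow> bool" where
  "expands d x [] = False"
| "expands d x [k] = (integral_code d k \<and> same_code x k)"
| "expands d x (k # k' # ks) = (integral_code d k \<and> \<not> same_code x k \<and> expands d (invert_code d x k) (k' # ks))"

lemma expansion_step_fixed: "tail_code (snd (prod_decode v)) = 0 \<Longrightarrow> (expansion_step d ^^ N) v = v"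
  by (induction N) (auto simp: expansion_step_def Let_def)

lemma code_Cons: "tail_code (list_encode (k # ks)) = list_encode ks" "head_code (list_encode (k # ks)) = k"
  by (simp_all add: tail_code_def head_code_def)

lemma tail_code_0: "tail_code 0 = 0"
  using le_prod_encode_2[of "snd (prod_decode 0)" "fst (prod_decode 0)"] by (simp add: tail_code_def)

lemma expansion_iterate:
  "length ks \<le> N \<Longrightarrow> expansion_done d ((expansion_step d ^^ N) (prod_encode (x, list_encode ks))) \<longleftrightarrow> expands d x ks"
proof (induction d x ks arbitrary: N rule: expands.induct)
  case (1 d x)
  then show ?case by (simp add: expansion_step_fixed tail_code_0 expansion_done_def)
next
  case (2 d x k)
  have "tail_code (list_encode [k]) = 0" using code_Cons(1)[of k "[]"] by simp
  moreover have "head_code (list_encode [k]) = k" "list_encode [k] > 0" using code_Cons(2)[of k "[]"] by auto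
  ultimately show ?case by (simp add: expansion_step_fixed expansion_done_def Let_def del: list_encode.simps)
next
  case (3 d x k k' ks)
  then obtain N' where N': "N = Suc N'" "length (k' # ks) \<le> N'" by (cases N) auto
  let ?m = "list_encode (k # k' # ks)"
  have m: "tail_code ?m = list_encode (k' # ks)" "head_code ?m = k" "list_encode (k' # ks) \<noteq> 0"
    using code_Cons[of k "k' # ks"] by auto
  have step: "expansion_step d (prod_encode (x, ?m)) =
      (if integral_code d k \<and> \<not> same_code x k then prod_encode (invert_code d x k, list_encode (k' # ks))
       else prod_encode (x, 0))"
    using m by (simp add: expansion_step_def Let_def del: list_encode.simps)
  show ?case
  proof (cases "integral_code d k \<and> \<not> same_code x k")
    case True
    then show ?thesis
      using 3 N' step by (simp add: funpow_Suc_right del: funpow.simps list_encode.simps)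
  next
    case False
    then have "(expansion_step d ^^ N) (prod_encode (x, ?m)) = prod_encode (x, 0)"
      using step[unfolded if_not_P[OF False]] by (simp add: N' funpow_Suc_right expansion_step_fixed tail_code_0 del: funpow.simps list_encode.simps)
    then show ?thesis using False by (auto simp: expansion_done_def simp del: list_encode.simps)
  qed
qed

lemma length_le_list_encode: "length ks \<le> list_encode ks"
proof (induction ks)
  case (Cons k ks)
  then show ?case using le_prod_encode_2[of "list_encode ks" k] by simp
qed simp

lemma is_expansion_iff: "is_expansion d x m \<longleftrightarrow> expands d x (list_decode m)"
proof -
  have "rec_nat v (\<lambda>_. f) N = (f ^^ N) v" for v :: nat and f N by (induction N) auto
  then show ?thesis
    using expansion_iterate[of "list_decode m" m d x] length_le_list_encode[of "list_decode m"]
    by (simp add: is_expansion_def)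
qed

context quadratic
begin

lemma same_code_iff: "same_code x k \<longleftrightarrow> elt x = elt k"
proof -
  have dn: "real_of_int (den x) \<noteq> 0" "real_of_int (den k) \<noteq> 0" using den_pos[of x] den_pos[of k] by auto
  have "elt x = elt k \<longleftrightarrow> (of_int (num1 x) + of_int (num2 x) * rd) * of_int (den k) =
      (of_int (num1 k) + of_int (num2 k) * rd) * of_int (den x)"
    unfolding elt_eq using dn by (simp add: frac_eq_eq)
  also have "\<dots> \<longleftrightarrow> of_rat (of_int (num1 x * den k)) + of_rat (of_int (num2 x * den k)) * rd
      = of_rat (of_int (num1 k * den x)) + of_rat (of_int (num2 k * den x)) * rd"
    unfolding of_rat_of_int_eq unfolding of_int_mult distrib_right by (simp only: mult_ac)
  also have "\<dots> \<longleftrightarrow> num1 x * den k = num1 k * den x \<and> num2 x * den k = num2 k * den x"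
    using coords_unique by (metis of_int_eq_iff)
  finally show ?thesis by (simp add: same_code_def)
qed

lemma elt_invert_code:
  assumes "elt x \<noteq> elt k" shows "elt (invert_code d x k) = 1 / (elt x - elt k)"
proof -
  define a b where "a = num1 x * den k - num1 k * den x" and "b = num2 x * den k - num2 k * den x"
  define N where "N = a\<^sup>2 - int d * b\<^sup>2"
  define c where "c = den x * den k"
  have c: "c > 0" using den_pos by (simp add: c_def)
  have diff: "elt x - elt k = (of_int a + of_int b * rd) / of_int c"
    using den_pos[of x] den_pos[of k] unfolding elt_eq a_def b_def c_def by (simp add: field_simps)
  have ab: "(of_int a + of_int b * rd) * (of_int a - of_int b * rd) = real_of_int N"
    using norm_Zs_coords[of a b] unfolding cj_Zs_coords N_def by (simp add: power2_eq_square)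
  have nz: "of_int a + of_int b * rd \<noteq> 0" using diff assms by auto
  then have "of_int a - of_int b * rd \<noteq> 0"
    using cj_eq_0_iff[OF Zrd_in_K[OF Zs_coords[of a b]]] unfolding cj_Zs_coords by blast
  then have N: "N \<noteq> 0" using ab nz by auto
  have inv: "1 / (elt x - elt k) = of_int c * (of_int a - of_int b * rd) / of_int N"
    unfolding diff ab[symmetric] using \<open>of_int a - of_int b * rd \<noteq> 0\<close> by simp
  define c' where "c' = (if N < 0 then - c else c)"
  have "elt (invert_code d x k) = (of_int (c' * a) + of_int (- (c' * b)) * rd) / real (Suc (nat \<bar>N\<bar> - 1))"
    unfolding element_of_code_def invert_code_def Let_def
    by (simp add: a_def b_def N_def c_def c'_def)
  also have "real (Suc (nat \<bar>N\<bar> - 1)) = of_int \<bar>N\<bar>" using N by simp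
  also have "(of_int (c' * a) + of_int (- (c' * b)) * rd) / of_int \<bar>N\<bar> = of_int c * (of_int a - of_int b * rd) / of_int N"
    using N by (simp add: c'_def field_simps)
  finally show ?thesis using inv by simp
qed

lemma continued_fraction_Cons_iff:
  "continued_fraction (q # q' # qs) = Some x \<longleftrightarrow>
     x \<noteq> q \<and> continued_fraction (q' # qs) = Some (1 / (x - q))"
  by (auto split: option.splits)

lemma expands_iff:
  "expands d x ks \<longleftrightarrow> set (map elt ks) \<subseteq> OK \<and> continued_fraction (map elt ks) = Some (elt x)"
proof (induction ks arbitrary: x rule: induct_list012)
  case (3 k k' ks)
  show ?case
  proof (cases "elt x = elt k")
    case True
    then show ?thesis using continued_fraction_Cons_iff[of "elt k" "elt k'" "map elt ks" "elt x"]
      by (simp add: same_code_iff del: continued_fraction.simps)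
  next
    case False
    then show ?thesis
      using 3(2)[of "invert_code d x k"] elt_invert_code[OF False]
        continued_fraction_Cons_iff[of "elt k" "elt k'" "map elt ks" "elt x"]
      by (auto simp: same_code_iff integral_code_iff simp del: continued_fraction.simps)
  qed
qed (auto simp: same_code_iff integral_code_iff)

lemma expansion_exists:
  assumes "two_stage_euclidean K" shows "\<exists>m. is_expansion d x m"
proof -
  obtain D where D: "D > 0" "real D * elt x \<in> Zs" using K_denominator[OF elt_in_K] .
  then obtain qs where qs: "set qs \<subseteq> OK" "continued_fraction qs = Some (elt x)"
    using continued_fraction_exists[OF assms Zs_in_OK[OF D(2)] Zs_in_OK[OF Zs_closed(2)[of D]]] by auto
  have "\<forall>q\<in>set qs. \<exists>k. elt k = q" using qs(1) elt_surj OK_in_K by blast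
  then obtain f where f: "\<And>q. q \<in> set qs \<Longrightarrow> elt (f q) = q" by metis
  then have "map elt (map f qs) = qs" by (simp add: map_idI)
  then have "is_expansion d x (list_encode (map f qs))"
    unfolding is_expansion_iff expands_iff using qs by simp
  then show ?thesis by blast
qed

end

theorem theorem1:
  shows "\<exists>P Q :: recf. \<forall>F d. real_quadratic_field F \<and> field_code F d \<longrightarrow>
    (halts P [d] \<longleftrightarrow> two_stage_euclidean F) \<and>
    (two_stage_euclidean F \<longrightarrow>
      (\<forall>s. eval_recf P [d] = Some s \<longrightarrow>
        (\<forall>x\<in>F. \<forall>n. element_of_code d n = x \<longrightarrow>
          (\<exists>m qs. eval_recf Q [d, s, n] = Some m \<and>
             qs = map (element_of_code d) (list_decode m) \<and>
             set qs \<subseteq> ring_of_integers F \<and>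
             continued_fraction qs = Some x))))"
proof -
  obtain P where P: "\<And>xs. length xs = 1 \<Longrightarrow> eval_recf P xs =
      (if \<exists>w. certificate (xs ! 0) w then Some (LEAST w. certificate (xs ! 0) w) else None)"
    using semidecide_by_search[of 1 "\<lambda>w xs. certificate (xs ! 0) w", OF decidable_certificate] by blast
  obtain Q where Q: "\<And>xs. length xs = 3 \<Longrightarrow> eval_recf Q xs =
      (if \<exists>m. is_expansion (xs ! 0) (xs ! 2) m then Some (LEAST m. is_expansion (xs ! 0) (xs ! 2) m) else None)"
    using semidecide_by_search[of 3 "\<lambda>m xs. is_expansion (xs ! 0) (xs ! 2) m", OF decidable_is_expansion] by blast
  show ?thesis
  proof (rule exI[of _ P], rule exI[of _ Q], intro allI impI)
    fix F d assume "real_quadratic_field F \<and> field_code F d"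
    then have d: "1 < d" "squarefree d" and F: "F = rat_sqrt d"
      using real_quadratic_field_eq_rat_sqrt by (auto simp: field_code_def)
    interpret quadratic d by unfold_locales (fact d)+
    have "halts P [d] \<longleftrightarrow> two_stage_euclidean F"
      unfolding halts_def F two_stage_iff_certificate using P[of "[d]"] by simp
    moreover have "\<exists>m qs. eval_recf Q [d, t, k] = Some m \<and>
             qs = map (element_of_code d) (list_decode m) \<and>
             set qs \<subseteq> ring_of_integers F \<and> continued_fraction qs = Some x"
      if "two_stage_euclidean F" and x: "element_of_code d k = x" for t x k
    proof -
      have ex: "\<exists>m. is_expansion d k m" using expansion_exists that F by simp
      define m where "m = (LEAST m. is_expansion d k m)"
      have "eval_recf Q [d, t, k] = Some m" using Q[of "[d, t, k]"] ex by (simp add: m_def)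
      moreover have "is_expansion d k m" unfolding m_def using ex by (rule LeastI_ex)
      ultimately show ?thesis
        unfolding is_expansion_iff expands_iff F using x by blast
    qed
    ultimately show "(halts P [d] \<longleftrightarrow> two_stage_euclidean F) \<and>
      (two_stage_euclidean F \<longrightarrow>
        (\<forall>s. eval_recf P [d] = Some s \<longrightarrow>
          (\<forall>x\<in>F. \<forall>n. element_of_code d n = x \<longrightarrow>
            (\<exists>m qs. eval_recf Q [d, s, n] = Some m \<and>
               qs = map (element_of_code d) (list_decode m) \<and>
               set qs \<subseteq> ring_of_integers F \<and>
               continued_fraction qs = Some x))))"
      by blast
  qed
qed

end
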